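(* Let $n\in\{2,3\}$, $\lambda_0,\Gamma_0,\alpha\in\mathbb R$, $\Gamma_2,\beta>0$, and consider the system (disordered isotropic state $v=0$) $$u_t+\lambda_0(u\cdot\nabla)u+(\alpha+\beta|u|^2)u-\Gamma_0\Delta u+\Gamma_2\Delta^2u+\nabla q=0,\quad\operatorname{div}u=0,\quad u(0)=u_0,$$ equivalently $u_t+A_du+\beta P(|u|^2u)+\lambda_0P((u\cdot\nabla)u)=0$ in $\mathrm{FM}_{0,\sigma}(\mathbb R^n)$. Then the zero solution is (1) exponentially stable in $\mathrm{FM}_{0,\sigma}(\mathbb R^n)$ if $\Gamma_0<0$ and $4\alpha>\Gamma_0^2/\Gamma_2$, or if $\Gamma_0\ge0$ and $\alpha>0$: there are $\kappa,C,\omega>0$ such that for all $u_0\in\mathrm{FM}_{0,\sigma}$ with $\|u_0\|_{\mathrm{FM}}<\kappa$ the solution is global and $\|u(t)\|_{\mathrm{FM}}\le Ce^{-\omega t}\|u_0\|_{\mathrm{FM}}$ for $t\ge0$; (2) unstable in $X_\gamma:=\mathrm{FM}^{4\gamma}(\mathbb R^n)\cap\mathrm{FM}_{0,\sigma}(\mathbb R^n)$ for every $\gamma\in[1/4,1)$ if $\Gamma_0<0$ and $4\alpha<\Gamma_0^2/\Gamma_2$, or if $\Gamma_0\ge0$ and $\alpha<0$.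
   Context: $\mathrm M(\mathbb R^n)$: finite vector valued Radon measures with total variation norm; $\mathrm M_0=\{\mu:\mu(\{0\})=0\}$; $\mu\lfloor\psi$ is the measure with density $\psi$ w.r.t. $\mu$. $\mathrm{FM}=\{\hat\mu:\mu\in\mathrm M\}$ with $\|u\|_{\mathrm{FM}}=\|\mathcal F^{-1}u\|_{\mathrm M}$, $\mathrm{FM}_0=\{\hat\mu:\mu\in\mathrm M_0\}$; for $s\ge0$, $\mathrm{FM}^s=\{u\in\mathrm{FM}:\hat u\lfloor|\xi|^s\in\mathrm M\}$ normed by $\|u\|_{\mathrm{FM}}+\|\hat u\lfloor|\xi|^s\|_{\mathrm M}$. Helmholtz projection $Pu=\mathcal F^{-1}(\hat u\lfloor(I-\xi\xi^T/|\xi|^2))$; $\mathrm{FM}_{0,\sigma}=\{u\in\mathrm{FM}_0(\mathbb R^n,\mathbb C^n):\operatorname{div}u=0\}$. $A_du=\alpha u-\Gamma_0\Delta u+\Gamma_2\Delta^2u$ on $D(A_d)=\mathrm{FM}_{0,\sigma}\cap\mathrm{FM}^4$. Solutions are the (mild/maximal strong) solutions of the projected equation. "Unstable in $X_\gamma$" means Lyapunov instability: there is $\varepsilon>0$ such that for every $\delta>0$ there exists $u_0\in X_\gamma$ with $\|u_0\|_{X_\gamma}<\delta$ whose solution $u$ satisfies $\|u(t)\|_{X_\gamma}\ge\varepsilon$ for some $t$ in its maximal existence interval (or does not exist globally). *)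

theory Defs
  imports "HOL-Analysis.Analysis"
begin

type_synonym 'n vfield = "real^('n::finite) \<Rightarrow> complex^'n"

text \<open>A finite C^n-valued Radon measure mu on R^n is represented in polar form
  mu = g . nu with nu a finite positive Borel measure and g in L^1(nu).\<close>

definition fm_rep :: "(real^('n::finite)) measure \<Rightarrow> (real^'n \<Rightarrow> complex^'n) \<Rightarrow> bool" where
  "fm_rep \<nu> g \<longleftrightarrow> sets \<nu> = sets borel \<and> finite_measure \<nu> \<and> integrable \<nu> g"

definition fm_of :: "(real^('n::finite)) measure \<Rightarrow> (real^'n \<Rightarrow> complex^'n) \<Rightarrow> ('n::finite) vfield" where
  "fm_of \<nu> g = (\<lambda>x. \<integral>\<xi>. (\<chi> i. cis (- (x \<bullet> \<xi>)) * (g \<xi> $ i)) \<partial>\<nu>)"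

definition fm_reps :: "('n::finite) vfield \<Rightarrow> ((real^'n) measure \<times> (real^'n \<Rightarrow> complex^'n)) set" where
  "fm_reps u = {(\<nu>, g). fm_rep \<nu> g \<and> fm_of \<nu> g = u}"

definition FM :: "('n::finite) vfield set" where
  "FM = {u. fm_reps u \<noteq> {}}"

text \<open>FM norm = total variation of the inverse Fourier transform.\<close>
definition FM_norm :: "('n::finite) vfield \<Rightarrow> real" where
  "FM_norm u = (INF p \<in> fm_reps u. \<integral>\<xi>. norm (snd p \<xi>) \<partial>(fst p))"

definition FM0 :: "('n::finite) vfield set" where
  "FM0 = {u. \<exists>(\<nu>, g) \<in> fm_reps u. (\<integral>\<xi>. indicator {0} \<xi> *\<^sub>R g \<xi> \<partial>\<nu>) = 0}"

text \<open>div u = 0, expressed on the Fourier side: xi . mu = 0.\<close>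
definition FM0_sigma :: "('n::finite) vfield set" where
  "FM0_sigma = {u. \<exists>(\<nu>, g) \<in> fm_reps u. (\<integral>\<xi>. indicator {0} \<xi> *\<^sub>R g \<xi> \<partial>\<nu>) = 0 \<and>
      (AE \<xi> in \<nu>. (\<Sum>i\<in>UNIV. complex_of_real (\<xi> $ i) * (g \<xi> $ i)) = 0)}"

definition FMs :: "real \<Rightarrow> ('n::finite) vfield set" where
  "FMs s = {u. \<exists>(\<nu>, g) \<in> fm_reps u. integrable \<nu> (\<lambda>\<xi>. norm \<xi> powr s * norm (g \<xi>))}"

definition FMs_norm :: "real \<Rightarrow> ('n::finite) vfield \<Rightarrow> real" where
  "FMs_norm s u = FM_norm u +
     (INF p \<in> fm_reps u. \<integral>\<xi>. norm \<xi> powr s * norm (snd p \<xi>) \<partial>(fst p))"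

text \<open>Fourier multiplier: mu |-> m(xi) mu (well defined since the measure is unique).\<close>
definition fm_mult :: "(real^'n \<Rightarrow> complex^'n \<Rightarrow> complex^'n) \<Rightarrow> ('n::finite) vfield \<Rightarrow> ('n::finite) vfield" where
  "fm_mult m u = (let p = (SOME p. p \<in> fm_reps u) in fm_of (fst p) (\<lambda>\<xi>. m \<xi> (snd p \<xi>)))"

definition A_d :: "real \<Rightarrow> real \<Rightarrow> real \<Rightarrow> ('n::finite) vfield \<Rightarrow> ('n::finite) vfield" where
  "A_d \<alpha> \<Gamma>0 \<Gamma>2 = fm_mult (\<lambda>\<xi> v. (\<alpha> + \<Gamma>0 * norm \<xi> ^ 2 + \<Gamma>2 * norm \<xi> ^ 4) *\<^sub>R v)"

definition helmholtz :: "('n::finite) vfield \<Rightarrow> ('n::finite) vfield" where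
  "helmholtz = fm_mult (\<lambda>\<xi> v. if \<xi> = 0 then 0 else
      (\<chi> j. v $ j - (\<Sum>i\<in>UNIV. complex_of_real (\<xi> $ i * \<xi> $ j / (norm \<xi>)\<^sup>2) * v $ i)))"

definition pdiff :: "'n \<Rightarrow> ('n::finite) vfield \<Rightarrow> ('n::finite) vfield" where
  "pdiff i u = (\<lambda>x. vector_derivative (\<lambda>t. u (x + t *\<^sub>R axis i 1)) (at 0))"

definition cubic :: "('n::finite) vfield \<Rightarrow> ('n::finite) vfield" where
  "cubic u = (\<lambda>x. (\<Sum>i\<in>UNIV. (cmod (u x $ i))\<^sup>2) *\<^sub>R u x)"

definition advect :: "('n::finite) vfield \<Rightarrow> ('n::finite) vfield" where
  "advect u = (\<lambda>x. \<chi> j. \<Sum>i\<in>UNIV. u x $ i * pdiff i u x $ j)"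

text \<open>Strong solution on [0,T) of u_t + A_d u + beta P(|u|^2u) + lam0 P((u.nabla)u) = 0,
  with phase space S normed by N (continuity at t >= 0 in N), u(t) in D(A_d) for t > 0,
  differentiable in FM and satisfying the equation in FM for t > 0.\<close>
definition strong_sol ::
  "('n::finite) vfield set \<Rightarrow> (('n::finite) vfield \<Rightarrow> real) \<Rightarrow> real \<Rightarrow> real \<Rightarrow> real \<Rightarrow> real \<Rightarrow> real \<Rightarrow>
   ereal \<Rightarrow> ('n::finite) vfield \<Rightarrow> (real \<Rightarrow> ('n::finite) vfield) \<Rightarrow> bool" where
  "strong_sol S N \<alpha> \<Gamma>0 \<Gamma>2 \<beta> lam0 T u0 u \<longleftrightarrow>
     u 0 = u0 \<and>
     (\<forall>t. 0 \<le> t \<and> ereal t < T \<longrightarrow> u t \<in> S \<and>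
        ((\<lambda>s. N (\<lambda>x. u s x - u t x)) \<longlongrightarrow> 0) (at t within {s. 0 \<le> s \<and> ereal s < T})) \<and>
     (\<forall>t. 0 < t \<and> ereal t < T \<longrightarrow> u t \<in> FMs 4 \<inter> FM0_sigma \<and>
        (\<exists>u'. u' \<in> FM \<and>
           ((\<lambda>h. FM_norm (\<lambda>x. (u (t + h) x - u t x) /\<^sub>R h - u' x)) \<longlongrightarrow> 0) (at 0) \<and>
           (\<forall>x. u' x + A_d \<alpha> \<Gamma>0 \<Gamma>2 (u t) x + \<beta> *\<^sub>R helmholtz (cubic (u t)) x
                 + lam0 *\<^sub>R helmholtz (advect (u t)) x = 0)))"

end

theory Submission
  imports Defs "HOL-Probability.Probability"
begin

text \<open>All estimates take place in the total variation norm of the Fourier transforms, where the symbol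
  \<open>symb\<close> of \<open>A_d\<close> controls any lower order term.

  Stability. Expand the solution in the initial data. The terms are indexed by trees whose leaves carry
  the initial measure and whose nodes are the quadratic and cubic nonlinearities, so the mild equation
  becomes a structural recursion, to be solved separately for every tree and every choice of frequencies
  at its leaves. As \<open>div u = 0\<close>, the advection term loses only one power of the total frequency
  \<open>\<xi>\<close>; if \<open>symb \<xi> \<ge> 2 m (1 + |\<xi>|)\<close>, Duhamel's integral regains it uniformly in time even with the weight
  \<open>exp (m t (1 + |\<xi>|))\<close>. Summing over trees reduces to the scalar equation
  \<open>S = N + K (S\<^sup>2 + S\<^sup>3)\<close>, and the weight yields both the exponential decay and, for positive times,
  enough smoothness for the series to be a strong solution.

  Instability. A solenoidal plane wave \<open>r(t) c exp (- i x \<cdot> \<xi>)\<close> has no advection term, and \<open>r\<close> solves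
  the Bernoulli equation \<open>r' = - symb \<xi> r - \<beta> r\<^sup>3\<close>. If \<open>symb \<xi> < 0\<close>, then \<open>r\<close> tends to
  \<open>sqrt (- symb \<xi> / \<beta>)\<close> however small \<open>r 0 > 0\<close> is, and by uniqueness every strong solution with these
  initial data is this one.\<close>

section \<open>Uniqueness of Fourier transforms of measures\<close>

text \<open>\<open>FM\<close> knows a measure only through pairs \<open>(\<nu>, g)\<close>: norms
  are infima over them and \<open>fm_mult\<close> picks one arbitrarily, so nothing can be computed
  before pairs with the same transform are known to define the same measure. After that, fields are
  carried by arbitrary measure spaces through \<open>lift\<close>, where a product of fields is a
  product space with added frequencies, and are pushed forward to R^n only when membership or a norm
  is needed.

  Trees replace a fixed point argument among measure-valued curves: for a fixed tree and fixed leaf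
  frequencies the mild equation is an explicit integral of curves in C^n, and smallness is needed
  only to sum over trees. All trees share the space of sequences of independent frequencies; a node
  distributes the coordinates by parity among its subtrees, so a product of series is again a series
  on that space.

  For instability every strong solution with the given data has to be excluded. One that stays below
  \<epsilon> in FM^(4\<gamma>), with 4\<gamma> \<ge> 1, has a bounded gradient in FM, which is the
  bound that uniqueness requires.\<close>

text \<open>Closure of the characters under linear combinations and bounded pointwise limits; it turns out
  to contain all bounded Borel functions.\<close>

inductive_set trig_class :: "('a::euclidean_space \<Rightarrow> complex) set" where
  char: "(\<lambda>\<xi>. cis (- (x \<bullet> \<xi>))) \<in> trig_class"
| add: "f \<in> trig_class \<Longrightarrow> g \<in> trig_class \<Longrightarrow> (\<lambda>\<xi>. f \<xi> + g \<xi>) \<in> trig_class"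
| scale: "f \<in> trig_class \<Longrightarrow> (\<lambda>\<xi>. c * f \<xi>) \<in> trig_class"
| lim: "(\<And>k::nat. F k \<in> trig_class) \<Longrightarrow> (\<And>k \<xi>. cmod (F k \<xi>) \<le> B) \<Longrightarrow>
    (\<And>\<xi>. (\<lambda>k. F k \<xi>) \<longlonglongrightarrow> f \<xi>) \<Longrightarrow> f \<in> trig_class"

lemma trig_class_bounded: "f \<in> trig_class \<Longrightarrow> \<exists>B. \<forall>\<xi>. cmod (f \<xi>) \<le> B"
proof (induction rule: trig_class.induct)
  case (char x)
  show ?case by (intro exI[of _ 1]) simp
next
  case (add f g)
  then obtain A B where "\<forall>\<xi>. cmod (f \<xi>) \<le> A" "\<forall>\<xi>. cmod (g \<xi>) \<le> B" by blast
  then show ?case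
    by (intro exI[of _ "A + B"] allI norm_triangle_mono) auto
next
  case (scale f c)
  then obtain A where "\<forall>\<xi>. cmod (f \<xi>) \<le> A" by blast
  then show ?case
    by (intro exI[of _ "cmod c * A"]) (auto simp: norm_mult intro: mult_left_mono)
next
  case (lim F B f)
  show ?case
    by (intro exI[of _ B] allI tendsto_upperbound[OF tendsto_norm[OF lim(3)]]) (auto simp: lim(2))
qed

lemma trig_class_measurable: "f \<in> trig_class \<Longrightarrow> f \<in> borel_measurable borel"
proof (induction rule: trig_class.induct)
  case (char x)
  show ?case by (intro borel_measurable_continuous_onI continuous_intros)
next
  case (lim F B f)
  show ?case by (rule borel_measurable_LIMSEQ_metric[OF lim(4)]) (use lim in auto)
qed auto

text \<open>Products are not among the rules, but two nested inductions reduce them to characters,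
  where the product is the character of \<open>x + y\<close>. The class thus becomes an algebra,
  which polynomial approximation and finite unions require. In the limit case the bound of the fixed
  factor keeps the products bounded.\<close>

lemma trig_class_mult:
  assumes "f \<in> trig_class" "g \<in> trig_class"
  shows "(\<lambda>\<xi>. f \<xi> * g \<xi>) \<in> trig_class"
  using assms
proof (induction rule: trig_class.induct)
  case (char x)
  show ?case using char(1)
  proof (induction rule: trig_class.induct)
    case (char y)
    have "(\<lambda>\<xi>. cis (- (x \<bullet> \<xi>)) * cis (- (y \<bullet> \<xi>))) = (\<lambda>\<xi>. cis (- ((x + y) \<bullet> \<xi>)))"
      by (auto simp: cis_mult inner_add_left)
    then show ?case using trig_class.char[of "x + y"] by simp
  next
    case (add f g)
    then show ?case using trig_class.add by (simp add: distrib_left)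
  next
    case (scale f c)
    then show ?case using trig_class.scale[OF scale(2), of c] by (simp add: mult_ac)
  next
    case (lim F B f)
    show ?case
      by (rule trig_class.lim[OF lim(4), where B = B])
        (auto simp: norm_mult lim(2) intro!: tendsto_intros lim(3))
  qed
next
  case (add f1 f2)
  then show ?case using trig_class.add by (simp add: distrib_right)
next
  case (scale f c)
  then show ?case using trig_class.scale[OF scale(2), of c] by (simp add: mult_ac)
next
  case (lim F B f)
  obtain C where C: "\<And>\<xi>. cmod (g \<xi>) \<le> C" using trig_class_bounded[OF lim(5)] by blast
  have "0 \<le> B" using lim(2) norm_ge_zero order_trans by blast
  show ?case
    by (rule trig_class.lim[OF lim(4)[OF lim(5)], where B = "B * C"])
      (auto simp: norm_mult lim(2) C \<open>0 \<le> B\<close> intro!: mult_mono tendsto_intros lim(3))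
qed

lemma trig_class_const: "(\<lambda>_. c) \<in> trig_class"
  using trig_class.scale[OF trig_class.char[of 0], of c] by simp

lemma trig_class_sum:
  "(\<And>i. i \<in> I \<Longrightarrow> f i \<in> trig_class) \<Longrightarrow> (\<lambda>\<xi>. \<Sum>i\<in>I. f i \<xi>) \<in> trig_class"
  by (induction I rule: infinite_finite_induct) (auto intro: trig_class_const trig_class.add)

lemma trig_class_prod:
  "(\<And>i. i \<in> I \<Longrightarrow> f i \<in> trig_class) \<Longrightarrow> (\<lambda>\<xi>. \<Prod>i\<in>I. f i \<xi>) \<in> trig_class"
  by (induction I rule: infinite_finite_induct) (auto intro: trig_class_const trig_class_mult)

lemma trig_class_diff:
  assumes "f \<in> trig_class" "g \<in> trig_class"
  shows "(\<lambda>\<xi>. f \<xi> - g \<xi>) \<in> trig_class"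
  using trig_class.add[OF assms(1) trig_class.scale[OF assms(2), of "-1"]] by simp

text \<open>A bounded real function from which linear functionals can be recovered by scaling;
  Weierstrass approximation needs its argument in a compact interval, so the linear functional
  itself would not do.\<close>

lemma trig_class_sin: "(\<lambda>\<xi>. complex_of_real (sin (y \<bullet> \<xi>))) \<in> trig_class"
proof -
  have "(\<lambda>\<xi>. (\<i>/2) * (cis (- (y \<bullet> \<xi>)) - cis (- (- y \<bullet> \<xi>)))) \<in> trig_class"
    by (intro trig_class.scale trig_class_diff trig_class.char)
  moreover have "(\<i>/2) * (cis (- (y \<bullet> \<xi>)) - cis (- (- y \<bullet> \<xi>))) = complex_of_real (sin (y \<bullet> \<xi>))" for \<xi>
    by (auto simp: complex_eq_iff)
  ultimately show ?thesis by simp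
qed

lemma trig_class_polynomial:
  assumes "real_polynomial_function (p::real\<Rightarrow>real)"
    and h: "(\<lambda>\<xi>. complex_of_real (h \<xi>)) \<in> trig_class"
  shows "(\<lambda>\<xi>. complex_of_real (p (h \<xi>))) \<in> trig_class"
  using assms(1)
proof (induction rule: real_polynomial_function.induct)
  case (linear f)
  then obtain c where "f = (\<lambda>x. x * c)" by (auto simp: real_bounded_linear)
  then show ?case using trig_class.scale[OF h, of c] by (simp add: mult.commute)
qed (auto intro: trig_class_const trig_class.add trig_class_mult)

text \<open>Polynomials in \<open>h\<close> belong to the class, and since \<open>h\<close> takes
  values in a compact interval they approximate \<open>\<phi>\<close> of \<open>h\<close> uniformly.
  The bound \<open>B + 1\<close> allows for an approximation error of at most 1.\<close>

lemma trig_class_continuous_bounded: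
  fixes \<phi> :: "real \<Rightarrow> real"
  assumes h: "(\<lambda>\<xi>. complex_of_real (h \<xi>)) \<in> trig_class"
    and hb: "\<And>\<xi>. \<bar>h \<xi>\<bar> \<le> L" and \<phi>: "continuous_on UNIV \<phi>"
  shows "(\<lambda>\<xi>. complex_of_real (\<phi> (h \<xi>))) \<in> trig_class"
proof -
  have "\<exists>q. real_polynomial_function q \<and> (\<forall>x\<in>{-L..L}. \<bar>\<phi> x - q x\<bar> < 1 / Suc k)" for k :: nat
    by (rule Stone_Weierstrass_real_polynomial_function[of "{-L..L}" \<phi> "1 / Suc k"])
       (use \<phi> in \<open>auto intro: continuous_on_subset\<close>)
  then obtain q where q: "\<And>k. real_polynomial_function (q k)"
    "\<And>k x. x \<in> {-L..L} \<Longrightarrow> \<bar>\<phi> x - q k x\<bar> < 1 / Suc k" by metis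
  obtain B where B: "\<And>x. x \<in> {-L..L} \<Longrightarrow> \<bar>\<phi> x\<bar> \<le> B"
    using compact_continuous_image[OF continuous_on_subset[OF \<phi>, of "{-L..L}"]]
    by (fastforce simp: bounded_iff dest!: compact_imp_bounded)
  have hL: "h \<xi> \<in> {-L..L}" for \<xi> using hb[of \<xi>] by auto
  show ?thesis
  proof (rule trig_class.lim[where F = "\<lambda>k \<xi>. complex_of_real (q k (h \<xi>))" and B = "B + 1"])
    show "(\<lambda>\<xi>. complex_of_real (q k (h \<xi>))) \<in> trig_class" for k
      using q(1) h by (rule trig_class_polynomial)
    show "cmod (complex_of_real (q k (h \<xi>))) \<le> B + 1" for k \<xi>
    proof -
      have "\<bar>\<phi> (h \<xi>) - q k (h \<xi>)\<bar> < 1"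
        using less_le_trans[OF q(2)[OF hL[of \<xi>], of k], of 1] by simp
      then show ?thesis using B[OF hL[of \<xi>]] by simp
    qed
    show "(\<lambda>k. complex_of_real (q k (h \<xi>))) \<longlonglongrightarrow> complex_of_real (\<phi> (h \<xi>))" for \<xi>
    proof (rule tendsto_of_real, rule Lim_transform)
      show "(\<lambda>k. \<phi> (h \<xi>)) \<longlonglongrightarrow> \<phi> (h \<xi>)" by simp
      show "(\<lambda>k. q k (h \<xi>) - \<phi> (h \<xi>)) \<longlonglongrightarrow> 0"
        by (rule Lim_null_comparison[OF _ LIMSEQ_Suc[OF lim_1_over_n]])
          (use q(2)[OF hL[of \<xi>]] in \<open>auto simp: abs_minus_commute less_imp_le\<close>)
    qed
  qed
qed

lemma tendsto_scaled_sin: "(\<lambda>k. real (Suc k) * sin (s / real (Suc k))) \<longlonglongrightarrow> s"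
proof -
  have "((\<lambda>x::real. sin (s * x)) has_real_derivative s) (at 0)"
    by (auto intro!: derivative_eq_intros)
  then have "((\<lambda>x. sin (s * x) / x) \<longlongrightarrow> s) (at 0)"
    by (simp add: has_field_derivative_iff)
  moreover have "filterlim (\<lambda>k. 1 / real (Suc k)) (at 0) sequentially"
    by (rule filterlim_atI[OF LIMSEQ_Suc[OF lim_1_over_n]]) auto
  ultimately have "(\<lambda>k. sin (s * (1 / real (Suc k))) / (1 / real (Suc k))) \<longlonglongrightarrow> s"
    by (rule filterlim_compose)
  then show ?thesis by (simp add: mult.commute)
qed

text \<open>The functional \<open>y \<bullet> \<xi>\<close> is unbounded, so it is replaced by
  \<open>real (Suc k) * sin ((y \<bullet> \<xi>) / real (Suc k))\<close>, which is bounded by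
  \<open>real (Suc k)\<close> and converges to it; boundedness of \<open>\<phi>\<close> supplies the
  uniform bound that the limit rule asks for.\<close>

lemma trig_class_continuous:
  fixes \<phi> :: "real \<Rightarrow> real"
  assumes \<phi>: "continuous_on UNIV \<phi>" and b: "\<And>x. \<bar>\<phi> x\<bar> \<le> B"
  shows "(\<lambda>\<xi>. complex_of_real (\<phi> (y \<bullet> \<xi>))) \<in> trig_class"
proof (rule trig_class.lim[where F = "\<lambda>k \<xi>. complex_of_real (\<phi> (real (Suc k) * sin ((y \<bullet> \<xi>) / real (Suc k))))" and B = B])
  fix k :: nat
  have "(\<lambda>\<xi>. complex_of_real (real (Suc k)) * complex_of_real (sin ((y /\<^sub>R real (Suc k)) \<bullet> \<xi>))) \<in> trig_class"
    by (intro trig_class.scale trig_class_sin)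
  then have "(\<lambda>\<xi>. complex_of_real (real (Suc k) * sin ((y \<bullet> \<xi>) / real (Suc k)))) \<in> trig_class"
    by (simp add: divide_inverse mult.commute)
  then show "(\<lambda>\<xi>. complex_of_real (\<phi> (real (Suc k) * sin ((y \<bullet> \<xi>) / real (Suc k))))) \<in> trig_class"
    by (rule trig_class_continuous_bounded[OF _ _ \<phi>, where L = "real (Suc k)"])
       (simp add: abs_mult mult_left_le)
next
  show "(\<lambda>k. complex_of_real (\<phi> (real (Suc k) * sin ((y \<bullet> \<xi>) / real (Suc k))))) \<longlonglongrightarrow> complex_of_real (\<phi> (y \<bullet> \<xi>))" for \<xi>
    by (rule tendsto_of_real, rule isCont_tendsto_compose[OF _ tendsto_scaled_sin])
       (use \<phi> in \<open>simp add: continuous_on_eq_continuous_at\<close>)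
qed (use b in auto)

text \<open>Ramps of slope \<open>k\<close>, cut off at 0 and 1, are continuous and bounded and tend
  pointwise to the indicator because the half-space is open: on its boundary every ramp is
  0.\<close>

lemma trig_class_halfspace: "(\<lambda>\<xi>. indicator {x. x \<bullet> y < a} \<xi>) \<in> trig_class"
proof (rule trig_class.lim[where F = "\<lambda>k \<xi>. complex_of_real (min 1 (max 0 (real k * (a - y \<bullet> \<xi>))))" and B = 1])
  show "(\<lambda>\<xi>. complex_of_real (min 1 (max 0 (real k * (a - y \<bullet> \<xi>))))) \<in> trig_class" for k
    by (rule trig_class_continuous[where B = 1]) (auto intro!: continuous_intros)
  show "(\<lambda>k. complex_of_real (min 1 (max 0 (real k * (a - y \<bullet> \<xi>))))) \<longlonglongrightarrow> indicator {x. x \<bullet> y < a} \<xi>" for \<xi>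
  proof (cases "\<xi> \<bullet> y < a")
    case True
    then have pos: "a - y \<bullet> \<xi> > 0" by (simp add: inner_commute)
    obtain m :: nat where m: "1 / (a - y \<bullet> \<xi>) < real m" using reals_Archimedean2 by blast
    have "\<forall>\<^sub>F k in sequentially. complex_of_real (min 1 (max 0 (real k * (a - y \<bullet> \<xi>)))) = 1"
      using eventually_ge_at_top[of m]
    proof eventually_elim
      case (elim k)
      have "1 < real m * (a - y \<bullet> \<xi>)" using m pos by (simp add: divide_simps)
      also have "\<dots> \<le> real k * (a - y \<bullet> \<xi>)" using elim pos by (intro mult_right_mono) auto
      finally show ?case by simp
    qed
    then show ?thesis using True by (auto intro: tendsto_eventually)
  next
    case False
    then have "real k * (a - y \<bullet> \<xi>) \<le> 0" for k
      by (simp add: inner_commute mult_nonneg_nonpos)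
    then have "complex_of_real (min 1 (max 0 (real k * (a - y \<bullet> \<xi>)))) = 0" for k
      by (simp add: max_absorb1)
    then show ?thesis using False by simp
  qed
qed auto

lemma trig_class_indicator:
  assumes "A \<in> sets (borel :: 'a::euclidean_space measure)"
  shows "(\<lambda>\<xi>. indicator A \<xi>) \<in> trig_class"
proof -
  have "A \<in> sigma_sets UNIV ((\<lambda>(a, i). {x::'a. x \<bullet> i < a}) ` (UNIV \<times> Basis))"
    using assms by (simp add: borel_eq_halfspace_less)
  then show ?thesis
  proof (induction rule: sigma_sets.induct)
    case (Basic a)
    then show ?case using trig_class_halfspace by auto
  next
    case Empty
    then show ?case using trig_class_const[of 0] by simp
  next
    case (Compl a)
    have "(\<lambda>\<xi>. indicator (UNIV - a) \<xi>) = (\<lambda>\<xi>. 1 - indicator a \<xi> :: complex)"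
      by (auto simp: indicator_def)
    then show ?case using trig_class_diff[OF trig_class_const[of 1] Compl(2)] by simp
  next
    case (Union a)
    show ?case
    \<comment> \<open>The sets need not be disjoint, so finite unions are built from products of the
      indicators of complements rather than from sums.\<close>
    proof (rule trig_class.lim[where F = "\<lambda>k \<xi>. 1 - (\<Prod>i<k. 1 - indicator (a i) \<xi>)" and B = 1])
      show "(\<lambda>\<xi>. 1 - (\<Prod>i<k. 1 - indicator (a i) \<xi>)) \<in> trig_class" for k
        by (intro trig_class_diff trig_class_const trig_class_prod Union)
      have *: "(\<Prod>i<k. 1 - indicator (a i) \<xi>) = (if \<xi> \<in> (\<Union>i<k. a i) then 0 else 1 :: complex)" for k \<xi>
        by (auto simp: indicator_def intro!: prod.neutral)
      then show "cmod (1 - (\<Prod>i<k. 1 - indicator (a i) \<xi>)) \<le> 1" for k \<xi> by simp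
      show "(\<lambda>k. 1 - (\<Prod>i<k. 1 - indicator (a i) \<xi>)) \<longlonglongrightarrow> (indicator (\<Union> (range a)) \<xi> :: complex)" for \<xi>
      proof (cases "\<xi> \<in> \<Union> (range a)")
        case True
        then obtain i where i: "\<xi> \<in> a i" by auto
        have "\<forall>\<^sub>F k in sequentially. 1 - (\<Prod>i<k. 1 - indicator (a i) \<xi>) = (1::complex)"
          using eventually_gt_at_top[of i] unfolding * by eventually_elim (use i in auto)
        moreover have "indicator (\<Union> (range a)) \<xi> = (1::complex)" using True by simp
        ultimately show ?thesis by (simp only: tendsto_eventually)
      next
        case False
        then show ?thesis unfolding * by simp
      qed
    qed
  qed
qed

lemma trig_class_borel:
  fixes f :: "'a::euclidean_space \<Rightarrow> complex"
  assumes f: "f \<in> borel_measurable borel" and B: "\<And>\<xi>. cmod (f \<xi>) \<le> B"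
  shows "f \<in> trig_class"
proof -
  obtain F where F: "\<And>i. simple_function borel (F i)" "\<And>x. (\<lambda>i. F i x) \<longlonglongrightarrow> f x"
     "\<And>i x. dist (F i x) 0 \<le> 2 * dist (f x) 0"
    using borel_measurable_implies_sequence_metric[OF f, of 0] by auto
  show ?thesis
  \<comment> \<open>The approximating simple functions obey |F k| \<le> 2 |f|, whence the bound
    \<open>2 * B\<close>.\<close>
  proof (rule trig_class.lim[OF _ _ F(2), where B = "2 * B"])
    fix k
    have "F k = (\<lambda>\<xi>. \<Sum>y\<in>range (F k). y * indicator (F k -` {y}) \<xi>)"
    proof
      fix \<xi>
      have "(\<Sum>y\<in>range (F k). y * indicator (F k -` {y}) \<xi>) = (\<Sum>y\<in>range (F k). if y = F k \<xi> then F k \<xi> else 0)"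
        by (intro sum.cong) (auto simp: indicator_def)
      also have "\<dots> = F k \<xi>" using simple_functionD(1)[OF F(1)] by (simp add: sum.delta)
      finally show "F k \<xi> = (\<Sum>y\<in>range (F k). y * indicator (F k -` {y}) \<xi>)" by simp
    qed
    moreover have "(\<lambda>\<xi>. \<Sum>y\<in>range (F k). y * indicator (F k -` {y}) \<xi>) \<in> trig_class"
      using simple_functionD(2)[OF F(1)]
      by (intro trig_class_sum trig_class.scale trig_class_indicator) auto
    ultimately show "F k \<in> trig_class" by simp
    show "cmod (F k \<xi>) \<le> 2 * B" for \<xi> using F(3)[of k \<xi>] B[of \<xi>] by simp
  qed
qed

lemma integrable_bounded_mult:
  fixes f g :: "'a \<Rightarrow> complex"
  assumes "integrable M g" "f \<in> borel_measurable M" "\<And>x. cmod (f x) \<le> B"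
  shows "integrable M (\<lambda>x. f x * g x)"
proof (rule Bochner_Integration.integrable_bound)
  show "integrable M (\<lambda>x. B * cmod (g x))" using assms(1) by simp
  show "AE x in M. norm (f x * g x) \<le> norm (B * cmod (g x))"
    using assms(3) by (auto simp: norm_mult abs_mult intro!: mult_right_mono AE_I2 order_trans[OF _ abs_ge_self])
qed (use assms in auto)

text \<open>The functions \<open>f\<close> for which the identity holds contain the characters and
  are closed under the rules of \<open>trig_class\<close>, the limit rule by dominated convergence.
  The two sides may use different base spaces because a measure on R^n has to be compared with its
  lifts.\<close>

theorem fourier_uniqueness:
  fixes X1 :: "'a \<Rightarrow> 'v::euclidean_space" and X2 :: "'b \<Rightarrow> 'v" and g1 g2 :: "_ \<Rightarrow> complex"
  assumes X[measurable]: "X1 \<in> borel_measurable M1" "X2 \<in> borel_measurable M2"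
    and g: "integrable M1 g1" "integrable M2 g2"
    and eq: "\<And>x. (\<integral>p. cis (- (x \<bullet> X1 p)) * g1 p \<partial>M1) = (\<integral>p. cis (- (x \<bullet> X2 p)) * g2 p \<partial>M2)"
    and f: "f \<in> borel_measurable borel" "\<And>\<xi>. cmod (f \<xi>) \<le> B"
  shows "(\<integral>p. f (X1 p) * g1 p \<partial>M1) = (\<integral>p. f (X2 p) * g2 p \<partial>M2)"
proof -
  have int: "integrable M1 (\<lambda>p. f (X1 p) * g1 p)" "integrable M2 (\<lambda>p. f (X2 p) * g2 p)" if f: "f \<in> trig_class" for f
  proof -
    obtain B where "\<And>\<xi>. cmod (f \<xi>) \<le> B" using trig_class_bounded[OF f] by blast
    then have Bf: "cmod (f (Y p)) \<le> B" for Y :: "'z \<Rightarrow> 'v" and p by simp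
    note * = integrable_bounded_mult[OF _ _ Bf] measurable_compose[OF _ trig_class_measurable[OF f]]
    show "integrable M1 (\<lambda>p. f (X1 p) * g1 p)" "integrable M2 (\<lambda>p. f (X2 p) * g2 p)"
      by (auto intro!: * g X)
  qed
  have "f \<in> trig_class" using f by (rule trig_class_borel)
  then show ?thesis
  proof (induction rule: trig_class.induct)
    case (char x)
    show ?case by (rule eq)
  next
    case (add f g)
    then show ?case by (simp add: distrib_right int)
  next
    case (scale f c)
    then show ?case by (simp add: mult.assoc)
  next
    case (lim F B f)
    note [measurable] = lim(1)[THEN trig_class_measurable] borel_measurable_integrable[OF g(1)] borel_measurable_integrable[OF g(2)]
    have [measurable]: "f \<in> borel_measurable borel"
      by (rule borel_measurable_LIMSEQ_metric[OF _ lim(3)]) simp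
    have "(\<lambda>k. \<integral>p. F k (X1 p) * g1 p \<partial>M1) \<longlonglongrightarrow> (\<integral>p. f (X1 p) * g1 p \<partial>M1)"
      by (rule integral_dominated_convergence[where w = "\<lambda>p. B * cmod (g1 p)"])
        (use g lim in \<open>auto intro!: tendsto_intros mult_right_mono simp: norm_mult\<close>)
    moreover have "(\<lambda>k. \<integral>p. F k (X2 p) * g2 p \<partial>M2) \<longlonglongrightarrow> (\<integral>p. f (X2 p) * g2 p \<partial>M2)"
      by (rule integral_dominated_convergence[where w = "\<lambda>p. B * cmod (g2 p)"])
        (use g lim in \<open>auto intro!: tendsto_intros mult_right_mono simp: norm_mult\<close>)
    ultimately show ?case using lim(4) LIMSEQ_unique by simp
  qed
qed

section \<open>Vector fields lifted to a measure space of frequencies\<close>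

lemma norm_vector_scalar_mult: "norm (c *s v) = cmod c * norm v" for v :: "complex^'n"
  by (simp add: norm_vec_def norm_mult L2_set_right_distrib)

lemma bounded_bilinear_vector_scalar_mult:
  "bounded_bilinear ((*s) :: complex \<Rightarrow> complex^'n \<Rightarrow> complex^'n)"
proof
  show "\<exists>K. \<forall>a (b::complex^'n). norm (a *s b) \<le> norm a * norm b * K"
    by (intro exI[of _ 1]) (simp add: norm_vector_scalar_mult)
qed (simp_all add: vec_eq_iff algebra_simps)

interpretation vsm: bounded_bilinear "(*s) :: complex \<Rightarrow> complex^'n \<Rightarrow> complex^'n"
  by (rule bounded_bilinear_vector_scalar_mult)

lemma borel_measurable_vector_scalar_mult[measurable (raw)]:
  fixes G :: "'a \<Rightarrow> complex^'n"
  assumes "c \<in> borel_measurable M" "G \<in> borel_measurable M"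
  shows "(\<lambda>p. c p *s G p) \<in> borel_measurable M"
  by (rule borel_measurable_continuous_Pair[OF assms]) (intro vsm.continuous_on continuous_intros)

lemma borel_measurable_vec_nth'[measurable (raw)]:
  fixes G :: "'a \<Rightarrow> 'b::real_normed_vector^'n"
  assumes "G \<in> borel_measurable M"
  shows "(\<lambda>p. G p $ i) \<in> borel_measurable M"
  using assms by (rule measurable_compose) (intro borel_measurable_continuous_onI continuous_intros)

lemma vec_lambda_eq_sum: "(\<chi> i. f i) = (\<Sum>i\<in>UNIV. f i *s axis i (1::complex))"
  by (auto simp: vec_eq_iff axis_def if_distrib cong: if_cong)

lemma borel_measurable_vec_lambda[measurable (raw)]:
  fixes f :: "'n::finite \<Rightarrow> 'a \<Rightarrow> complex"
  assumes [measurable]: "\<And>i. f i \<in> borel_measurable M"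
  shows "(\<lambda>p. \<chi> i. f i p) \<in> borel_measurable M"
  unfolding vec_lambda_eq_sum by measurable

lemma integrable_vec_lambda:
  fixes f :: "'n::finite \<Rightarrow> 'a \<Rightarrow> complex"
  assumes "\<And>i. integrable M (f i)"
  shows "integrable M (\<lambda>p. \<chi> i. f i p)"
  unfolding vec_lambda_eq_sum
  by (intro Bochner_Integration.integrable_sum
        integrable_bounded_linear[OF vsm.bounded_linear_left] assms)

lemma integrable_vec_nth:
  fixes G :: "'a \<Rightarrow> complex^'n"
  shows "integrable M G \<Longrightarrow> integrable M (\<lambda>p. G p $ i)"
  by (rule integrable_bounded_linear[OF bounded_linear_vec_nth])

lemma integral_vec_nth:
  fixes G :: "'a \<Rightarrow> complex^'n"
  shows "integrable M G \<Longrightarrow> (\<integral>p. G p \<partial>M) $ i = (\<integral>p. G p $ i \<partial>M)"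
  by (rule integral_bounded_linear[OF bounded_linear_vec_nth, symmetric])

text \<open>A generalised representation: the frequency is a function on an arbitrary measure space, which
  need not be finite, and \<open>fm_of\<close> is the case of the identity.\<close>

definition lift :: "'a measure \<Rightarrow> ('a \<Rightarrow> real^'n) \<Rightarrow> ('a \<Rightarrow> complex^'n) \<Rightarrow> ('n::finite) vfield" where
  "lift M X G = (\<lambda>x. \<integral>p. cis (- (x \<bullet> X p)) *s G p \<partial>M)"

lemma fm_of_eq_lift: "fm_of \<nu> g = lift \<nu> (\<lambda>\<xi>. \<xi>) g"
  unfolding fm_of_def lift_def vector_scalar_mult_def ..

lemma measurable_cis[measurable]: "cis \<in> borel_measurable borel"
  by (intro borel_measurable_continuous_onI continuous_intros)

lemma integrable_lift:
  fixes X :: "'a \<Rightarrow> real^'n"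
  assumes "X \<in> borel_measurable M" "integrable M G"
  shows "integrable M (\<lambda>p. cis (- (x \<bullet> X p)) *s G p)"
proof (rule Bochner_Integration.integrable_bound[OF integrable_norm[OF assms(2)]])
  show "(\<lambda>p. cis (- (x \<bullet> X p)) *s G p) \<in> borel_measurable M"
    by (intro borel_measurable_vector_scalar_mult measurable_compose[OF _ measurable_cis]
        borel_measurable_uminus borel_measurable_inner borel_measurable_const
        assms(1) borel_measurable_integrable[OF assms(2)])
qed (simp add: norm_vector_scalar_mult)

lemma lift_nth:
  assumes "X \<in> borel_measurable M" "integrable M G"
  shows "lift M X G x $ i = (\<integral>p. cis (- (x \<bullet> X p)) * G p $ i \<partial>M)"
  unfolding lift_def by (subst integral_vec_nth[OF integrable_lift[OF assms]]) simp

lemma lift_add: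
  assumes "X \<in> borel_measurable M" "integrable M G" "integrable M H"
  shows "lift M X (\<lambda>p. G p + H p) x = lift M X G x + lift M X H x"
  unfolding lift_def vsm.add_right
  by (intro Bochner_Integration.integral_add integrable_lift assms)

lemma lift_diff:
  assumes "X \<in> borel_measurable M" "integrable M G" "integrable M H"
  shows "lift M X (\<lambda>p. G p - H p) x = lift M X G x - lift M X H x"
  unfolding lift_def vsm.diff_right
  by (intro Bochner_Integration.integral_diff integrable_lift assms)

lemma lift_scaleR: "lift M X (\<lambda>p. c *\<^sub>R G p) x = c *\<^sub>R lift M X G x"
  unfolding lift_def vsm.scaleR_right by (rule integral_scaleR_right)

lemma fm_repD:
  assumes "fm_rep \<nu> g"
  shows "(\<lambda>\<xi>. \<xi>) \<in> borel_measurable \<nu>" "integrable \<nu> g" "sets \<nu> = sets borel" "finite_measure \<nu>"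
  using assms unfolding fm_rep_def by (auto simp: measurable_def dest: sets_eq_imp_space_eq)

text \<open>Needed for unbounded multipliers such as the symbol of \<open>A_d\<close>: cutting
  \<open>f\<close> to 0 where its modulus exceeds \<open>k\<close> reduces to the bounded case, and
  the integrable products dominate the truncations.\<close>

lemma fourier_uniqueness_unbounded:
  fixes X1 :: "'a \<Rightarrow> 'v::euclidean_space" and X2 :: "'b \<Rightarrow> 'v" and g1 g2 :: "_ \<Rightarrow> complex"
  assumes X[measurable]: "X1 \<in> borel_measurable M1" "X2 \<in> borel_measurable M2"
    and g: "integrable M1 g1" "integrable M2 g2"
    and eq: "\<And>x. (\<integral>p. cis (- (x \<bullet> X1 p)) * g1 p \<partial>M1) = (\<integral>p. cis (- (x \<bullet> X2 p)) * g2 p \<partial>M2)"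
    and f[measurable]: "f \<in> borel_measurable borel"
    and int: "integrable M1 (\<lambda>p. f (X1 p) * g1 p)" "integrable M2 (\<lambda>p. f (X2 p) * g2 p)"
  shows "(\<integral>p. f (X1 p) * g1 p \<partial>M1) = (\<integral>p. f (X2 p) * g2 p \<partial>M2)"
proof -
  note [measurable] = borel_measurable_integrable[OF g(1)] borel_measurable_integrable[OF g(2)]
  define F where "F k \<xi> = (if cmod (f \<xi>) \<le> real k then f \<xi> else 0)" for k \<xi>
  have [measurable]: "F k \<in> borel_measurable borel" for k unfolding F_def by measurable
  have lim: "(\<lambda>k. F k \<xi>) \<longlonglongrightarrow> f \<xi>" for \<xi>
  proof (rule tendsto_eventually)
    obtain m where "cmod (f \<xi>) \<le> real m" using real_arch_simple by blast
    then show "\<forall>\<^sub>F k in sequentially. F k \<xi> = f \<xi>"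
      by (auto simp: F_def eventually_sequentially intro!: exI[of _ m])
  qed
  have le: "cmod (F k \<xi>) \<le> cmod (f \<xi>)" for k \<xi> by (auto simp: F_def)
  have "(\<lambda>k. \<integral>p. F k (X1 p) * g1 p \<partial>M1) \<longlonglongrightarrow> (\<integral>p. f (X1 p) * g1 p \<partial>M1)"
    by (rule integral_dominated_convergence[where w = "\<lambda>p. cmod (f (X1 p) * g1 p)"])
      (auto simp: norm_mult int[THEN integrable_norm, unfolded norm_mult] intro!: tendsto_intros lim mult_right_mono le)
  moreover have "(\<lambda>k. \<integral>p. F k (X2 p) * g2 p \<partial>M2) \<longlonglongrightarrow> (\<integral>p. f (X2 p) * g2 p \<partial>M2)"
    by (rule integral_dominated_convergence[where w = "\<lambda>p. cmod (f (X2 p) * g2 p)"])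
      (auto simp: norm_mult int[THEN integrable_norm, unfolded norm_mult] intro!: tendsto_intros lim mult_right_mono le)
  moreover have "(\<integral>p. F k (X1 p) * g1 p \<partial>M1) = (\<integral>p. F k (X2 p) * g2 p \<partial>M2)" for k
    by (rule fourier_uniqueness[OF X g eq, where B = "real k"]) (auto simp: F_def)
  ultimately show ?thesis using LIMSEQ_unique by simp
qed

section \<open>Total variation and weights do not depend on the representation\<close>

lemma inner_complex_vec: "(a::complex^'n) \<bullet> b = Re (\<Sum>i\<in>UNIV. cnj (a $ i) * b $ i)"
  by (simp add: inner_vec_def inner_complex_def)

lemma integral_inner_sum:
  fixes s :: "real^'n \<Rightarrow> complex^'n"
  assumes X[measurable]: "X \<in> borel_measurable M" and G: "integrable M G"
    and s[measurable]: "s \<in> borel_measurable borel" and B: "\<And>\<xi>. norm (s \<xi>) \<le> B"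
  shows "integrable M (\<lambda>p. s (X p) \<bullet> G p)"
    and "(\<integral>p. s (X p) \<bullet> G p \<partial>M) = Re (\<Sum>i\<in>UNIV. \<integral>p. cnj (s (X p) $ i) * G p $ i \<partial>M)"
proof -
  have [measurable]: "cnj \<in> borel_measurable borel"
    by (intro borel_measurable_continuous_onI continuous_intros)
  have int: "integrable M (\<lambda>p. cnj (s (X p) $ i) * G p $ i)" for i
    by (rule integrable_bounded_mult[OF integrable_vec_nth[OF G], where B = B])
      (auto intro: order_trans[OF Finite_Cartesian_Product.norm_nth_le B])
  show "integrable M (\<lambda>p. s (X p) \<bullet> G p)"
    unfolding inner_complex_vec by (intro integrable_Re Bochner_Integration.integrable_sum int)
  show "(\<integral>p. s (X p) \<bullet> G p \<partial>M) = Re (\<Sum>i\<in>UNIV. \<integral>p. cnj (s (X p) $ i) * G p $ i \<partial>M)"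
    unfolding inner_complex_vec
    by (subst integral_Re) (simp_all only: Bochner_Integration.integrable_sum int Bochner_Integration.integral_sum)
qed

text \<open>Testing the two representations against the direction field of \<open>g\<close>, which is a function of
  the frequency alone, shows that passing to the image measure cannot increase the total variation.\<close>

lemma rep_weight_le:
  fixes w :: "real^'n \<Rightarrow> real"
  assumes rep: "fm_rep \<nu> g" and eq: "fm_of \<nu> g = lift M X G"
    and X[measurable]: "X \<in> borel_measurable M" and G: "integrable M G"
    and w[measurable]: "w \<in> borel_measurable borel" and w0: "\<And>\<xi>. 0 \<le> w \<xi>"
  shows "(\<integral>\<^sup>+\<xi>. ennreal (w \<xi> * norm (g \<xi>)) \<partial>\<nu>) \<le> (\<integral>\<^sup>+p. ennreal (w (X p) * norm (G p)) \<partial>M)"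
proof -
  note D = fm_repD[OF rep]
  note sets_eq[measurable_cong] = D(3)
  note [measurable] = borel_measurable_integrable[OF G]
  have gm: "g \<in> borel_measurable \<nu>" using D(2) by simp
  then have [measurable]: "g \<in> borel_measurable borel" using measurable_cong_sets[OF D(3) refl] by blast
  have comp: "(\<integral>\<xi>. cis (- (x \<bullet> \<xi>)) * g \<xi> $ i \<partial>\<nu>) = (\<integral>p. cis (- (x \<bullet> X p)) * G p $ i \<partial>M)" for x i
    using arg_cong[OF eq, of "\<lambda>u. u x $ i"] unfolding fm_of_eq_lift
    by (simp add: lift_nth[OF D(1,2)] lift_nth[OF X G])
  have bounded: "(\<integral>\<^sup>+\<xi>. ennreal (v \<xi> * norm (g \<xi>)) \<partial>\<nu>) \<le> (\<integral>\<^sup>+p. ennreal (v (X p) * norm (G p)) \<partial>M)"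
    if v[measurable]: "v \<in> borel_measurable borel" and v0: "\<And>\<xi>. 0 \<le> v \<xi>" and vB: "\<And>\<xi>. v \<xi> \<le> B" for v B
  proof -
    \<comment> \<open>The real inner product with \<open>g\<close> then equals
      \<open>v \<xi> * norm (g \<xi>)\<close>, while with \<open>G\<close> it is at most
      \<open>v (X p) * norm (G p)\<close> by Cauchy-Schwarz.\<close>
    define s where "s \<xi> = v \<xi> *\<^sub>R sgn (g \<xi>)" for \<xi>
    have s[measurable]: "s \<in> borel_measurable borel"
      unfolding s_def sgn_div_norm by measurable
    have sv: "norm (s \<xi>) \<le> v \<xi>" for \<xi> using v0[of \<xi>] by (simp add: s_def norm_sgn)
    then have sB: "norm (s \<xi>) \<le> B" for \<xi> using vB order_trans by blast
    have [measurable]: "cnj \<in> borel_measurable borel"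
      by (intro borel_measurable_continuous_onI continuous_intros)
    have sg: "s \<xi> \<bullet> g \<xi> = v \<xi> * norm (g \<xi>)" for \<xi>
      by (cases "g \<xi> = 0") (simp_all add: s_def sgn_div_norm power2_norm_eq_inner[symmetric] power2_eq_square)
    have "(\<integral>\<xi>. cnj (s \<xi> $ i) * g \<xi> $ i \<partial>\<nu>) = (\<integral>p. cnj (s (X p) $ i) * G p $ i \<partial>M)" for i
      by (rule fourier_uniqueness[OF D(1) X integrable_vec_nth[OF D(2)] integrable_vec_nth[OF G] comp, where B = B])
        (auto intro: order_trans[OF Finite_Cartesian_Product.norm_nth_le] sB)
    then have e: "(\<integral>\<xi>. s \<xi> \<bullet> g \<xi> \<partial>\<nu>) = (\<integral>p. s (X p) \<bullet> G p \<partial>M)"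
      using integral_inner_sum(2)[OF D(1,2) s sB] integral_inner_sum(2)[OF X G s sB] by simp
    have i1: "integrable \<nu> (\<lambda>\<xi>. v \<xi> * norm (g \<xi>))"
      using integral_inner_sum(1)[OF D(1,2) s sB] by (simp add: sg)
    have i2: "integrable M (\<lambda>p. v (X p) * norm (G p))"
    proof (rule Bochner_Integration.integrable_bound)
      show "integrable M (\<lambda>p. B * norm (G p))" using G by simp
      show "AE p in M. norm (v (X p) * norm (G p)) \<le> norm (B * norm (G p))"
        using v0 vB by (auto simp: abs_mult intro!: mult_right_mono AE_I2 order_trans[OF vB abs_ge_self])
    qed simp
    have "(\<integral>p. s (X p) \<bullet> G p \<partial>M) \<le> (\<integral>p. v (X p) * norm (G p) \<partial>M)"
      by (rule integral_mono[OF integral_inner_sum(1)[OF X G s sB] i2])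
        (rule order_trans[OF norm_cauchy_schwarz mult_right_mono[OF sv]], simp)
    then have "(\<integral>\<xi>. v \<xi> * norm (g \<xi>) \<partial>\<nu>) \<le> (\<integral>p. v (X p) * norm (G p) \<partial>M)"
      using e by (simp add: sg)
    then show ?thesis
      using v0 by (simp add: nn_integral_eq_integral[OF i1] nn_integral_eq_integral[OF i2] ennreal_leI)
  qed
  \<comment> \<open>Unbounded weights are suprema of the truncations
    \<open>min (w \<xi>) (real k)\<close>. Nonnegative integrals allow the comparison before the
    weighted density is known to be integrable.\<close>
  have "(\<integral>\<^sup>+\<xi>. ennreal (w \<xi> * norm (g \<xi>)) \<partial>\<nu>) = (\<integral>\<^sup>+\<xi>. (SUP k. ennreal (min (w \<xi>) (real k) * norm (g \<xi>))) \<partial>\<nu>)"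
  proof (rule nn_integral_cong)
    fix \<xi>
    obtain m where m: "w \<xi> \<le> real m" using real_arch_simple by blast
    show "ennreal (w \<xi> * norm (g \<xi>)) = (SUP k. ennreal (min (w \<xi>) (real k) * norm (g \<xi>)))"
    proof (rule antisym)
      show "ennreal (w \<xi> * norm (g \<xi>)) \<le> (SUP k. ennreal (min (w \<xi>) (real k) * norm (g \<xi>)))"
        by (rule SUP_upper2[of m]) (use m in auto)
      show "(SUP k. ennreal (min (w \<xi>) (real k) * norm (g \<xi>))) \<le> ennreal (w \<xi> * norm (g \<xi>))"
        by (intro SUP_least ennreal_leI mult_right_mono) auto
    qed
  qed
  also have "\<dots> = (SUP k. \<integral>\<^sup>+\<xi>. ennreal (min (w \<xi>) (real k) * norm (g \<xi>)) \<partial>\<nu>)"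
    by (rule nn_integral_monotone_convergence_SUP)
      (auto simp: incseq_def le_fun_def intro!: ennreal_leI mult_right_mono)
  also have "\<dots> \<le> (\<integral>\<^sup>+p. ennreal (w (X p) * norm (G p)) \<partial>M)"
  proof (rule SUP_least)
    fix k :: nat
    have "(\<integral>\<^sup>+\<xi>. ennreal (min (w \<xi>) (real k) * norm (g \<xi>)) \<partial>\<nu>) \<le> (\<integral>\<^sup>+p. ennreal (min (w (X p)) (real k) * norm (G p)) \<partial>M)"
      by (rule bounded[where B = "real k"]) (use w0 in auto)
    also have "\<dots> \<le> (\<integral>\<^sup>+p. ennreal (w (X p) * norm (G p)) \<partial>M)"
      by (intro nn_integral_mono ennreal_leI mult_right_mono) auto
    finally show "(\<integral>\<^sup>+\<xi>. ennreal (min (w \<xi>) (real k) * norm (g \<xi>)) \<partial>\<nu>) \<le> (\<integral>\<^sup>+p. ennreal (w (X p) * norm (G p)) \<partial>M)" .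
  qed
  finally show ?thesis .
qed

lemma rep_weight_integrable:
  fixes w :: "real^'n \<Rightarrow> real"
  assumes rep: "fm_rep \<nu> g" and eq: "fm_of \<nu> g = lift M X G"
    and X: "X \<in> borel_measurable M" and G: "integrable M G"
    and w: "w \<in> borel_measurable borel" and w0: "\<And>\<xi>. 0 \<le> w \<xi>"
    and int: "integrable M (\<lambda>p. w (X p) * norm (G p))"
  shows "integrable \<nu> (\<lambda>\<xi>. w \<xi> * norm (g \<xi>))"
    and "(\<integral>\<xi>. w \<xi> * norm (g \<xi>) \<partial>\<nu>) \<le> (\<integral>p. w (X p) * norm (G p) \<partial>M)"
proof -
  note D = fm_repD[OF rep]
  have [measurable]: "w \<in> borel_measurable \<nu>" using w measurable_cong_sets[OF D(3) refl] by blast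
  note [measurable] = borel_measurable_integrable[OF D(2)]
  have le: "(\<integral>\<^sup>+\<xi>. ennreal (w \<xi> * norm (g \<xi>)) \<partial>\<nu>) \<le> ennreal (\<integral>p. w (X p) * norm (G p) \<partial>M)"
    using rep_weight_le[OF rep eq X G w w0] w0 by (simp add: nn_integral_eq_integral[OF int])
  show i: "integrable \<nu> (\<lambda>\<xi>. w \<xi> * norm (g \<xi>))"
    by (rule integrableI_nonneg) (use w0 le in \<open>auto intro: le_less_trans\<close>)
  show "(\<integral>\<xi>. w \<xi> * norm (g \<xi>) \<partial>\<nu>) \<le> (\<integral>p. w (X p) * norm (G p) \<partial>M)"
    using le w0 by (simp add: nn_integral_eq_integral[OF i] integral_nonneg_AE)
qed

text \<open>Because \<open>k\<close> is dominated by \<open>norm (G p)\<close>, its image under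
  \<open>X\<close> is absolutely continuous with respect to the image of \<open>norm (G p)\<close>,
  and Radon-Nikodym provides the density. The claim is stated through test functions, which is what
  a comparison of transforms uses.\<close>

lemma pushforward_density_real:
  fixes G :: "'a \<Rightarrow> 'b::{banach, second_countable_topology}" and X :: "'a \<Rightarrow> 'v::euclidean_space"
  assumes X[measurable]: "X \<in> borel_measurable M" and G: "integrable M G"
    and k[measurable]: "k \<in> borel_measurable M" and kG: "\<And>p. \<bar>k p\<bar> \<le> norm (G p)"
  defines "\<nu> \<equiv> distr (density M (\<lambda>p. ennreal (norm (G p)))) borel X"
  shows "\<exists>f. integrable \<nu> f \<and> (\<forall>h B. h \<in> borel_measurable borel \<longrightarrow> (\<forall>\<xi>. cmod (h \<xi>) \<le> B) \<longrightarrow>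
      (\<integral>\<xi>. h \<xi> * complex_of_real (f \<xi>) \<partial>\<nu>) = (\<integral>p. h (X p) * complex_of_real (k p) \<partial>M))"
proof -
  note [measurable] = borel_measurable_integrable[OF G]
  \<comment> \<open>Radon-Nikodym is applied to positive measures: adding \<open>norm (G p)\<close>
    makes the density nonnegative, and as the image of \<open>norm (G p)\<close> is
    \<open>\<nu>\<close> itself, the shift is undone by the 1 subtracted in
    \<open>D \<xi> - 1\<close>.\<close>
  define K where "K p = k p + norm (G p)" for p
  have [measurable]: "K \<in> borel_measurable M" unfolding K_def by measurable
  have K0: "0 \<le> K p" and K2: "K p \<le> 2 * norm (G p)" for p
    using kG[of p] by (auto simp: K_def abs_le_iff)
  define N where "N = distr (density M (\<lambda>p. ennreal (K p))) borel X"
  have kint: "integrable M k"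
    by (rule Bochner_Integration.integrable_bound[OF integrable_norm[OF G]]) (use kG in auto)
  then have Kint: "integrable M K" unfolding K_def using G by simp
  have \<nu>A: "emeasure \<nu> A = (\<integral>\<^sup>+p. ennreal (norm (G p)) * indicator A (X p) \<partial>M)" if [measurable]: "A \<in> sets borel" for A
    unfolding \<nu>_def by (subst emeasure_distr) (auto simp: emeasure_density intro!: nn_integral_cong split: split_indicator)
  have NA: "emeasure N A = (\<integral>\<^sup>+p. ennreal (K p) * indicator A (X p) \<partial>M)" if [measurable]: "A \<in> sets borel" for A
    unfolding N_def by (subst emeasure_distr) (auto simp: emeasure_density intro!: nn_integral_cong split: split_indicator)
  have fin: "finite_measure \<nu>" "finite_measure N"
    using \<nu>A[of UNIV] NA[of UNIV]
    by (auto intro!: finite_measureI simp: nn_integral_eq_integral[OF Kint] K0 nn_integral_eq_integral[OF integrable_norm[OF G]])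
      (simp_all add: \<nu>_def N_def)
  interpret \<nu>: finite_measure \<nu> by fact
  have sets: "sets \<nu> = sets borel" "sets N = sets \<nu>" by (simp_all add: \<nu>_def N_def)
  have ac: "absolutely_continuous \<nu> N"
    unfolding absolutely_continuous_def
  proof
    fix A assume "A \<in> null_sets \<nu>"
    then have A[measurable]: "A \<in> sets borel" and 0: "emeasure \<nu> A = 0" by (auto simp: null_sets_def sets)
    have "emeasure N A \<le> (\<integral>\<^sup>+p. 2 * (ennreal (norm (G p)) * indicator A (X p)) \<partial>M)"
      unfolding NA[OF A]
    proof (rule nn_integral_mono)
      fix p
      have "ennreal (K p) \<le> ennreal (2 * norm (G p))" using K2 by (rule ennreal_leI)
      also have "\<dots> = 2 * ennreal (norm (G p))" by (simp add: ennreal_mult)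
      finally show "ennreal (K p) * indicator A (X p) \<le> 2 * (ennreal (norm (G p)) * indicator A (X p))"
        by (simp split: split_indicator)
    qed
    also have "\<dots> = 2 * emeasure \<nu> A" unfolding \<nu>A[OF A] by (rule nn_integral_cmult) measurable
    finally show "A \<in> null_sets N" using 0 A by (auto simp: null_sets_def sets)
  qed
  obtain D where D[measurable]: "D \<in> borel_measurable \<nu>" and D_eq: "AE x in \<nu>. RN_deriv \<nu> N x = ennreal (D x)"
    and D0: "\<And>x. 0 \<le> D x"
    using \<nu>.real_RN_deriv[OF fin(2) ac sets(2)] by metis
  have dens: "density \<nu> (\<lambda>x. ennreal (D x)) = N"
    using \<nu>.density_RN_deriv[OF ac sets(2)] density_cong[OF borel_measurable_RN_deriv _ D_eq] by simp
  have Dint: "integrable \<nu> D"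
  proof (rule integrableI_nonneg)
    have "(\<integral>\<^sup>+x. ennreal (D x) \<partial>\<nu>) = emeasure (density \<nu> (\<lambda>x. ennreal (D x))) (space \<nu>)"
      by (subst emeasure_density) (auto intro!: nn_integral_cong)
    also have "\<dots> < \<infinity>" unfolding dens using finite_measure.emeasure_finite[OF fin(2)]
      by (simp add: less_top)
    finally show "(\<integral>\<^sup>+x. ennreal (D x) \<partial>\<nu>) < \<infinity>" .
  qed (use D0 in auto)
  show ?thesis
  proof (intro exI[of _ "\<lambda>\<xi>. D \<xi> - 1"] conjI allI impI)
    show "integrable \<nu> (\<lambda>\<xi>. D \<xi> - 1)" using Dint by simp
    fix h :: "'v \<Rightarrow> complex" and B assume h[measurable]: "h \<in> borel_measurable borel" and B: "\<forall>\<xi>. cmod (h \<xi>) \<le> B"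
    have h\<nu>[measurable]: "h \<in> borel_measurable \<nu>" using h measurable_cong_sets[OF sets(1) refl] by blast
    have i1: "integrable \<nu> (\<lambda>\<xi>. h \<xi> * complex_of_real (D \<xi>))"
      by (rule integrable_bounded_mult[where B = B]) (use Dint B in auto)
    have i2: "integrable \<nu> h" by (rule \<nu>.integrable_const_bound[where B = B]) (use B in auto)
    have i3: "integrable M (\<lambda>p. h (X p) * complex_of_real (k p))"
      by (rule integrable_bounded_mult[where B = B]) (use kint B in auto)
    have i4: "integrable M (\<lambda>p. h (X p) * complex_of_real (norm (G p)))"
      by (rule integrable_bounded_mult[where B = B]) (use G B in auto)
    have "(\<integral>\<xi>. h \<xi> * complex_of_real (D \<xi> - 1) \<partial>\<nu>) = (\<integral>\<xi>. h \<xi> * complex_of_real (D \<xi>) \<partial>\<nu>) - (\<integral>\<xi>. h \<xi> \<partial>\<nu>)"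
      by (subst Bochner_Integration.integral_diff[OF i1 i2, symmetric]) (simp add: algebra_simps)
    also have "(\<integral>\<xi>. h \<xi> * complex_of_real (D \<xi>) \<partial>\<nu>) = (\<integral>\<xi>. h \<xi> \<partial>N)"
      unfolding dens[symmetric] by (subst integral_density) (auto simp: D0 scaleR_conv_of_real mult.commute)
    also have "\<dots> = (\<integral>p. h (X p) * complex_of_real (K p) \<partial>M)"
      unfolding N_def by (subst integral_distr) (auto simp: integral_density K0 scaleR_conv_of_real mult.commute)
    also have "\<dots> = (\<integral>p. h (X p) * complex_of_real (k p) \<partial>M) + (\<integral>p. h (X p) * complex_of_real (norm (G p)) \<partial>M)"
      by (subst Bochner_Integration.integral_add[OF i3 i4, symmetric]) (simp add: K_def distrib_left)
    also have "(\<integral>p. h (X p) * complex_of_real (norm (G p)) \<partial>M) = (\<integral>\<xi>. h \<xi> \<partial>\<nu>)"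
      unfolding \<nu>_def by (subst integral_distr) (auto simp: integral_density scaleR_conv_of_real mult.commute)
    finally show "(\<integral>\<xi>. h \<xi> * complex_of_real (D \<xi> - 1) \<partial>\<nu>) = (\<integral>p. h (X p) * complex_of_real (k p) \<partial>M)" by simp
  qed
qed

text \<open>The way back from lifts to \<open>FM\<close>: the image of the measure with density
  \<open>norm (G p)\<close> is finite whatever \<open>M\<close> is, and the real and imaginary parts
  of each component have densities with respect to it.\<close>

theorem lift_rep_exists:
  fixes X :: "'a \<Rightarrow> real^'n" and G :: "'a \<Rightarrow> complex^'n"
  assumes X[measurable]: "X \<in> borel_measurable M" and G: "integrable M G"
  shows "\<exists>\<nu> g. fm_rep \<nu> g \<and> fm_of \<nu> g = lift M X G"
proof -
  note [measurable] = borel_measurable_integrable[OF G]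
  define \<nu> where "\<nu> = distr (density M (\<lambda>p. ennreal (norm (G p)))) borel X"
  have "\<exists>f. integrable \<nu> f \<and> (\<forall>h B. h \<in> borel_measurable borel \<longrightarrow> (\<forall>\<xi>. cmod (h \<xi>) \<le> B) \<longrightarrow>
      (\<integral>\<xi>. h \<xi> * complex_of_real (f \<xi>) \<partial>\<nu>) = (\<integral>p. h (X p) * complex_of_real (Re (G p $ i)) \<partial>M))" for i
    unfolding \<nu>_def
    by (rule pushforward_density_real[OF X G])
      (auto intro: order_trans[OF abs_Re_le_cmod Finite_Cartesian_Product.norm_nth_le])
  then have "\<exists>f. \<forall>i. integrable \<nu> (f i) \<and> (\<forall>h B. h \<in> borel_measurable borel \<longrightarrow> (\<forall>\<xi>. cmod (h \<xi>) \<le> B) \<longrightarrow>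
      (\<integral>\<xi>. h \<xi> * complex_of_real (f i \<xi>) \<partial>\<nu>) = (\<integral>p. h (X p) * complex_of_real (Re (G p $ i)) \<partial>M))"
    by (intro choice allI)
  then obtain fr where fr_all: "\<forall>i. integrable \<nu> (fr i) \<and> (\<forall>h B. h \<in> borel_measurable borel \<longrightarrow> (\<forall>\<xi>. cmod (h \<xi>) \<le> B) \<longrightarrow>
      (\<integral>\<xi>. h \<xi> * complex_of_real (fr i \<xi>) \<partial>\<nu>) = (\<integral>p. h (X p) * complex_of_real (Re (G p $ i)) \<partial>M))" ..
  have fr: "\<And>i. integrable \<nu> (fr i)" "\<And>i h B. h \<in> borel_measurable borel \<Longrightarrow> (\<And>\<xi>. cmod (h \<xi>) \<le> B) \<Longrightarrow>
      (\<integral>\<xi>. h \<xi> * complex_of_real (fr i \<xi>) \<partial>\<nu>) = (\<integral>p. h (X p) * complex_of_real (Re (G p $ i)) \<partial>M)"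
    using fr_all by blast+
  have "\<exists>f. integrable \<nu> f \<and> (\<forall>h B. h \<in> borel_measurable borel \<longrightarrow> (\<forall>\<xi>. cmod (h \<xi>) \<le> B) \<longrightarrow>
      (\<integral>\<xi>. h \<xi> * complex_of_real (f \<xi>) \<partial>\<nu>) = (\<integral>p. h (X p) * complex_of_real (Im (G p $ i)) \<partial>M))" for i
    unfolding \<nu>_def
    by (rule pushforward_density_real[OF X G])
      (auto intro: order_trans[OF abs_Im_le_cmod Finite_Cartesian_Product.norm_nth_le])
  then have "\<exists>f. \<forall>i. integrable \<nu> (f i) \<and> (\<forall>h B. h \<in> borel_measurable borel \<longrightarrow> (\<forall>\<xi>. cmod (h \<xi>) \<le> B) \<longrightarrow>
      (\<integral>\<xi>. h \<xi> * complex_of_real (f i \<xi>) \<partial>\<nu>) = (\<integral>p. h (X p) * complex_of_real (Im (G p $ i)) \<partial>M))"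
    by (intro choice allI)
  then obtain fi where fi_all: "\<forall>i. integrable \<nu> (fi i) \<and> (\<forall>h B. h \<in> borel_measurable borel \<longrightarrow> (\<forall>\<xi>. cmod (h \<xi>) \<le> B) \<longrightarrow>
      (\<integral>\<xi>. h \<xi> * complex_of_real (fi i \<xi>) \<partial>\<nu>) = (\<integral>p. h (X p) * complex_of_real (Im (G p $ i)) \<partial>M))" ..
  have fi: "\<And>i. integrable \<nu> (fi i)" "\<And>i h B. h \<in> borel_measurable borel \<Longrightarrow> (\<And>\<xi>. cmod (h \<xi>) \<le> B) \<Longrightarrow>
      (\<integral>\<xi>. h \<xi> * complex_of_real (fi i \<xi>) \<partial>\<nu>) = (\<integral>p. h (X p) * complex_of_real (Im (G p $ i)) \<partial>M)"
    using fi_all by blast+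
  define g where "g \<xi> = (\<chi> i. complex_of_real (fr i \<xi>) + \<i> * complex_of_real (fi i \<xi>))" for \<xi>
  have sets: "sets \<nu> = sets borel" by (simp add: \<nu>_def)
  have "emeasure \<nu> (space \<nu>) = (\<integral>\<^sup>+p. ennreal (norm (G p)) \<partial>M)"
    unfolding \<nu>_def by (subst emeasure_distr) (auto simp: emeasure_density intro!: nn_integral_cong)
  then have "finite_measure \<nu>"
    by (auto intro!: finite_measureI simp: nn_integral_eq_integral[OF integrable_norm[OF G]])
  moreover have "integrable \<nu> g"
    unfolding g_def by (intro integrable_vec_lambda Bochner_Integration.integrable_add integrable_mult_right integrable_of_real fr fi)
  ultimately have rep: "fm_rep \<nu> g" using sets by (simp add: fm_rep_def)
  note D = fm_repD[OF rep]
  have "fm_of \<nu> g x $ i = lift M X G x $ i" for x i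
  proof -
    let ?h = "\<lambda>\<xi>. cis (- (x \<bullet> \<xi>))"
    have h: "?h \<in> borel_measurable borel" "\<And>\<xi>. cmod (?h \<xi>) \<le> 1" by auto
    have h\<nu>: "?h \<in> borel_measurable \<nu>" using h(1) measurable_cong_sets[OF sets refl] by blast
    have ir: "integrable \<nu> (\<lambda>\<xi>. ?h \<xi> * complex_of_real (fr i \<xi>))" "integrable \<nu> (\<lambda>\<xi>. ?h \<xi> * complex_of_real (fi i \<xi>))"
      by (rule integrable_bounded_mult[where B = 1]; use fr(1) fi(1) h\<nu> in simp)+
    have i: "integrable M (\<lambda>p. G p $ i)" using G by (rule integrable_vec_nth)
    have iM: "integrable M (\<lambda>p. ?h (X p) * complex_of_real (Re (G p $ i)))" "integrable M (\<lambda>p. ?h (X p) * complex_of_real (Im (G p $ i)))"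
      by (rule integrable_bounded_mult[where B = 1]; use i in simp)+
    have "fm_of \<nu> g x $ i = (\<integral>\<xi>. ?h \<xi> * complex_of_real (fr i \<xi>) + \<i> * (?h \<xi> * complex_of_real (fi i \<xi>)) \<partial>\<nu>)"
      unfolding fm_of_eq_lift lift_nth[OF D(1,2)] by (simp add: g_def algebra_simps)
    also have "\<dots> = (\<integral>\<xi>. ?h \<xi> * complex_of_real (fr i \<xi>) \<partial>\<nu>) + \<i> * (\<integral>\<xi>. ?h \<xi> * complex_of_real (fi i \<xi>) \<partial>\<nu>)"
      using ir by simp
    also have "\<dots> = (\<integral>p. ?h (X p) * complex_of_real (Re (G p $ i)) \<partial>M) + \<i> * (\<integral>p. ?h (X p) * complex_of_real (Im (G p $ i)) \<partial>M)"
      by (simp only: fr(2)[OF h] fi(2)[OF h])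
    also have "\<dots> = (\<integral>p. ?h (X p) * complex_of_real (Re (G p $ i)) + \<i> * (?h (X p) * complex_of_real (Im (G p $ i))) \<partial>M)"
      using iM by simp
    also have "\<dots> = (\<integral>p. ?h (X p) * G p $ i \<partial>M)"
    proof (intro Bochner_Integration.integral_cong refl)
      fix p
      have "G p $ i = complex_of_real (Re (G p $ i)) + \<i> * complex_of_real (Im (G p $ i))" by (rule complex_eq)
      then show "?h (X p) * complex_of_real (Re (G p $ i)) + \<i> * (?h (X p) * complex_of_real (Im (G p $ i))) = ?h (X p) * G p $ i"
        by (metis distrib_left mult.left_commute)
    qed
    also have "\<dots> = lift M X G x $ i" by (rule lift_nth[OF X G, symmetric])
    finally show ?thesis .
  qed
  then have "fm_of \<nu> g = lift M X G" by (auto simp: fun_eq_iff vec_eq_iff)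
  with rep show ?thesis by blast
qed

lemma lift_in_FM:
  assumes "X \<in> borel_measurable M" "integrable M G"
  shows "lift M X G \<in> FM"
  using lift_rep_exists[OF assms] by (auto simp: FM_def fm_reps_def)

lemma image_eq_singleton: "(\<And>x. x \<in> A \<Longrightarrow> f x = c) \<Longrightarrow> a \<in> A \<Longrightarrow> f ` A = {c}"
  by auto

text \<open>A representation is itself a lift with the identity as frequency, so any two
  representations can be compared in both directions; the infimum in \<open>FM_norm\<close> runs
  over a single value.\<close>

lemma FM_norm_eq:
  assumes "fm_rep \<nu> g" "fm_of \<nu> g = u"
  shows "FM_norm u = (\<integral>\<xi>. norm (g \<xi>) \<partial>\<nu>)"
proof -
  have le: "(\<integral>\<xi>. norm (g2 \<xi>) \<partial>\<nu>2) \<le> (\<integral>\<xi>. norm (g1 \<xi>) \<partial>\<nu>1)"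
    if "fm_rep \<nu>1 g1" "fm_of \<nu>1 g1 = u" "fm_rep \<nu>2 g2" "fm_of \<nu>2 g2 = u" for \<nu>1 \<nu>2 g1 g2
  proof -
    note D = fm_repD[OF that(1)]
    have "fm_of \<nu>2 g2 = lift \<nu>1 (\<lambda>\<xi>. \<xi>) g1" using that by (simp add: fm_of_eq_lift)
    from rep_weight_integrable(2)[OF that(3) this D(1,2), of "\<lambda>_. 1"] D(2) show ?thesis by simp
  qed
  have "(\<lambda>p. \<integral>\<xi>. norm (snd p \<xi>) \<partial>(fst p)) ` fm_reps u = {\<integral>\<xi>. norm (g \<xi>) \<partial>\<nu>}"
  proof -
    have "(\<integral>\<xi>. norm (snd p \<xi>) \<partial>(fst p)) = (\<integral>\<xi>. norm (g \<xi>) \<partial>\<nu>)" if "p \<in> fm_reps u" for p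
      using that le[of \<nu> g "fst p" "snd p"] le[of "fst p" "snd p" \<nu> g] assms by (auto simp: fm_reps_def)
    moreover have "(\<nu>, g) \<in> fm_reps u" using assms by (simp add: fm_reps_def)
    ultimately show ?thesis by (rule image_eq_singleton)
  qed
  then show ?thesis unfolding FM_norm_def by simp
qed

lemma FMs_rep:
  assumes "u \<in> FMs s" "fm_rep \<nu> g" "fm_of \<nu> g = u"
  shows "integrable \<nu> (\<lambda>\<xi>. norm \<xi> powr s * norm (g \<xi>))"
proof -
  obtain \<nu>1 g1 where r: "fm_rep \<nu>1 g1" "fm_of \<nu>1 g1 = u" "integrable \<nu>1 (\<lambda>\<xi>. norm \<xi> powr s * norm (g1 \<xi>))"
    using assms(1) by (auto simp: FMs_def fm_reps_def)
  note D = fm_repD[OF r(1)]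
  have "fm_of \<nu> g = lift \<nu>1 (\<lambda>\<xi>. \<xi>) g1" using r assms by (simp add: fm_of_eq_lift)
  from rep_weight_integrable(1)[OF assms(2) this D(1,2), of "\<lambda>\<xi>. norm \<xi> powr s"] r(3) show ?thesis by simp
qed

lemma FMs_norm_eq:
  assumes "fm_rep \<nu> g" "fm_of \<nu> g = u" "u \<in> FMs s"
  shows "FMs_norm s u = FM_norm u + (\<integral>\<xi>. norm \<xi> powr s * norm (g \<xi>) \<partial>\<nu>)"
proof -
  have le: "(\<integral>\<xi>. norm \<xi> powr s * norm (g2 \<xi>) \<partial>\<nu>2) \<le> (\<integral>\<xi>. norm \<xi> powr s * norm (g1 \<xi>) \<partial>\<nu>1)"
    if r: "fm_rep \<nu>1 g1" "fm_of \<nu>1 g1 = u" "fm_rep \<nu>2 g2" "fm_of \<nu>2 g2 = u" for \<nu>1 \<nu>2 g1 g2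
  proof -
    note D = fm_repD[OF r(1)]
    have "fm_of \<nu>2 g2 = lift \<nu>1 (\<lambda>\<xi>. \<xi>) g1" using r by (simp add: fm_of_eq_lift)
    from rep_weight_integrable(2)[OF r(3) this D(1,2), of "\<lambda>\<xi>. norm \<xi> powr s"] FMs_rep[OF assms(3) r(1,2)]
    show ?thesis by simp
  qed
  have "(\<lambda>p. \<integral>\<xi>. norm \<xi> powr s * norm (snd p \<xi>) \<partial>(fst p)) ` fm_reps u = {\<integral>\<xi>. norm \<xi> powr s * norm (g \<xi>) \<partial>\<nu>}"
  proof -
    have "(\<integral>\<xi>. norm \<xi> powr s * norm (snd p \<xi>) \<partial>(fst p)) = (\<integral>\<xi>. norm \<xi> powr s * norm (g \<xi>) \<partial>\<nu>)" if "p \<in> fm_reps u" for p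
      using that le[of \<nu> g "fst p" "snd p"] le[of "fst p" "snd p" \<nu> g] assms(1,2) by (auto simp: fm_reps_def)
    moreover have "(\<nu>, g) \<in> fm_reps u" using assms(1,2) by (simp add: fm_reps_def)
    ultimately show ?thesis by (rule image_eq_singleton)
  qed
  then show ?thesis unfolding FMs_norm_def by simp
qed

lemma FM_norm_lift_le:
  assumes "X \<in> borel_measurable M" "integrable M G"
  shows "FM_norm (lift M X G) \<le> (\<integral>p. norm (G p) \<partial>M)"
proof -
  obtain \<nu> g where r: "fm_rep \<nu> g" "fm_of \<nu> g = lift M X G" using lift_rep_exists[OF assms] by blast
  from rep_weight_integrable(2)[OF r assms, of "\<lambda>_. 1"] FM_norm_eq[OF r] assms(2) show ?thesis by simp
qed

lemma lift_in_FMs: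
  assumes X: "X \<in> borel_measurable M" "integrable M G"
    and "integrable M (\<lambda>p. norm (X p) powr s * norm (G p))"
  shows "lift M X G \<in> FMs s"
proof -
  obtain \<nu> g where r: "fm_rep \<nu> g" "fm_of \<nu> g = lift M X G" using lift_rep_exists[OF X] by blast
  from rep_weight_integrable(1)[OF r X, of "\<lambda>\<xi>. norm \<xi> powr s"] assms(3) r show ?thesis
    by (auto simp: FMs_def fm_reps_def)
qed

lemma FM_norm_nonneg: "u \<in> FM \<Longrightarrow> 0 \<le> FM_norm u"
proof -
  assume "u \<in> FM"
  then obtain \<nu> g where "fm_rep \<nu> g" "fm_of \<nu> g = u" by (auto simp: FM_def fm_reps_def)
  from FM_norm_eq[OF this] show ?thesis by simp
qed

lemma FMs_subset_FM: "FMs s \<subseteq> FM"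
  by (auto simp: FM_def FMs_def)

lemma FM0_sigma_subset_FM: "FM0_sigma \<subseteq> FM"
  by (auto simp: FM_def FM0_sigma_def)

lemma FM_norm_le_FMs_norm: "u \<in> FMs s \<Longrightarrow> FM_norm u \<le> FMs_norm s u"
proof -
  assume u: "u \<in> FMs s"
  then obtain \<nu> g where "fm_rep \<nu> g" "fm_of \<nu> g = u" by (auto simp: FMs_def fm_reps_def)
  from FMs_norm_eq[OF this u] show ?thesis by (simp add: integral_nonneg_AE)
qed

lemma norm_le_FM_norm: "u \<in> FM \<Longrightarrow> norm (u x) \<le> FM_norm u"
proof -
  assume "u \<in> FM"
  then obtain \<nu> g where r: "fm_rep \<nu> g" "fm_of \<nu> g = u" by (auto simp: FM_def fm_reps_def)
  have "norm (lift \<nu> (\<lambda>\<xi>. \<xi>) g x) \<le> (\<integral>\<xi>. norm (cis (- (x \<bullet> \<xi>)) *s g \<xi>) \<partial>\<nu>)"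
    unfolding lift_def by (rule integral_norm_bound)
  then show ?thesis using FM_norm_eq[OF r] r(2) by (simp add: fm_of_eq_lift norm_vector_scalar_mult)
qed

section \<open>Multipliers, derivatives and products\<close>

text \<open>The bound is demanded only for times near \<open>a\<close> and different from
  \<open>a\<close>, as difference quotients at a positive time satisfy no more than that.\<close>

lemma dominated_convergence_within:
  fixes f :: "real \<Rightarrow> 'a \<Rightarrow> 'b::{banach, second_countable_topology}"
  assumes f: "\<And>t. t \<in> S \<Longrightarrow> f t \<in> borel_measurable M" and g: "g \<in> borel_measurable M"
    and lim: "\<And>p. ((\<lambda>t. f t p) \<longlongrightarrow> g p) (at a within S)"
    and d: "0 < d" and bound: "\<And>t p. t \<in> S \<Longrightarrow> t \<noteq> a \<Longrightarrow> \<bar>t - a\<bar> < d \<Longrightarrow> norm (f t p) \<le> w p"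
    and w: "integrable M w"
  shows "((\<lambda>t. \<integral>p. f t p \<partial>M) \<longlongrightarrow> (\<integral>p. g p \<partial>M)) (at a within S)"
  unfolding tendsto_at_iff_sequentially
proof (intro allI impI)
  fix X :: "nat \<Rightarrow> real" assume X: "\<forall>i. X i \<in> S - {a}" and Xa: "X \<longlonglongrightarrow> a"
  from Xa d have "\<forall>\<^sub>F n in sequentially. \<bar>X n - a\<bar> < d"
    by (auto simp: tendsto_iff dist_real_def)
  then obtain N where N: "\<And>n. n \<ge> N \<Longrightarrow> \<bar>X n - a\<bar> < d" by (auto simp: eventually_sequentially)
  have "(\<lambda>n. \<integral>p. f (X (n + N)) p \<partial>M) \<longlonglongrightarrow> (\<integral>p. g p \<partial>M)"
  proof (rule integral_dominated_convergence[OF g _ w])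
    show "AE p in M. (\<lambda>n. f (X (n + N)) p) \<longlonglongrightarrow> g p"
    proof (rule AE_I2)
      fix p
      have "(\<lambda>n. f (X n) p) \<longlonglongrightarrow> g p"
        using lim[of p] X Xa unfolding tendsto_at_iff_sequentially by (auto simp: o_def)
      then show "(\<lambda>n. f (X (n + N)) p) \<longlonglongrightarrow> g p" by (rule LIMSEQ_ignore_initial_segment)
    qed
  qed (use X N bound f in auto)
  then show "((\<lambda>t. \<integral>p. f t p \<partial>M) \<circ> X) \<longlonglongrightarrow> (\<integral>p. g p \<partial>M)"
    unfolding o_def by (rule LIMSEQ_offset)
qed

lemma has_vector_derivativeI_quotient:
  assumes "((\<lambda>h. (f (x + h) - f x) /\<^sub>R h) \<longlongrightarrow> D) (at (0::real))"
  shows "(f has_vector_derivative D) (at x)"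
  unfolding has_vector_derivative_def has_derivative_at
proof
  show "bounded_linear (\<lambda>h. h *\<^sub>R D)" by (rule bounded_linear_scaleR_left)
  have "((\<lambda>h. norm ((f (x + h) - f x) /\<^sub>R h - D)) \<longlongrightarrow> 0) (at 0)"
    using assms by (simp add: tendsto_norm_zero Lim_null[symmetric] LIM_zero)
  then show "(\<lambda>h. norm (f (x + h) - f x - h *\<^sub>R D) / norm h) \<midarrow>0\<rightarrow> 0"
  proof (rule Lim_transform_eventually)
    show "\<forall>\<^sub>F h in at 0. norm ((f (x + h) - f x) /\<^sub>R h - D) = norm (f (x + h) - f x - h *\<^sub>R D) / norm h"
      unfolding eventually_at
    proof (intro exI[of _ 1] conjI ballI impI)
      fix h :: real assume "h \<noteq> 0 \<and> dist h 0 < 1"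
      then have "(f (x + h) - f x) /\<^sub>R h - D = (f (x + h) - f x - h *\<^sub>R D) /\<^sub>R h"
        by (simp add: scaleR_diff_right)
      then show "norm ((f (x + h) - f x) /\<^sub>R h - D) = norm (f (x + h) - f x - h *\<^sub>R D) / norm h"
        by (simp add: divide_inverse mult.commute)
    qed simp
  qed
qed

text \<open>\<open>fm_mult\<close> picks an arbitrary representation; by uniqueness it acts on every lifted
  representation by multiplication with the symbol.\<close>

lemma
  fixes K :: "'n::finite \<Rightarrow> 'n \<Rightarrow> real^'n \<Rightarrow> complex" and X :: "'a \<Rightarrow> real^'n"
  assumes X[measurable]: "X \<in> borel_measurable M" and G: "integrable M G"
    and K[measurable]: "\<And>i j. K i j \<in> borel_measurable borel" and W[measurable]: "W \<in> borel_measurable borel"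
    and KW: "\<And>i j \<xi>. cmod (K i j \<xi>) \<le> W \<xi>" and int: "integrable M (\<lambda>p. W (X p) * norm (G p))"
    and m: "\<And>\<xi> v i. m \<xi> v $ i = (\<Sum>j\<in>UNIV. K i j \<xi> * v $ j)"
  shows integrable_multiplier: "integrable M (\<lambda>p. m (X p) (G p))"
    and multiplier_rep: "fm_rep \<nu> g \<Longrightarrow> fm_of \<nu> g = lift M X G \<Longrightarrow>
          fm_rep \<nu> (\<lambda>\<xi>. m \<xi> (g \<xi>)) \<and> fm_of \<nu> (\<lambda>\<xi>. m \<xi> (g \<xi>)) = lift M X (\<lambda>p. m (X p) (G p))"
    and fm_mult_lift: "fm_mult m (lift M X G) = lift M X (\<lambda>p. m (X p) (G p))"
proof -
  have W0: "0 \<le> W \<xi>" for \<xi> using KW[of undefined undefined \<xi>] norm_ge_zero order_trans by blast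
  have m_eq: "m \<xi> v = (\<chi> i. \<Sum>j\<in>UNIV. K i j \<xi> * v $ j)" for \<xi> v by (simp add: vec_eq_iff m)
  have entry: "integrable L (\<lambda>p. K i j (Y p) * H p $ j)"
    if [measurable]: "Y \<in> borel_measurable L" and H: "integrable L H" and "integrable L (\<lambda>p. W (Y p) * norm (H p))"
    for L :: "'c measure" and Y and H :: "'c \<Rightarrow> complex^'n" and i j
  proof (rule Bochner_Integration.integrable_bound[OF that(3)])
    note [measurable] = borel_measurable_integrable[OF H]
    show "(\<lambda>p. K i j (Y p) * H p $ j) \<in> borel_measurable L" by measurable
    show "AE p in L. norm (K i j (Y p) * H p $ j) \<le> norm (W (Y p) * norm (H p))"
      using W0 by (auto simp: norm_mult abs_mult intro!: mult_mono KW Finite_Cartesian_Product.norm_nth_le)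
  qed
  have mint: "integrable L (\<lambda>p. m (Y p) (H p))"
    if "Y \<in> borel_measurable L" "integrable L H" "integrable L (\<lambda>p. W (Y p) * norm (H p))"
    for L :: "'c measure" and Y and H :: "'c \<Rightarrow> complex^'n"
    unfolding m_eq by (intro integrable_vec_lambda Bochner_Integration.integrable_sum entry that)
  show mG: "integrable M (\<lambda>p. m (X p) (G p))" by (rule mint[OF X G int])
  have rep: "fm_rep \<nu> (\<lambda>\<xi>. m \<xi> (g \<xi>)) \<and> fm_of \<nu> (\<lambda>\<xi>. m \<xi> (g \<xi>)) = lift M X (\<lambda>p. m (X p) (G p))"
    if r: "fm_rep \<nu> g" "fm_of \<nu> g = lift M X G" for \<nu> g
  proof
    note D = fm_repD[OF r(1)]
    note Wg = rep_weight_integrable(1)[OF r X G W W0 int]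
    have mg: "integrable \<nu> (\<lambda>\<xi>. m \<xi> (g \<xi>))" by (rule mint[OF D(1,2) Wg])
    then show "fm_rep \<nu> (\<lambda>\<xi>. m \<xi> (g \<xi>))" using r(1) by (simp add: fm_rep_def)
    have comp: "(\<integral>\<xi>. cis (- (x \<bullet> \<xi>)) * g \<xi> $ i \<partial>\<nu>) = (\<integral>p. cis (- (x \<bullet> X p)) * G p $ i \<partial>M)" for x i
      using arg_cong[OF r(2), of "\<lambda>u. u x $ i"] unfolding fm_of_eq_lift
      by (simp add: lift_nth[OF D(1,2)] lift_nth[OF X G])
    have "lift \<nu> (\<lambda>\<xi>. \<xi>) (\<lambda>\<xi>. m \<xi> (g \<xi>)) x $ i = lift M X (\<lambda>p. m (X p) (G p)) x $ i" for x i
    proof -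
      \<comment> \<open>For fixed \<open>x\<close> the character is absorbed into the multiplier,
        and each matrix entry becomes an admissible unbounded test function of the
        frequency.\<close>
      have [measurable]: "(\<lambda>\<xi>. cis (- (x \<bullet> \<xi>)) * K i j \<xi>) \<in> borel_measurable borel" for j by measurable
      have ib: "integrable L (\<lambda>p. (cis (- (x \<bullet> Y p)) * K i j (Y p)) * H p $ j)"
        if [measurable]: "Y \<in> borel_measurable L" and *: "integrable L H" "integrable L (\<lambda>p. W (Y p) * norm (H p))"
        for L :: "'c measure" and Y and H :: "'c \<Rightarrow> complex^'n" and j
        using integrable_bounded_mult[OF entry[OF that, of i j], of "\<lambda>p. cis (- (x \<bullet> Y p))" 1]
        by (simp add: mult.assoc)
      have "lift \<nu> (\<lambda>\<xi>. \<xi>) (\<lambda>\<xi>. m \<xi> (g \<xi>)) x $ i = (\<Sum>j\<in>UNIV. \<integral>\<xi>. (cis (- (x \<bullet> \<xi>)) * K i j \<xi>) * g \<xi> $ j \<partial>\<nu>)"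
        unfolding lift_nth[OF D(1) mg] m
        by (subst Bochner_Integration.integral_sum[symmetric]) (use ib[OF D(1,2) Wg] in \<open>auto simp: sum_distrib_left mult.assoc\<close>)
      also have "\<dots> = (\<Sum>j\<in>UNIV. \<integral>p. (cis (- (x \<bullet> X p)) * K i j (X p)) * G p $ j \<partial>M)"
        by (intro sum.cong refl fourier_uniqueness_unbounded[OF D(1) X integrable_vec_nth[OF D(2)] integrable_vec_nth[OF G] comp]
            ib[OF D(1,2) Wg] ib[OF X G int]) measurable
      also have "\<dots> = lift M X (\<lambda>p. m (X p) (G p)) x $ i"
        unfolding lift_nth[OF X mG] m
        by (subst Bochner_Integration.integral_sum[symmetric]) (use ib[OF X G int] in \<open>auto simp: sum_distrib_left mult.assoc\<close>)
      finally show ?thesis .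
    qed
    then show "fm_of \<nu> (\<lambda>\<xi>. m \<xi> (g \<xi>)) = lift M X (\<lambda>p. m (X p) (G p))"
      unfolding fm_of_eq_lift by (auto simp: fun_eq_iff vec_eq_iff)
  qed
  then show "fm_rep \<nu> g \<Longrightarrow> fm_of \<nu> g = lift M X G \<Longrightarrow>
          fm_rep \<nu> (\<lambda>\<xi>. m \<xi> (g \<xi>)) \<and> fm_of \<nu> (\<lambda>\<xi>. m \<xi> (g \<xi>)) = lift M X (\<lambda>p. m (X p) (G p))" .
  define q where "q = (SOME p. p \<in> fm_reps (lift M X G))"
  have "\<exists>p. p \<in> fm_reps (lift M X G)" using lift_rep_exists[OF X G] by (auto simp: fm_reps_def)
  then have "q \<in> fm_reps (lift M X G)" unfolding q_def by (rule someI_ex)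
  then have "fm_rep (fst q) (snd q)" "fm_of (fst q) (snd q) = lift M X G" by (auto simp: fm_reps_def)
  from rep[OF this] show "fm_mult m (lift M X G) = lift M X (\<lambda>p. m (X p) (G p))"
    by (simp add: fm_mult_def Let_def flip: q_def)
qed

section \<open>The symbol of the linear part and the Helmholtz projection\<close>

definition symb :: "real \<Rightarrow> real \<Rightarrow> real \<Rightarrow> real^'n \<Rightarrow> real" where
  "symb \<alpha> \<Gamma>0 \<Gamma>2 \<xi> = \<alpha> + \<Gamma>0 * norm \<xi> ^ 2 + \<Gamma>2 * norm \<xi> ^ 4"

lemma symb_measurable[measurable]: "symb \<alpha> \<Gamma>0 \<Gamma>2 \<in> borel_measurable borel"
  unfolding symb_def by measurable

lemma abs_symb_le: "\<bar>symb \<alpha> \<Gamma>0 \<Gamma>2 \<xi>\<bar> \<le> (\<bar>\<alpha>\<bar> + \<bar>\<Gamma>0\<bar> + \<bar>\<Gamma>2\<bar>) * (1 + norm \<xi> ^ 4)"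
proof -
  have "norm \<xi> ^ 2 \<le> 1 + norm \<xi> ^ 4"
  proof -
    have "0 \<le> (norm \<xi> ^ 2 - 1)\<^sup>2" "0 \<le> norm \<xi> ^ 2" by simp_all
    moreover have "(norm \<xi> ^ 2 - 1)\<^sup>2 = norm \<xi> ^ 4 - 2 * norm \<xi> ^ 2 + 1"
      by (simp add: power2_diff flip: power_mult)
    ultimately show ?thesis by linarith
  qed
  then have "\<bar>\<Gamma>0\<bar> * norm \<xi> ^ 2 \<le> \<bar>\<Gamma>0\<bar> * (1 + norm \<xi> ^ 4)" by (intro mult_left_mono) auto
  moreover have "\<bar>\<alpha>\<bar> * 1 \<le> \<bar>\<alpha>\<bar> * (1 + norm \<xi> ^ 4)" by (intro mult_left_mono) auto
  moreover have "\<bar>\<Gamma>2\<bar> * norm \<xi> ^ 4 \<le> \<bar>\<Gamma>2\<bar> * (1 + norm \<xi> ^ 4)" by (intro mult_left_mono) auto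
  moreover have "\<bar>symb \<alpha> \<Gamma>0 \<Gamma>2 \<xi>\<bar> \<le> \<bar>\<alpha>\<bar> + \<bar>\<Gamma>0\<bar> * norm \<xi> ^ 2 + \<bar>\<Gamma>2\<bar> * norm \<xi> ^ 4"
    unfolding symb_def
    using abs_triangle_ineq[of "\<alpha> + \<Gamma>0 * norm \<xi> ^ 2" "\<Gamma>2 * norm \<xi> ^ 4"] abs_triangle_ineq[of \<alpha> "\<Gamma>0 * norm \<xi> ^ 2"]
    by (simp add: abs_mult)
  ultimately show ?thesis by (simp add: distrib_right)
qed

lemma
  fixes X :: "'a \<Rightarrow> real^'n"
  assumes X: "X \<in> borel_measurable M" and G: "integrable M G"
    and int: "integrable M (\<lambda>p. norm (X p) ^ 4 * norm (G p))"
  shows integrable_symb: "integrable M (\<lambda>p. symb \<alpha> \<Gamma>0 \<Gamma>2 (X p) *\<^sub>R G p)"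
    and A_d_lift: "A_d \<alpha> \<Gamma>0 \<Gamma>2 (lift M X G) = lift M X (\<lambda>p. symb \<alpha> \<Gamma>0 \<Gamma>2 (X p) *\<^sub>R G p)"
proof -
  define K where "K i j \<xi> = (if i = j then complex_of_real (symb \<alpha> \<Gamma>0 \<Gamma>2 \<xi>) else 0)" for i j :: 'n and \<xi> :: "real^'n"
  define W where "W \<xi> = (\<bar>\<alpha>\<bar> + \<bar>\<Gamma>0\<bar> + \<bar>\<Gamma>2\<bar>) * (1 + norm \<xi> ^ 4)" for \<xi> :: "real^'n"
  have K: "K i j \<in> borel_measurable borel" for i j unfolding K_def by measurable
  have W: "W \<in> borel_measurable borel" unfolding W_def by measurable
  have KW: "cmod (K i j \<xi>) \<le> W \<xi>" for i j \<xi>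
    using abs_symb_le[of \<alpha> \<Gamma>0 \<Gamma>2 \<xi>] by (auto simp: K_def W_def)
  have "integrable M (\<lambda>p. (\<bar>\<alpha>\<bar> + \<bar>\<Gamma>0\<bar> + \<bar>\<Gamma>2\<bar>) * (norm (G p) + norm (X p) ^ 4 * norm (G p)))"
    using G int by (intro integrable_mult_right Bochner_Integration.integrable_add) auto
  then have Wint: "integrable M (\<lambda>p. W (X p) * norm (G p))"
    by (simp add: W_def algebra_simps)
  have m: "(symb \<alpha> \<Gamma>0 \<Gamma>2 \<xi> *\<^sub>R v) $ i = (\<Sum>j\<in>UNIV. K i j \<xi> * v $ j)" for \<xi> v i
    by (simp add: K_def if_distrib[of "\<lambda>c. c * _"] scaleR_conv_of_real[of _ "_ $ _"] cong: if_cong)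
  note * = X G K W KW Wint m
  show "integrable M (\<lambda>p. symb \<alpha> \<Gamma>0 \<Gamma>2 (X p) *\<^sub>R G p)"
    by (rule integrable_multiplier[OF *])
  show "A_d \<alpha> \<Gamma>0 \<Gamma>2 (lift M X G) = lift M X (\<lambda>p. symb \<alpha> \<Gamma>0 \<Gamma>2 (X p) *\<^sub>R G p)"
    using fm_mult_lift[OF *] by (simp add: A_d_def symb_def)
qed

definition cdot :: "real^'n \<Rightarrow> complex^'n \<Rightarrow> complex" where
  "cdot \<xi> v = (\<Sum>i\<in>UNIV. complex_of_real (\<xi> $ i) * v $ i)"

definition hdot :: "complex^'n \<Rightarrow> complex^'n \<Rightarrow> complex" where
  "hdot u v = (\<Sum>i\<in>UNIV. u $ i * cnj (v $ i))"

text \<open>The multiplier inside \<open>helmholtz\<close>. Its value 0 at the frequency 0 lets the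
  single equation \<open>proj \<xi> v = v\<close> encode solenoidality together with the absence of
  mass at the origin.\<close>

definition proj :: "real^'n \<Rightarrow> complex^'n \<Rightarrow> complex^'n" where
  "proj \<xi> v = (if \<xi> = 0 then 0 else
      (\<chi> j. v $ j - (\<Sum>i\<in>UNIV. complex_of_real (\<xi> $ i * \<xi> $ j / (norm \<xi>)\<^sup>2) * v $ i)))"

lemma cauchy_schwarz_sum:
  fixes f g :: "'n::finite \<Rightarrow> complex"
  shows "cmod (\<Sum>i\<in>UNIV. f i * g i) \<le> norm (\<chi> i. f i) * norm (\<chi> i. g i)"
proof -
  have "cmod (\<Sum>i\<in>UNIV. f i * g i) \<le> (\<Sum>i\<in>UNIV. \<bar>cmod (f i)\<bar> * \<bar>cmod (g i)\<bar>)"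
    using norm_sum[of "\<lambda>i. f i * g i" UNIV] by (simp add: norm_mult)
  also have "\<dots> \<le> norm (\<chi> i. f i) * norm (\<chi> i. g i)"
    unfolding norm_vec_def using L2_set_mult_ineq[of "\<lambda>i. cmod (f i)" "\<lambda>i. cmod (g i)" UNIV] by simp
  finally show ?thesis .
qed

lemma norm_cvec: "norm (\<chi> i. complex_of_real (\<xi> $ i)) = norm \<xi>"
  by (simp add: norm_vec_def)

lemma cmod_cdot_le: "cmod (cdot \<xi> v) \<le> norm \<xi> * norm v"
  using cauchy_schwarz_sum[of "\<lambda>i. complex_of_real (\<xi> $ i)" "\<lambda>i. v $ i"]
  by (simp add: cdot_def norm_cvec)

lemma cmod_hdot_le: "cmod (hdot u v) \<le> norm u * norm v"
  using cauchy_schwarz_sum[of "\<lambda>i. u $ i" "\<lambda>i. cnj (v $ i)"]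
  by (simp add: hdot_def norm_vec_def)

lemma cdot_add_left: "cdot (\<xi> + \<eta>) v = cdot \<xi> v + cdot \<eta> v"
  by (simp add: cdot_def distrib_right sum.distrib)

lemma cdot_scaleR: "cdot \<xi> (r *\<^sub>R v) = r *\<^sub>R cdot \<xi> v"
  by (simp add: cdot_def scaleR_sum_right)

lemma norm_sq_cvec: "(\<Sum>j\<in>UNIV. complex_of_real (\<xi> $ j) * complex_of_real (\<xi> $ j)) = complex_of_real ((norm \<xi>)\<^sup>2)"
  by (simp add: power2_norm_eq_inner inner_vec_def)

lemma proj_eq:
  "\<xi> \<noteq> 0 \<Longrightarrow> proj \<xi> v = v - (cdot \<xi> v / complex_of_real ((norm \<xi>)\<^sup>2)) *s (\<chi> i. complex_of_real (\<xi> $ i))"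
  by (simp add: proj_def vec_eq_iff[of "vec_lambda _"] cdot_def sum_divide_distrib sum_distrib_left mult_ac)

lemma cdot_proj: "cdot \<xi> (proj \<xi> v) = 0"
proof (cases "\<xi> = 0")
  case False
  have "cdot \<xi> (proj \<xi> v) = cdot \<xi> v - (cdot \<xi> v / complex_of_real ((norm \<xi>)\<^sup>2)) * (\<Sum>j\<in>UNIV. complex_of_real (\<xi> $ j) * complex_of_real (\<xi> $ j))"
    unfolding proj_eq[OF False]
    by (simp add: cdot_def[of _ "_ - _"] right_diff_distrib sum_subtractf sum_distrib_left mult.left_commute flip: cdot_def)
  then show ?thesis using False by (simp add: norm_sq_cvec)
qed (simp add: proj_def cdot_def)

lemma proj_0: "proj 0 v = 0"
  by (simp add: proj_def)

lemma proj_id: "\<xi> \<noteq> 0 \<Longrightarrow> cdot \<xi> v = 0 \<Longrightarrow> proj \<xi> v = v"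
  by (simp add: proj_eq)

lemma proj_idem: "proj \<xi> (proj \<xi> v) = proj \<xi> v"
  using proj_id[OF _ cdot_proj] by (cases "\<xi> = 0") (auto simp: proj_0)

text \<open>Splitting off the removed component by the triangle inequality gives 2 instead of the
  optimal 1; this 2 reappears in the later constants.\<close>

lemma norm_proj_le: "norm (proj \<xi> v) \<le> 2 * norm v"
proof (cases "\<xi> = 0")
  case False
  have "norm (proj \<xi> v) \<le> norm v + cmod (cdot \<xi> v / complex_of_real ((norm \<xi>)\<^sup>2)) * norm \<xi>"
    unfolding proj_eq[OF False]
    by (rule order_trans[OF norm_triangle_ineq4]) (simp add: norm_vector_scalar_mult norm_cvec)
  also have "cmod (cdot \<xi> v / complex_of_real ((norm \<xi>)\<^sup>2)) * norm \<xi> \<le> norm v"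
    using cmod_cdot_le[of \<xi> v] False
    by (simp add: norm_divide power2_eq_square divide_le_eq norm_mult mult_ac)
  finally show ?thesis by simp
qed (simp add: proj_0)

lemma bounded_linear_proj: "bounded_linear (proj \<xi>)"
proof (cases "\<xi> = 0")
  case True
  then have "proj \<xi> = (\<lambda>_. 0)" by (simp add: fun_eq_iff proj_0)
  then show ?thesis by (simp add: bounded_linear_zero)
next
  case False
  show ?thesis
  proof (rule bounded_linear_intro)
    show "proj \<xi> (x + y) = proj \<xi> x + proj \<xi> y" for x y
      using False by (simp add: proj_eq cdot_def vec_eq_iff algebra_simps sum.distrib add_divide_distrib)
    show "proj \<xi> (r *\<^sub>R x) = r *\<^sub>R proj \<xi> x" for r x
      using False by (simp add: proj_eq cdot_scaleR scaleR_diff_right divide_inverse vsm.scaleR_left)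
    show "norm (proj \<xi> x) \<le> norm x * 2" for x using norm_proj_le[of \<xi> x] by simp
  qed
qed

lemmas proj_add = linear_add[OF bounded_linear.linear[OF bounded_linear_proj]]
lemmas proj_diff = linear_diff[OF bounded_linear.linear[OF bounded_linear_proj]]
lemmas proj_scaleR = linear_scale[OF bounded_linear.linear[OF bounded_linear_proj]]

lemma
  fixes X :: "'a \<Rightarrow> real^'n"
  assumes X: "X \<in> borel_measurable M" and G: "integrable M G"
  shows integrable_proj: "integrable M (\<lambda>p. proj (X p) (G p))"
    and proj_rep: "fm_rep \<nu> g \<Longrightarrow> fm_of \<nu> g = lift M X G \<Longrightarrow>
          fm_rep \<nu> (\<lambda>\<xi>. proj \<xi> (g \<xi>)) \<and> fm_of \<nu> (\<lambda>\<xi>. proj \<xi> (g \<xi>)) = lift M X (\<lambda>p. proj (X p) (G p))"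
    and helmholtz_lift: "helmholtz (lift M X G) = lift M X (\<lambda>p. proj (X p) (G p))"
proof -
  define K where "K i j \<xi> = (if \<xi> = 0 then 0 else (if i = j then 1 else 0) - complex_of_real (\<xi> $ j * \<xi> $ i / (norm \<xi>)\<^sup>2))"
    for i j :: 'n and \<xi> :: "real^'n"
  have K: "K i j \<in> borel_measurable borel" for i j unfolding K_def by measurable
  have KW: "cmod (K i j \<xi>) \<le> 2" for i j \<xi>
  proof (cases "\<xi> = 0")
    case False
    have "cmod (complex_of_real (\<xi> $ j * \<xi> $ i / (norm \<xi>)\<^sup>2)) \<le> 1"
      using False mult_mono[OF component_le_norm_cart[of \<xi> j] component_le_norm_cart[of \<xi> i]]
      by (simp add: norm_divide norm_mult norm_power power2_eq_square divide_le_eq)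
    moreover have "cmod (if i = j then 1 else 0) \<le> 1" by simp
    ultimately have "cmod ((if i = j then 1 else 0) - complex_of_real (\<xi> $ j * \<xi> $ i / (norm \<xi>)\<^sup>2)) \<le> 1 + 1"
      by (intro order_trans[OF norm_triangle_ineq4] add_mono)
    then show ?thesis using False unfolding K_def by simp
  qed (simp add: K_def)
  have int: "integrable M (\<lambda>p. 2 * norm (G p))" using G by simp
  have m: "proj \<xi> v $ i = (\<Sum>j\<in>UNIV. K i j \<xi> * v $ j)" for \<xi> v i
    by (simp add: proj_def K_def left_diff_distrib sum_subtractf if_distrib[of "\<lambda>c. c * _"] cong: if_cong)
  have W: "(\<lambda>_. 2) \<in> borel_measurable borel" by simp
  note * = X G K W KW int m
  show "integrable M (\<lambda>p. proj (X p) (G p))" by (rule integrable_multiplier[OF *])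
  show "fm_rep \<nu> g \<Longrightarrow> fm_of \<nu> g = lift M X G \<Longrightarrow>
          fm_rep \<nu> (\<lambda>\<xi>. proj \<xi> (g \<xi>)) \<and> fm_of \<nu> (\<lambda>\<xi>. proj \<xi> (g \<xi>)) = lift M X (\<lambda>p. proj (X p) (G p))"
    by (rule multiplier_rep[OF *])
  show "helmholtz (lift M X G) = lift M X (\<lambda>p. proj (X p) (G p))"
    unfolding helmholtz_def proj_def[symmetric] by (rule fm_mult_lift[OF *])
qed

text \<open>The hypothesis holds at each point of the lift, whereas membership concerns the
  pushed-forward density. Projecting that density does not change the represented field, and a
  projected density meets both conditions pointwise.\<close>

lemma lift_in_FM0_sigma:
  assumes X: "X \<in> borel_measurable M" and G: "integrable M G" and p: "\<And>p. proj (X p) (G p) = G p"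
  shows "lift M X G \<in> FM0_sigma"
proof -
  obtain \<nu> g where r: "fm_rep \<nu> g" "fm_of \<nu> g = lift M X G" using lift_rep_exists[OF X G] by blast
  from proj_rep[OF X G r] have "(\<nu>, \<lambda>\<xi>. proj \<xi> (g \<xi>)) \<in> fm_reps (lift M X G)"
    by (simp add: p fm_reps_def)
  moreover have "(\<integral>\<xi>. indicator {0} \<xi> *\<^sub>R proj \<xi> (g \<xi>) \<partial>\<nu>) = 0"
    by (rule integral_eq_zero_AE) (auto simp: indicator_def proj_0)
  moreover have "AE \<xi> in \<nu>. (\<Sum>i\<in>UNIV. complex_of_real (\<xi> $ i) * (proj \<xi> (g \<xi>) $ i)) = 0"
    using cdot_proj unfolding cdot_def by auto
  ultimately show ?thesis unfolding FM0_sigma_def by (auto intro!: bexI[of _ "(\<nu>, \<lambda>\<xi>. proj \<xi> (g \<xi>))"])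
qed

section \<open>Derivatives of lifted fields\<close>

lemma cmod_cis_minus_one_le: "cmod (cis s - 1) \<le> \<bar>s\<bar>"
proof -
  have "(cmod (cis s - 1))\<^sup>2 = (cos s - 1)\<^sup>2 + (sin s)\<^sup>2"
    by (simp add: cmod_power2)
  also have "\<dots> = 2 * (1 - cos s)"
    using sin_cos_squared_add[of s] by (simp add: power2_diff)
  also have "\<dots> = (2 * sin (s / 2))\<^sup>2"
    using cos_double_sin[of "s / 2"] by (simp add: power_mult_distrib)
  finally have "cmod (cis s - 1) = \<bar>2 * sin (s / 2)\<bar>"
    by (metis abs_norm_cancel power2_eq_iff_nonneg abs_ge_zero norm_ge_zero power2_abs)
  also have "\<dots> \<le> \<bar>s\<bar>" using abs_sin_x_le_abs_x[of "s / 2"] by (simp add: abs_mult)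
  finally show ?thesis .
qed

lemma tendsto_cis_quotient:
  "((\<lambda>h. (cis (- (h * c)) - 1) /\<^sub>R h) \<longlongrightarrow> - \<i> * complex_of_real c) (at 0)"
proof -
  have "((\<lambda>z. exp (z * (- \<i> * complex_of_real c))) has_field_derivative - \<i> * complex_of_real c) (at 0)"
    by (auto intro!: derivative_eq_intros)
  then have "((\<lambda>z. (exp (z * (- \<i> * complex_of_real c)) - 1) / z) \<longlongrightarrow> - \<i> * complex_of_real c) (at 0)"
    by (simp add: has_field_derivative_iff)
  moreover have "filterlim complex_of_real (at 0) (at 0)"
    by (rule filterlim_atI) (auto simp: eventually_at_filter intro!: tendsto_eq_intros)
  ultimately have "((\<lambda>h. (exp (complex_of_real h * (- \<i> * complex_of_real c)) - 1) / complex_of_real h) \<longlongrightarrow> - \<i> * complex_of_real c) (at 0)"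
    by (rule filterlim_compose)
  moreover have "(exp (complex_of_real h * (- \<i> * complex_of_real c)) - 1) / complex_of_real h = (cis (- (h * c)) - 1) /\<^sub>R h" for h
    by (simp add: cis_conv_exp scaleR_conv_of_real divide_inverse mult_ac)
  ultimately show ?thesis by simp
qed

text \<open>Differentiation under the integral sign: since |cis s - 1| \<le> |s|, the difference
  quotients of the characters are dominated by \<open>norm (X p) * norm (G p)\<close>.\<close>

lemma
  fixes X :: "'a \<Rightarrow> real^'n"
  assumes X[measurable]: "X \<in> borel_measurable M" and G: "integrable M G"
    and int: "integrable M (\<lambda>p. norm (X p) * norm (G p))"
  shows integrable_pdiff: "integrable M (\<lambda>p. (- \<i> * complex_of_real (X p $ i)) *s G p)"
    and pdiff_lift: "pdiff i (lift M X G) = lift M X (\<lambda>p. (- \<i> * complex_of_real (X p $ i)) *s G p)"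
proof -
  note [measurable] = borel_measurable_integrable[OF G]
  show I: "integrable M (\<lambda>p. (- \<i> * complex_of_real (X p $ i)) *s G p)"
    by (rule Bochner_Integration.integrable_bound[OF int])
      (auto simp: norm_vector_scalar_mult norm_mult intro!: mult_right_mono component_le_norm_cart)
  have "pdiff i (lift M X G) x = lift M X (\<lambda>p. (- \<i> * complex_of_real (X p $ i)) *s G p) x" for x
    unfolding pdiff_def
  proof (rule vector_derivative_at, rule has_vector_derivativeI_quotient)
    let ?q = "\<lambda>h p. (cis (- (h * (X p $ i))) - 1) /\<^sub>R h"
    have e: "cis (- ((x + (0 + h) *\<^sub>R axis i 1) \<bullet> X p)) = cis (- (x \<bullet> X p)) * cis (- (h * (X p $ i)))" for h p
      by (simp add: cis_mult inner_add_left inner_axis')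
    have "((\<lambda>h. \<integral>p. (cis (- (x \<bullet> X p)) * ?q h p) *s G p \<partial>M) \<longlongrightarrow> (\<integral>p. (cis (- (x \<bullet> X p)) * (- \<i> * complex_of_real (X p $ i))) *s G p \<partial>M)) (at 0)"
    proof (rule dominated_convergence_within[where d = 1, OF _ _ _ _ _ int])
      show "((\<lambda>h. (cis (- (x \<bullet> X p)) * ?q h p) *s G p) \<longlongrightarrow> (cis (- (x \<bullet> X p)) * (- \<i> * complex_of_real (X p $ i))) *s G p) (at 0)" for p
        by (intro vsm.tendsto tendsto_const tendsto_mult tendsto_cis_quotient)
      show "norm ((cis (- (x \<bullet> X p)) * ?q h p) *s G p) \<le> norm (X p) * norm (G p)" if "h \<noteq> 0" for h p
      proof -
        have "cmod (?q h p) \<le> \<bar>X p $ i\<bar>"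
          using cmod_cis_minus_one_le[of "- (h * (X p $ i))"] that by (simp add: abs_mult divide_simps mult.commute)
        also have "\<dots> \<le> norm (X p)" by (rule component_le_norm_cart)
        finally show ?thesis by (simp add: norm_vector_scalar_mult norm_mult mult_right_mono)
      qed
    qed (auto intro!: borel_measurable_vector_scalar_mult)
    moreover have "(lift M X G (x + (0 + h) *\<^sub>R axis i 1) - lift M X G (x + 0 *\<^sub>R axis i 1)) /\<^sub>R h
        = (\<integral>p. (cis (- (x \<bullet> X p)) * ?q h p) *s G p \<partial>M)" for h
    proof -
      have "lift M X G (x + (0 + h) *\<^sub>R axis i 1) - lift M X G (x + 0 *\<^sub>R axis i 1)
          = (\<integral>p. cis (- ((x + (0 + h) *\<^sub>R axis i 1) \<bullet> X p)) *s G p - cis (- (x \<bullet> X p)) *s G p \<partial>M)"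
        unfolding lift_def by (subst Bochner_Integration.integral_diff) (auto intro!: integrable_lift G)
      moreover have "(cis (- ((x + (0 + h) *\<^sub>R axis i 1) \<bullet> X p)) *s G p - cis (- (x \<bullet> X p)) *s G p) /\<^sub>R h
          = (cis (- (x \<bullet> X p)) * ?q h p) *s G p" for p
        unfolding e vsm.diff_left[symmetric] vsm.scaleR_left[symmetric] by (simp add: right_diff_distrib)
      ultimately show ?thesis by (simp only: integral_scaleR_right[symmetric])
    qed
    ultimately show "((\<lambda>h. (lift M X G (x + (0 + h) *\<^sub>R axis i 1) - lift M X G (x + 0 *\<^sub>R axis i 1)) /\<^sub>R h)
        \<longlongrightarrow> lift M X (\<lambda>p. (- \<i> * complex_of_real (X p $ i)) *s G p) x) (at 0)"
      by (simp add: lift_def)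
  qed
  then show "pdiff i (lift M X G) = lift M X (\<lambda>p. (- \<i> * complex_of_real (X p $ i)) *s G p)" by auto
qed

section \<open>Products of fields as lifts to product spaces\<close>

lemma
  fixes f :: "'a \<Rightarrow> 'c::{real_normed_field, banach, second_countable_topology}" and g :: "'b \<Rightarrow> 'c"
  assumes "sigma_finite_measure M1" "sigma_finite_measure M2" and f: "integrable M1 f" and g: "integrable M2 g"
  shows integrable_pair_mult: "integrable (M1 \<Otimes>\<^sub>M M2) (\<lambda>z. f (fst z) * g (snd z))"
    and integral_pair_mult: "(\<integral>z. f (fst z) * g (snd z) \<partial>(M1 \<Otimes>\<^sub>M M2)) = (\<integral>p. f p \<partial>M1) * (\<integral>q. g q \<partial>M2)"
proof -
  interpret M1: sigma_finite_measure M1 by fact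
  interpret M2: sigma_finite_measure M2 by fact
  interpret pair_sigma_finite M1 M2 ..
  note [measurable] = borel_measurable_integrable[OF f] borel_measurable_integrable[OF g]
  show *: "integrable (M1 \<Otimes>\<^sub>M M2) (\<lambda>z. f (fst z) * g (snd z))"
    by (rule Fubini_integrable) (auto simp: norm_mult f g)
  show "(\<integral>z. f (fst z) * g (snd z) \<partial>(M1 \<Otimes>\<^sub>M M2)) = (\<integral>p. f p \<partial>M1) * (\<integral>q. g q \<partial>M2)"
    using integral_fst'[OF *] f g by simp
qed

text \<open>Polarised form of \<open>advect\<close>, so that a difference of two advection terms can
  be expanded with the difference of the fields as one factor.\<close>

definition advB :: "('n::finite) vfield \<Rightarrow> 'n vfield \<Rightarrow> 'n vfield" where
  "advB u v = (\<lambda>x. \<chi> j. \<Sum>i\<in>UNIV. u x $ i * pdiff i v x $ j)"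

definition cubT :: "('n::finite) vfield \<Rightarrow> 'n vfield \<Rightarrow> 'n vfield \<Rightarrow> 'n vfield" where
  "cubT u v w = (\<lambda>x. hdot (u x) (v x) *s w x)"

lemma advect_eq_advB: "advect u = advB u u"
  by (simp add: advect_def advB_def)

lemma hdot_self: "hdot v v = complex_of_real (\<Sum>i\<in>UNIV. (cmod (v $ i))\<^sup>2)"
  unfolding hdot_def of_real_sum complex_norm_square ..

lemma cubic_eq_cubT: "cubic u = cubT u u u"
  unfolding cubic_def cubT_def
  by (simp add: fun_eq_iff vec_eq_iff scaleR_conv_of_real[of _ "_ $ _"] hdot_self del: of_real_sum)

text \<open>A product of transforms is the transform of a convolution, and on the product space the
  convolution is merely the sum of the frequencies. The derivative multiplies by the second
  frequency, paired with the first amplitude; a first moment of the second factor pays for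
  it.\<close>

lemma
  fixes X1 :: "'a \<Rightarrow> real^'n" and X2 :: "'b \<Rightarrow> real^'n"
  assumes s: "sigma_finite_measure M1" "sigma_finite_measure M2"
    and X[measurable]: "X1 \<in> borel_measurable M1" "X2 \<in> borel_measurable M2"
    and G: "integrable M1 G1" "integrable M2 G2" and int: "integrable M2 (\<lambda>q. norm (X2 q) * norm (G2 q))"
  defines "H \<equiv> (\<lambda>z. (- \<i> * cdot (X2 (snd z)) (G1 (fst z))) *s G2 (snd z))"
  shows integrable_advB: "integrable (M1 \<Otimes>\<^sub>M M2) H"
    and norm_advB_le: "(\<integral>z. norm (H z) \<partial>(M1 \<Otimes>\<^sub>M M2)) \<le> (\<integral>p. norm (G1 p) \<partial>M1) * (\<integral>q. norm (X2 q) * norm (G2 q) \<partial>M2)"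
    and advB_lift: "advB (lift M1 X1 G1) (lift M2 X2 G2) = lift (M1 \<Otimes>\<^sub>M M2) (\<lambda>z. X1 (fst z) + X2 (snd z)) H"
proof -
  note [measurable] = borel_measurable_integrable[OF G(1)] borel_measurable_integrable[OF G(2)]
  let ?w = "\<lambda>z. norm (G1 (fst z)) * (norm (X2 (snd z)) * norm (G2 (snd z)))"
  have wi: "integrable (M1 \<Otimes>\<^sub>M M2) ?w"
    by (rule integrable_pair_mult[OF s integrable_norm[OF G(1)] int])
  have Hw: "norm (H z) \<le> ?w z" for z
  proof -
    have "norm (H z) = cmod (cdot (X2 (snd z)) (G1 (fst z))) * norm (G2 (snd z))"
      by (simp add: H_def norm_vector_scalar_mult norm_mult)
    also have "\<dots> \<le> (norm (X2 (snd z)) * norm (G1 (fst z))) * norm (G2 (snd z))"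
      by (intro mult_right_mono cmod_cdot_le) simp
    finally show ?thesis by (simp add: mult_ac)
  qed
  have Hm[measurable]: "H \<in> borel_measurable (M1 \<Otimes>\<^sub>M M2)" unfolding H_def cdot_def by measurable
  show H: "integrable (M1 \<Otimes>\<^sub>M M2) H"
    by (rule Bochner_Integration.integrable_bound[OF wi]) (use Hw in \<open>auto intro: AE_I2\<close>)
  have "(\<integral>z. norm (H z) \<partial>(M1 \<Otimes>\<^sub>M M2)) \<le> (\<integral>z. ?w z \<partial>(M1 \<Otimes>\<^sub>M M2))"
    by (rule integral_mono[OF integrable_norm[OF H] wi Hw])
  also have "\<dots> = (\<integral>p. norm (G1 p) \<partial>M1) * (\<integral>q. norm (X2 q) * norm (G2 q) \<partial>M2)"
    by (rule integral_pair_mult[OF s integrable_norm[OF G(1)] int])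
  finally show "(\<integral>z. norm (H z) \<partial>(M1 \<Otimes>\<^sub>M M2)) \<le> (\<integral>p. norm (G1 p) \<partial>M1) * (\<integral>q. norm (X2 q) * norm (G2 q) \<partial>M2)" .
  have "advB (lift M1 X1 G1) (lift M2 X2 G2) x $ j = lift (M1 \<Otimes>\<^sub>M M2) (\<lambda>z. X1 (fst z) + X2 (snd z)) H x $ j" for x j
  proof -
    define F1 where "F1 i p = cis (- (x \<bullet> X1 p)) * G1 p $ i" for i p
    define F2 where "F2 i q = cis (- (x \<bullet> X2 q)) * ((- \<i> * complex_of_real (X2 q $ i)) *s G2 q) $ j" for i q
    have F1: "integrable M1 (F1 i)" for i
      unfolding F1_def by (rule integrable_bounded_mult[where B = 1, OF integrable_vec_nth[OF G(1)]]) auto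
    have F2: "integrable M2 (F2 i)" for i
      unfolding F2_def by (rule integrable_bounded_mult[where B = 1, OF integrable_vec_nth[OF integrable_pdiff[OF X(2) G(2) int]]]) auto
    have "advB (lift M1 X1 G1) (lift M2 X2 G2) x $ j = (\<Sum>i\<in>UNIV. (\<integral>p. F1 i p \<partial>M1) * (\<integral>q. F2 i q \<partial>M2))"
      unfolding advB_def pdiff_lift[OF X(2) G(2) int] lift_nth[OF X(1) G(1)] F1_def
          lift_nth[OF X(2) integrable_pdiff[OF X(2) G(2) int]] F2_def vec_lambda_beta ..
    also have "\<dots> = (\<Sum>i\<in>UNIV. \<integral>z. F1 i (fst z) * F2 i (snd z) \<partial>(M1 \<Otimes>\<^sub>M M2))"
      by (simp add: integral_pair_mult[OF s F1 F2])
    also have "\<dots> = (\<integral>z. (\<Sum>i\<in>UNIV. F1 i (fst z) * F2 i (snd z)) \<partial>(M1 \<Otimes>\<^sub>M M2))"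
      by (rule Bochner_Integration.integral_sum[symmetric]) (rule integrable_pair_mult[OF s F1 F2])
    also have "(\<lambda>z. \<Sum>i\<in>UNIV. F1 i (fst z) * F2 i (snd z)) = (\<lambda>z. cis (- (x \<bullet> (X1 (fst z) + X2 (snd z)))) * H z $ j)"
    proof
      fix z
      have c: "cis (- (x \<bullet> (X1 (fst z) + X2 (snd z)))) = cis (- (x \<bullet> X1 (fst z))) * cis (- (x \<bullet> X2 (snd z)))"
        by (simp add: cis_mult inner_add_right)
      show "(\<Sum>i\<in>UNIV. F1 i (fst z) * F2 i (snd z)) = cis (- (x \<bullet> (X1 (fst z) + X2 (snd z)))) * H z $ j"
        unfolding c F1_def F2_def H_def cdot_def
        by (simp add: sum_distrib_left sum_distrib_right sum_negf mult_ac)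
    qed
    also have "(\<integral>z. cis (- (x \<bullet> (X1 (fst z) + X2 (snd z)))) * H z $ j \<partial>(M1 \<Otimes>\<^sub>M M2)) = lift (M1 \<Otimes>\<^sub>M M2) (\<lambda>z. X1 (fst z) + X2 (snd z)) H x $ j"
      by (rule lift_nth[symmetric, OF _ H]) measurable
    finally show ?thesis .
  qed
  then show "advB (lift M1 X1 G1) (lift M2 X2 G2) = lift (M1 \<Otimes>\<^sub>M M2) (\<lambda>z. X1 (fst z) + X2 (snd z)) H"
    by (auto simp: fun_eq_iff vec_eq_iff)
qed

text \<open>Conjugating the second field reverses its frequency, hence the minus sign in front of
  \<open>X2\<close>.\<close>

lemma
  fixes X1 :: "'a \<Rightarrow> real^'n" and X2 :: "'b \<Rightarrow> real^'n" and X3 :: "'c \<Rightarrow> real^'n"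
  assumes s: "sigma_finite_measure M1" "sigma_finite_measure M2" "sigma_finite_measure M3"
    and X[measurable]: "X1 \<in> borel_measurable M1" "X2 \<in> borel_measurable M2" "X3 \<in> borel_measurable M3"
    and G: "integrable M1 G1" "integrable M2 G2" "integrable M3 G3"
  defines "M \<equiv> M1 \<Otimes>\<^sub>M (M2 \<Otimes>\<^sub>M M3)"
    and "Y \<equiv> (\<lambda>z. X1 (fst z) - X2 (fst (snd z)) + X3 (snd (snd z)))"
    and "H \<equiv> (\<lambda>z. hdot (G1 (fst z)) (G2 (fst (snd z))) *s G3 (snd (snd z)))"
  shows integrable_cubT: "integrable M H"
    and norm_cubT_le: "(\<integral>z. norm (H z) \<partial>M) \<le> (\<integral>p. norm (G1 p) \<partial>M1) * ((\<integral>p. norm (G2 p) \<partial>M2) * (\<integral>p. norm (G3 p) \<partial>M3))"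
    and cubT_lift: "cubT (lift M1 X1 G1) (lift M2 X2 G2) (lift M3 X3 G3) = lift M Y H"
proof -
  note [measurable] = borel_measurable_integrable[OF G(1)] borel_measurable_integrable[OF G(2)] borel_measurable_integrable[OF G(3)]
  have [measurable]: "cnj \<in> borel_measurable borel"
    by (intro borel_measurable_continuous_onI continuous_intros)
  interpret M2: sigma_finite_measure M2 by fact
  interpret M3: sigma_finite_measure M3 by fact
  interpret M23: pair_sigma_finite M2 M3 ..
  have s23: "sigma_finite_measure (M2 \<Otimes>\<^sub>M M3)" ..
  note i23 = integrable_pair_mult[OF s(2,3)]
  note i123 = integrable_pair_mult[OF s(1) s23 _ i23]
  let ?w = "\<lambda>z. norm (G1 (fst z)) * (norm (G2 (fst (snd z))) * norm (G3 (snd (snd z))))"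
  have wi: "integrable M ?w"
    unfolding M_def by (rule i123[OF G[THEN integrable_norm]])
  have Hw: "norm (H z) \<le> ?w z" for z
    using mult_right_mono[OF cmod_hdot_le[of "G1 (fst z)" "G2 (fst (snd z))"] norm_ge_zero[of "G3 (snd (snd z))"]]
    by (simp add: H_def norm_vector_scalar_mult mult.assoc)
  have Hm[measurable]: "H \<in> borel_measurable M" unfolding H_def hdot_def M_def by measurable
  have Ym[measurable]: "Y \<in> borel_measurable M" unfolding Y_def M_def by measurable
  show H: "integrable M H"
    by (rule Bochner_Integration.integrable_bound[OF wi]) (use Hw in \<open>auto intro: AE_I2\<close>)
  have "(\<integral>z. norm (H z) \<partial>M) \<le> (\<integral>z. ?w z \<partial>M)"
    by (rule integral_mono[OF integrable_norm[OF H] wi Hw])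
  also have "\<dots> = (\<integral>p. norm (G1 p) \<partial>M1) * ((\<integral>p. norm (G2 p) \<partial>M2) * (\<integral>p. norm (G3 p) \<partial>M3))"
    unfolding M_def
    by (simp add: integral_pair_mult[OF s(1) s23 integrable_norm[OF G(1)] i23[OF G(2,3)[THEN integrable_norm]]]
        integral_pair_mult[OF s(2,3) G(2,3)[THEN integrable_norm]])
  finally show "(\<integral>z. norm (H z) \<partial>M) \<le> (\<integral>p. norm (G1 p) \<partial>M1) * ((\<integral>p. norm (G2 p) \<partial>M2) * (\<integral>p. norm (G3 p) \<partial>M3))" .
  have "cubT (lift M1 X1 G1) (lift M2 X2 G2) (lift M3 X3 G3) x $ j = lift M Y H x $ j" for x j
  proof -
    define F1 where "F1 i p = cis (- (x \<bullet> X1 p)) * G1 p $ i" for i p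
    define F2 where "F2 i p = cnj (cis (- (x \<bullet> X2 p)) * G2 p $ i)" for i p
    define F3 where "F3 p = cis (- (x \<bullet> X3 p)) * G3 p $ j" for p
    have F1: "integrable M1 (F1 i)" for i
      unfolding F1_def by (rule integrable_bounded_mult[where B = 1, OF integrable_vec_nth[OF G(1)]]) auto
    have F2': "integrable M2 (\<lambda>p. cis (- (x \<bullet> X2 p)) * G2 p $ i)" for i
      by (rule integrable_bounded_mult[where B = 1, OF integrable_vec_nth[OF G(2)]]) auto
    have F2: "integrable M2 (F2 i)" for i
      unfolding F2_def by (rule integrable_cnj[OF F2'])
    have F3: "integrable M3 F3"
      unfolding F3_def by (rule integrable_bounded_mult[where B = 1, OF integrable_vec_nth[OF G(3)]]) auto
    have "cubT (lift M1 X1 G1) (lift M2 X2 G2) (lift M3 X3 G3) x $ j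
        = (\<Sum>i\<in>UNIV. (\<integral>p. F1 i p \<partial>M1) * ((\<integral>p. F2 i p \<partial>M2) * (\<integral>p. F3 p \<partial>M3)))"
      by (simp add: cubT_def hdot_def lift_nth[OF X(1) G(1)] lift_nth[OF X(2) G(2)] lift_nth[OF X(3) G(3)] F1_def F2_def F3_def
          sum_distrib_right mult.assoc del: complex_cnj_mult)
    also have "\<dots> = (\<Sum>i\<in>UNIV. \<integral>z. F1 i (fst z) * (F2 i (fst (snd z)) * F3 (snd (snd z))) \<partial>M)"
      unfolding M_def
      by (simp add: integral_pair_mult[OF s(1) s23 F1 i23[OF F2 F3]] integral_pair_mult[OF s(2,3) F2 F3])
    also have "\<dots> = (\<integral>z. (\<Sum>i\<in>UNIV. F1 i (fst z) * (F2 i (fst (snd z)) * F3 (snd (snd z)))) \<partial>M)"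
      unfolding M_def by (rule Bochner_Integration.integral_sum[symmetric]) (rule i123[OF F1 F2 F3])
    also have "(\<lambda>z. \<Sum>i\<in>UNIV. F1 i (fst z) * (F2 i (fst (snd z)) * F3 (snd (snd z)))) = (\<lambda>z. cis (- (x \<bullet> Y z)) * H z $ j)"
    proof
      fix z
      have c: "cis (- (x \<bullet> Y z)) = cis (- (x \<bullet> X1 (fst z))) * cnj (cis (- (x \<bullet> X2 (fst (snd z))))) * cis (- (x \<bullet> X3 (snd (snd z))))"
        by (simp add: Y_def cis_cnj cis_mult inner_add_right inner_diff_right algebra_simps)
      show "(\<Sum>i\<in>UNIV. F1 i (fst z) * (F2 i (fst (snd z)) * F3 (snd (snd z)))) = cis (- (x \<bullet> Y z)) * H z $ j"
        unfolding c F1_def F2_def F3_def H_def hdot_def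
        by (simp add: sum_distrib_left sum_distrib_right mult_ac)
    qed
    also have "(\<integral>z. cis (- (x \<bullet> Y z)) * H z $ j \<partial>M) = lift M Y H x $ j"
      by (rule lift_nth[symmetric, OF Ym H])
    finally show ?thesis .
  qed
  then show "cubT (lift M1 X1 G1) (lift M2 X2 G2) (lift M3 X3 G3) = lift M Y H"
    by (auto simp: fun_eq_iff vec_eq_iff)
qed

section \<open>The normed space FM\<close>

lemma FM_rep: "u \<in> FM \<Longrightarrow> \<exists>\<nu> g. fm_rep \<nu> g \<and> fm_of \<nu> g = u"
  by (auto simp: FM_def fm_reps_def)

lemma FM_norm_eq_0:
  assumes "u \<in> FM" "FM_norm u = 0" shows "u = (\<lambda>_. 0)"
  using norm_le_FM_norm[OF assms(1)] assms(2) by auto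

lemma lift_zero: "lift M X (\<lambda>_. 0) = (\<lambda>_. 0)"
  by (simp add: lift_def)

text \<open>The size is moved from the measure into a uniform bound on the density by normalising
  the total variation measure. A probability measure is needed for infinite products, and the
  uniform bound becomes, up to the factor of the projection, the weight of a leaf.\<close>

lemma FM_prob_rep:
  fixes u :: "('n::finite) vfield"
  assumes u: "u \<in> FM"
  shows "\<exists>\<nu> g. fm_rep \<nu> g \<and> prob_space \<nu> \<and> fm_of \<nu> g = u \<and> (\<forall>\<xi>. norm (g \<xi>) \<le> FM_norm u)"
proof -
  obtain \<nu> g where r: "fm_rep \<nu> g" "fm_of \<nu> g = u" using FM_rep[OF u] by blast
  note D = fm_repD[OF r(1)]
  define N where "N = FM_norm u"
  have N: "N = (\<integral>\<xi>. norm (g \<xi>) \<partial>\<nu>)" unfolding N_def by (rule FM_norm_eq[OF r])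
  show ?thesis
  proof (cases "N = 0")
    case True
    \<comment> \<open>The zero field has no total variation to normalise; a unit mass with zero
      density represents it.\<close>
    have "fm_rep (return borel (0::real^'n)) (\<lambda>_. 0 :: complex^'n)"
      by (simp add: fm_rep_def prob_space.finite_measure prob_space_return)
    moreover have "u = (\<lambda>_. 0)" using FM_norm_eq_0[OF u] True by (simp add: N_def)
    ultimately show ?thesis
      using True by (intro exI[of _ "return borel 0"] exI[of _ "\<lambda>_. 0"])
        (auto simp: fm_of_eq_lift lift_zero prob_space_return N_def)
  next
    case False
    then have N0: "N > 0" unfolding N by (simp add: order.strict_iff_order)
    have gm[measurable]: "g \<in> borel_measurable \<nu>" using D(2) by simp
    have [measurable]: "(\<lambda>\<xi>. \<xi>) \<in> borel_measurable \<nu>" by (rule D(1))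
    define \<nu>' where "\<nu>' = density \<nu> (\<lambda>\<xi>. ennreal (norm (g \<xi>) / N))"
    define g' where "g' \<xi> = N *\<^sub>R sgn (g \<xi>)" for \<xi>
    have ng: "norm (g' \<xi>) \<le> N" for \<xi> using N0 by (simp add: g'_def norm_sgn)
    have i: "integrable \<nu> (\<lambda>\<xi>. norm (g \<xi>) / N)" using D(2) by simp
    have "emeasure \<nu>' (space \<nu>') = (\<integral>\<^sup>+\<xi>. ennreal (norm (g \<xi>) / N) \<partial>\<nu>)"
      unfolding \<nu>'_def by (simp add: emeasure_density cong: nn_integral_cong_simp)
    also have "\<dots> = 1" using N0 by (subst nn_integral_eq_integral[OF i]) (auto simp flip: N)
    finally have prob: "prob_space \<nu>'" by (rule prob_spaceI)
    then interpret prob_space \<nu>' .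
    have g'm[measurable]: "g' \<in> borel_measurable \<nu>" unfolding g'_def sgn_div_norm by measurable
    then have g'm': "g' \<in> borel_measurable \<nu>'" unfolding \<nu>'_def by simp
    have "integrable \<nu>' g'" by (rule integrable_const_bound[where B = N, OF _ g'm']) (use ng in auto)
    then have rep: "fm_rep \<nu>' g'" using D(3) by (simp add: fm_rep_def \<nu>'_def[THEN arg_cong[where f = sets]] finite_measure_axioms)
    have "lift \<nu>' (\<lambda>\<xi>. \<xi>) g' x = lift \<nu> (\<lambda>\<xi>. \<xi>) g x" for x
    proof -
      have "lift \<nu>' (\<lambda>\<xi>. \<xi>) g' x = (\<integral>\<xi>. (norm (g \<xi>) / N) *\<^sub>R (cis (- (x \<bullet> \<xi>)) *s g' \<xi>) \<partial>\<nu>)"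
        unfolding lift_def \<nu>'_def using N0 by (intro integral_density) (auto intro!: borel_measurable_vector_scalar_mult)
      also have "\<dots> = lift \<nu> (\<lambda>\<xi>. \<xi>) g x"
        unfolding lift_def
      proof (intro Bochner_Integration.integral_cong refl)
        fix \<xi>
        have "(norm (g \<xi>) / N) *\<^sub>R g' \<xi> = g \<xi>"
          using N0 by (cases "g \<xi> = 0") (auto simp: g'_def sgn_div_norm)
        then show "(norm (g \<xi>) / N) *\<^sub>R (cis (- (x \<bullet> \<xi>)) *s g' \<xi>) = cis (- (x \<bullet> \<xi>)) *s g \<xi>"
          by (simp flip: vsm.scaleR_right)
      qed
      finally show ?thesis .
    qed
    then have "fm_of \<nu>' g' = u" using r(2) by (auto simp: fm_of_eq_lift)
    with rep prob ng show ?thesis unfolding N_def by blast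
  qed
qed

text \<open>The almost everywhere conditions in \<open>FM0_sigma\<close> become pointwise by
  projecting the density: the projected density represents the same field, at the price of the
  factor 2 in the bound.\<close>

lemma FM0_sigma_prob_rep:
  fixes u :: "('n::finite) vfield"
  assumes u: "u \<in> FM0_sigma"
  shows "\<exists>\<nu> g. fm_rep \<nu> g \<and> prob_space \<nu> \<and> fm_of \<nu> g = u \<and> (\<forall>\<xi>. norm (g \<xi>) \<le> 2 * FM_norm u) \<and>
    (\<forall>\<xi>. proj \<xi> (g \<xi>) = g \<xi>)"
proof -
  obtain \<nu>0 g0 where r0: "fm_rep \<nu>0 g0" "fm_of \<nu>0 g0 = u"
    and z: "(\<integral>\<xi>. indicator {0} \<xi> *\<^sub>R g0 \<xi> \<partial>\<nu>0) = 0"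
    and div: "AE \<xi> in \<nu>0. (\<Sum>i\<in>UNIV. complex_of_real (\<xi> $ i) * (g0 \<xi> $ i)) = 0"
    using u by (auto simp: FM0_sigma_def fm_reps_def)
  note D = fm_repD[OF r0(1)]
  interpret finite_measure \<nu>0 by (rule D(4))
  have sp: "space \<nu>0 = UNIV" using sets_eq_imp_space_eq[OF D(3)] by simp
  have z0: "{0} \<in> sets \<nu>0" by (simp add: D(3))
  \<comment> \<open>The origin carries the vector \<open>measure \<nu>0 {0} *\<^sub>R g0 0\<close>,
    so its vanishing means that either the origin is a null set or \<open>g0\<close> is 0
    there.\<close>
  have "(\<integral>\<xi>. indicator {0} \<xi> *\<^sub>R g0 \<xi> \<partial>\<nu>0) = (\<integral>\<xi>. indicat_real {0} \<xi> *\<^sub>R g0 0 \<partial>\<nu>0)"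
    by (intro Bochner_Integration.integral_cong refl) (auto simp: indicator_def)
  also have "\<dots> = measure \<nu>0 {0} *\<^sub>R g0 0"
    using z0 by (simp add: sp emeasure_eq_measure)
  finally have "measure \<nu>0 {0} = 0 \<or> g0 0 = 0" using z by simp
  then have "AE \<xi> in \<nu>0. \<xi> = 0 \<longrightarrow> g0 \<xi> = 0"
  proof
    assume "measure \<nu>0 {0} = 0"
    then have "{0} \<in> null_sets \<nu>0" using z0 by (auto simp: null_sets_def emeasure_eq_measure)
    then show ?thesis by (rule AE_I') auto
  qed auto
  with div have ae: "AE \<xi> in \<nu>0. proj \<xi> (g0 \<xi>) = g0 \<xi>"
    by eventually_elim (metis cdot_def proj_0 proj_id)
  obtain \<nu> g where r: "fm_rep \<nu> g" "prob_space \<nu>" "fm_of \<nu> g = u" "\<And>\<xi>. norm (g \<xi>) \<le> FM_norm u"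
    using FM_prob_rep[of u] u FM0_sigma_subset_FM by blast
  have "fm_rep \<nu> (\<lambda>\<xi>. proj \<xi> (g \<xi>)) \<and> fm_of \<nu> (\<lambda>\<xi>. proj \<xi> (g \<xi>)) = lift \<nu>0 (\<lambda>\<xi>. \<xi>) (\<lambda>\<xi>. proj \<xi> (g0 \<xi>))"
    using r0 r by (intro proj_rep[OF D(1,2)]) (simp_all add: fm_of_eq_lift)
  moreover have "lift \<nu>0 (\<lambda>\<xi>. \<xi>) (\<lambda>\<xi>. proj \<xi> (g0 \<xi>)) = u"
  proof -
    have "lift \<nu>0 (\<lambda>\<xi>. \<xi>) (\<lambda>\<xi>. proj \<xi> (g0 \<xi>)) = lift \<nu>0 (\<lambda>\<xi>. \<xi>) g0"
      unfolding lift_def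
      by (intro ext integral_cong_AE borel_measurable_integrable integrable_lift[OF D(1)] integrable_proj[OF D(1,2)] D(2))
        (use ae in \<open>eventually_elim, simp\<close>)
    then show ?thesis using r0 by (simp add: fm_of_eq_lift)
  qed
  moreover have "norm (proj \<xi> (g \<xi>)) \<le> 2 * FM_norm u" for \<xi>
    using norm_proj_le[of \<xi> "g \<xi>"] r(4)[of \<xi>] by simp
  ultimately show ?thesis using r(2) proj_idem by blast
qed

lemma (in prob_space) distr_pair_snd:
  assumes "sigma_finite_measure N" shows "distr (M \<Otimes>\<^sub>M N) N snd = N"
proof (rule measure_eqI)
  interpret N: sigma_finite_measure N by fact
  fix A assume "A \<in> sets (distr (M \<Otimes>\<^sub>M N) N snd)"
  then have A[measurable]: "A \<in> sets N" by simp
  have "emeasure (distr (M \<Otimes>\<^sub>M N) N snd) A = emeasure (M \<Otimes>\<^sub>M N) (space M \<times> A)"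
    using sets.sets_into_space[OF A] by (subst emeasure_distr) (auto simp: space_pair_measure intro!: arg_cong[where f = "emeasure _"])
  also have "\<dots> = emeasure N A" using A by (subst N.emeasure_pair_measure_Times) (auto simp: emeasure_space_1)
  finally show "emeasure (distr (M \<Otimes>\<^sub>M N) N snd) A = emeasure N A" .
qed simp

text \<open>Two functions of \<open>FM\<close> are lifted simultaneously to the disjoint union of their frequency spaces.\<close>

lemma common_lift:
  fixes u v :: "('n::finite) vfield"
  assumes u: "u \<in> FM" and v: "v \<in> FM"
  obtains M :: "(bool \<times> (real^'n) \<times> (real^'n)) measure" and X G H where
    "X \<in> borel_measurable M" "integrable M G" "integrable M H" "u = lift M X G" "v = lift M X H"
    "(\<integral>p. norm (G p) \<partial>M) = FM_norm u" "(\<integral>p. norm (H p) \<partial>M) = FM_norm v"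
    "\<And>s. u \<in> FMs s \<Longrightarrow> integrable M (\<lambda>p. norm (X p) powr s * norm (G p))"
    "\<And>s. v \<in> FMs s \<Longrightarrow> integrable M (\<lambda>p. norm (X p) powr s * norm (H p))"
proof -
  obtain \<nu>1 g1 where r1: "fm_rep \<nu>1 g1" "prob_space \<nu>1" "fm_of \<nu>1 g1 = u" using FM_prob_rep[OF u] by blast
  obtain \<nu>2 g2 where r2: "fm_rep \<nu>2 g2" "prob_space \<nu>2" "fm_of \<nu>2 g2 = v" using FM_prob_rep[OF v] by blast
  note D1 = fm_repD[OF r1(1)] and D2 = fm_repD[OF r2(1)]
  interpret P1: prob_space \<nu>1 by fact
  interpret P2: prob_space \<nu>2 by fact
  interpret P: pair_prob_space \<nu>1 \<nu>2 ..
  interpret C: sigma_finite_measure "count_space (UNIV::bool set)" by (rule sigma_finite_measure_count_space)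
  interpret CP: pair_sigma_finite "count_space (UNIV::bool set)" "\<nu>1 \<Otimes>\<^sub>M \<nu>2" ..
  \<comment> \<open>The Boolean says which of the two coordinates is the frequency; the other
    coordinate integrates to 1 because both measures are probabilities.\<close>
  define M where "M = count_space (UNIV::bool set) \<Otimes>\<^sub>M (\<nu>1 \<Otimes>\<^sub>M \<nu>2)"
  define X where "X z = (if fst z then fst (snd z) else snd (snd z))" for z :: "bool \<times> (real^'n) \<times> (real^'n)"
  note [measurable] = D1(1) D2(1)
  have X: "X \<in> borel_measurable M" unfolding X_def M_def by measurable
  have int1: "integrable M (\<lambda>z. if fst z then f (fst (snd z)) else 0) \<and>
      (\<integral>z. (if fst z then f (fst (snd z)) else 0) \<partial>M) = (\<integral>\<xi>. f \<xi> \<partial>\<nu>1)" if f: "integrable \<nu>1 f"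
    for f :: "_ \<Rightarrow> 'b::{banach, second_countable_topology}"
  proof -
    note [measurable] = borel_measurable_integrable[OF f]
    have e: "integrable (\<nu>1 \<Otimes>\<^sub>M \<nu>2) (\<lambda>z. f (fst z))" "(\<integral>z. f (fst z) \<partial>(\<nu>1 \<Otimes>\<^sub>M \<nu>2)) = (\<integral>\<xi>. f \<xi> \<partial>\<nu>1)"
      using integrable_distr_eq[of fst "\<nu>1 \<Otimes>\<^sub>M \<nu>2" \<nu>1 f] integral_distr[of fst "\<nu>1 \<Otimes>\<^sub>M \<nu>2" \<nu>1 f] f
      by (simp_all add: P2.distr_pair_fst)
    have "integrable (\<nu>1 \<Otimes>\<^sub>M \<nu>2) (\<lambda>y. if b then f (fst y) else 0)" for b by (cases b) (simp_all add: e)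
    then have ae: "AE b in count_space UNIV. integrable (\<nu>1 \<Otimes>\<^sub>M \<nu>2) (\<lambda>y. if fst (b, y) then f (fst (snd (b, y))) else 0)" by (simp add: AE_count_space cong del: if_weak_cong)
    have i: "integrable M (\<lambda>z. if fst z then f (fst (snd z)) else 0)"
      unfolding M_def by (rule CP.Fubini_integrable[OF _ _ ae]) (auto simp: integrable_count_space)
    have "(\<integral>z. (if fst z then f (fst (snd z)) else 0) \<partial>M) = (\<integral>b. \<integral>y. (if b then f (fst y) else 0) \<partial>(\<nu>1 \<Otimes>\<^sub>M \<nu>2) \<partial>count_space UNIV)"
      using CP.integral_fst'[OF i[unfolded M_def]] by (simp add: M_def cong del: if_weak_cong)
    also have "\<dots> = (\<integral>\<xi>. f \<xi> \<partial>\<nu>1)"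
      by (simp add: lebesgue_integral_count_space_finite UNIV_bool e)
    finally show ?thesis using i by simp
  qed
  have int2: "integrable M (\<lambda>z. if fst z then 0 else f (snd (snd z))) \<and>
      (\<integral>z. (if fst z then 0 else f (snd (snd z))) \<partial>M) = (\<integral>\<xi>. f \<xi> \<partial>\<nu>2)" if f: "integrable \<nu>2 f"
    for f :: "_ \<Rightarrow> 'b::{banach, second_countable_topology}"
  proof -
    note [measurable] = borel_measurable_integrable[OF f]
    have e: "integrable (\<nu>1 \<Otimes>\<^sub>M \<nu>2) (\<lambda>z. f (snd z))" "(\<integral>z. f (snd z) \<partial>(\<nu>1 \<Otimes>\<^sub>M \<nu>2)) = (\<integral>\<xi>. f \<xi> \<partial>\<nu>2)"
      using integrable_distr_eq[of snd "\<nu>1 \<Otimes>\<^sub>M \<nu>2" \<nu>2 f] integral_distr[of snd "\<nu>1 \<Otimes>\<^sub>M \<nu>2" \<nu>2 f] f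
      by (simp_all add: P1.distr_pair_snd P2.sigma_finite_measure_axioms)
    have "integrable (\<nu>1 \<Otimes>\<^sub>M \<nu>2) (\<lambda>y. if b then 0 else f (snd y))" for b by (cases b) (simp_all add: e)
    then have ae: "AE b in count_space UNIV. integrable (\<nu>1 \<Otimes>\<^sub>M \<nu>2) (\<lambda>y. if fst (b, y) then 0 else f (snd (snd (b, y))))" by (simp add: AE_count_space cong del: if_weak_cong)
    have i: "integrable M (\<lambda>z. if fst z then 0 else f (snd (snd z)))"
      unfolding M_def by (rule CP.Fubini_integrable[OF _ _ ae]) (auto simp: integrable_count_space)
    have "(\<integral>z. (if fst z then 0 else f (snd (snd z))) \<partial>M) = (\<integral>b. \<integral>y. (if b then 0 else f (snd y)) \<partial>(\<nu>1 \<Otimes>\<^sub>M \<nu>2) \<partial>count_space UNIV)"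
      using CP.integral_fst'[OF i[unfolded M_def]] by (simp add: M_def cong del: if_weak_cong)
    also have "\<dots> = (\<integral>\<xi>. f \<xi> \<partial>\<nu>2)"
      by (simp add: lebesgue_integral_count_space_finite UNIV_bool e)
    finally show ?thesis using i by simp
  qed
  define G where "G z = (if fst z then g1 (fst (snd z)) else 0)" for z :: "bool \<times> (real^'n) \<times> (real^'n)"
  define H where "H z = (if fst z then 0 else g2 (snd (snd z)))" for z :: "bool \<times> (real^'n) \<times> (real^'n)"
  have GH: "integrable M G" "integrable M H"
    using int1[OF D1(2)] int2[OF D2(2)] by (simp_all add: G_def[abs_def] H_def[abs_def])
  have "lift M X G x = lift \<nu>1 (\<lambda>\<xi>. \<xi>) g1 x" for x
    unfolding lift_def int1[OF integrable_lift[OF D1(1,2)], THEN conjunct2, symmetric]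
    by (intro Bochner_Integration.integral_cong) (auto simp: G_def X_def)
  then have uG: "u = lift M X G" using r1(3) by (auto simp: fm_of_eq_lift)
  have "lift M X H x = lift \<nu>2 (\<lambda>\<xi>. \<xi>) g2 x" for x
    unfolding lift_def int2[OF integrable_lift[OF D2(1,2)], THEN conjunct2, symmetric]
    by (intro Bochner_Integration.integral_cong) (auto simp: H_def X_def)
  then have vH: "v = lift M X H" using r2(3) by (auto simp: fm_of_eq_lift)
  have nG: "(\<integral>p. norm (G p) \<partial>M) = FM_norm u"
    unfolding FM_norm_eq[OF r1(1,3)] int1[OF integrable_norm[OF D1(2)], THEN conjunct2, symmetric]
    by (intro Bochner_Integration.integral_cong) (auto simp: G_def)
  have nH: "(\<integral>p. norm (H p) \<partial>M) = FM_norm v"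
    unfolding FM_norm_eq[OF r2(1,3)] int2[OF integrable_norm[OF D2(2)], THEN conjunct2, symmetric]
    by (intro Bochner_Integration.integral_cong) (auto simp: H_def)
  have wG: "integrable M (\<lambda>p. norm (X p) powr s * norm (G p))" if "u \<in> FMs s" for s
    using int1[OF FMs_rep[OF that r1(1,3)], THEN conjunct1]
    by (rule Bochner_Integration.integrable_cong[THEN iffD1, rotated 2]) (auto simp: G_def X_def)
  have wH: "integrable M (\<lambda>p. norm (X p) powr s * norm (H p))" if "v \<in> FMs s" for s
    using int2[OF FMs_rep[OF that r2(1,3)], THEN conjunct1]
    by (rule Bochner_Integration.integrable_cong[THEN iffD1, rotated 2]) (auto simp: H_def X_def)
  show thesis by (rule that[OF X GH uG vH nG nH], erule wG, erule wH)
qed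

lemma
  fixes u v :: "('n::finite) vfield"
  assumes u: "u \<in> FM" and v: "v \<in> FM"
  shows FM_add: "(\<lambda>x. u x + v x) \<in> FM" and FM_norm_add_le: "FM_norm (\<lambda>x. u x + v x) \<le> FM_norm u + FM_norm v"
    and FM_diff: "(\<lambda>x. u x - v x) \<in> FM" and FM_norm_diff_le: "FM_norm (\<lambda>x. u x - v x) \<le> FM_norm u + FM_norm v"
    and helmholtz_diff: "helmholtz (\<lambda>x. u x - v x) x = helmholtz u x - helmholtz v x"
proof -
  obtain M :: "(bool \<times> (real^'n) \<times> (real^'n)) measure" and X G H where
    *: "X \<in> borel_measurable M" "integrable M G" "integrable M H" "u = lift M X G" "v = lift M X H"
    "(\<integral>p. norm (G p) \<partial>M) = FM_norm u" "(\<integral>p. norm (H p) \<partial>M) = FM_norm v"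
    "\<And>s. u \<in> FMs s \<Longrightarrow> integrable M (\<lambda>p. norm (X p) powr s * norm (G p))"
    "\<And>s. v \<in> FMs s \<Longrightarrow> integrable M (\<lambda>p. norm (X p) powr s * norm (H p))"
    by (rule common_lift[OF u v], rule that)
  have a: "(\<lambda>x. u x + v x) = lift M X (\<lambda>p. G p + H p)" and d: "(\<lambda>x. u x - v x) = lift M X (\<lambda>p. G p - H p)"
    unfolding *(4,5) by (intro ext lift_add[symmetric] lift_diff[symmetric] *(1-3))+
  have i: "integrable M (\<lambda>p. G p + H p)" "integrable M (\<lambda>p. G p - H p)" using * by simp_all
  show "(\<lambda>x. u x + v x) \<in> FM" "(\<lambda>x. u x - v x) \<in> FM" unfolding a d using * i by (auto intro: lift_in_FM)
  have s: "(\<integral>p. norm (G p) + norm (H p) \<partial>M) = FM_norm u + FM_norm v" using * by simp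
  have "FM_norm (\<lambda>x. u x + v x) \<le> (\<integral>p. norm (G p + H p) \<partial>M)" unfolding a by (rule FM_norm_lift_le[OF *(1) i(1)])
  also have "\<dots> \<le> (\<integral>p. norm (G p) + norm (H p) \<partial>M)"
    by (rule integral_mono) (use * in \<open>auto intro: norm_triangle_ineq\<close>)
  finally show "FM_norm (\<lambda>x. u x + v x) \<le> FM_norm u + FM_norm v" using s by simp
  have "FM_norm (\<lambda>x. u x - v x) \<le> (\<integral>p. norm (G p - H p) \<partial>M)" unfolding d by (rule FM_norm_lift_le[OF *(1) i(2)])
  also have "\<dots> \<le> (\<integral>p. norm (G p) + norm (H p) \<partial>M)"
    by (rule integral_mono) (use * in \<open>auto intro: norm_triangle_ineq4\<close>)
  finally show "FM_norm (\<lambda>x. u x - v x) \<le> FM_norm u + FM_norm v" using s by simp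
  have "helmholtz (\<lambda>x. u x - v x) x = lift M X (\<lambda>p. proj (X p) (G p) - proj (X p) (H p)) x"
    unfolding d by (simp add: helmholtz_lift[OF *(1) i(2)] proj_diff)
  also have "\<dots> = helmholtz u x - helmholtz v x"
    using * by (simp add: lift_diff integrable_proj helmholtz_lift)
  finally show "helmholtz (\<lambda>x. u x - v x) x = helmholtz u x - helmholtz v x" .
qed

lemma
  assumes u: "u \<in> FM"
  shows FM_scaleR: "(\<lambda>x. c *\<^sub>R u x) \<in> FM" and FM_norm_scaleR_le: "FM_norm (\<lambda>x. c *\<^sub>R u x) \<le> \<bar>c\<bar> * FM_norm u"
    and helmholtz_FM: "helmholtz u \<in> FM" and FM_norm_helmholtz_le: "FM_norm (helmholtz u) \<le> 2 * FM_norm u"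
proof -
  obtain \<nu> g where r: "fm_rep \<nu> g" "fm_of \<nu> g = u" using FM_rep[OF u] by blast
  note D = fm_repD[OF r(1)]
  have c: "(\<lambda>x. c *\<^sub>R u x) = lift \<nu> (\<lambda>\<xi>. \<xi>) (\<lambda>\<xi>. c *\<^sub>R g \<xi>)" and ul: "u = lift \<nu> (\<lambda>\<xi>. \<xi>) g"
    using r(2) by (auto simp: lift_scaleR fm_of_eq_lift)
  have i: "integrable \<nu> (\<lambda>\<xi>. c *\<^sub>R g \<xi>)" using D(2) by simp
  show "(\<lambda>x. c *\<^sub>R u x) \<in> FM" unfolding c by (rule lift_in_FM[OF D(1) i])
  show "FM_norm (\<lambda>x. c *\<^sub>R u x) \<le> \<bar>c\<bar> * FM_norm u"
    unfolding c using FM_norm_lift_le[OF D(1) i] by (simp add: FM_norm_eq[OF r])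
  have h: "helmholtz u = lift \<nu> (\<lambda>\<xi>. \<xi>) (\<lambda>\<xi>. proj \<xi> (g \<xi>))" unfolding ul by (rule helmholtz_lift[OF D(1,2)])
  note ip = integrable_proj[OF D(1,2)]
  show "helmholtz u \<in> FM" unfolding h by (rule lift_in_FM[OF D(1) ip])
  have "FM_norm (helmholtz u) \<le> (\<integral>\<xi>. norm (proj \<xi> (g \<xi>)) \<partial>\<nu>)" unfolding h by (rule FM_norm_lift_le[OF D(1) ip])
  also have "\<dots> \<le> (\<integral>\<xi>. 2 * norm (g \<xi>) \<partial>\<nu>)"
    by (rule integral_mono) (use ip D(2) norm_proj_le in auto)
  finally show "FM_norm (helmholtz u) \<le> 2 * FM_norm u" by (simp add: FM_norm_eq[OF r])
qed

lemma powr_4: "0 \<le> x \<Longrightarrow> x powr 4 = x ^ 4" for x :: real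
  using powr_realpow'[of x 4] by simp

lemma powr_le_one_plus:
  assumes "0 \<le> s" "s \<le> r" "0 \<le> x" shows "x powr s \<le> 1 + x powr (r::real)"
proof (cases "x \<le> 1")
  case True
  then have "x powr s \<le> 1 powr s" using assms by (intro powr_mono2) auto
  then show ?thesis using powr_ge_zero[of x r] by (simp only: powr_one_eq_one)
next
  case False
  then have "x powr s \<le> x powr r" using assms by (intro powr_mono) auto
  then show ?thesis by simp
qed

lemma integrable_weight_mono:
  fixes X :: "'a \<Rightarrow> real^'n" and G :: "'a \<Rightarrow> complex^'n"
  assumes X[measurable]: "X \<in> borel_measurable M" and G: "integrable M G"
    and r: "integrable M (\<lambda>p. norm (X p) powr r * norm (G p))" and s: "0 \<le> s" "s \<le> r"
  shows "integrable M (\<lambda>p. norm (X p) powr s * norm (G p))"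
proof (rule Bochner_Integration.integrable_bound)
  note [measurable] = borel_measurable_integrable[OF G]
  show "integrable M (\<lambda>p. norm (G p) + norm (X p) powr r * norm (G p))"
    using integrable_norm[OF G] r by (rule Bochner_Integration.integrable_add)
  show "(\<lambda>p. norm (X p) powr s * norm (G p)) \<in> borel_measurable M" by measurable
  have "norm (X p) powr s * norm (G p) \<le> norm (G p) + norm (X p) powr r * norm (G p)" for p
    using mult_right_mono[OF powr_le_one_plus[OF s norm_ge_zero[of "X p"]] norm_ge_zero[of "G p"]] by (simp add: distrib_right)
  then show "AE p in M. norm (norm (X p) powr s * norm (G p)) \<le> norm (norm (G p) + norm (X p) powr r * norm (G p))"
    by (auto intro: order_trans[OF _ abs_ge_self])
qed

lemma FMs_mono: "0 \<le> s \<Longrightarrow> s \<le> r \<Longrightarrow> (FMs r :: ('n::finite) vfield set) \<subseteq> FMs s"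
proof
  fix u :: "('n::finite) vfield" assume s: "0 \<le> s" "s \<le> r" and u: "u \<in> FMs r"
  then obtain \<nu> g where g: "fm_rep \<nu> g" "fm_of \<nu> g = u" by (auto simp: FMs_def fm_reps_def)
  note D = fm_repD[OF g(1)]
  show "u \<in> FMs s"
    using lift_in_FMs[OF D(1,2) integrable_weight_mono[OF D(1,2) FMs_rep[OF u g] s]] g(2)
    by (simp add: fm_of_eq_lift)
qed

lemma
  fixes u v :: "('n::finite) vfield"
  assumes u: "u \<in> FMs s" and v: "v \<in> FMs s"
  shows FMs_diff: "(\<lambda>x. u x - v x) \<in> FMs s"
    and A_d_diff: "s = 4 \<Longrightarrow> A_d \<alpha> \<Gamma>0 \<Gamma>2 (\<lambda>x. u x - v x) x = A_d \<alpha> \<Gamma>0 \<Gamma>2 u x - A_d \<alpha> \<Gamma>0 \<Gamma>2 v x"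
    and pdiff_diff: "s = 1 \<Longrightarrow> pdiff i (\<lambda>x. u x - v x) x = pdiff i u x - pdiff i v x"
proof -
  have uv: "u \<in> FM" "v \<in> FM" using u v FMs_subset_FM by blast+
  obtain M :: "(bool \<times> (real^'n) \<times> (real^'n)) measure" and X G H where
    X[measurable]: "X \<in> borel_measurable M" and G: "integrable M G" and H: "integrable M H"
    and ul: "u = lift M X G" and vl: "v = lift M X H"
    "(\<integral>p. norm (G p) \<partial>M) = FM_norm u" "(\<integral>p. norm (H p) \<partial>M) = FM_norm v"
    and w0:
    "\<And>s. u \<in> FMs s \<Longrightarrow> integrable M (\<lambda>p. norm (X p) powr s * norm (G p))"
    "\<And>s. v \<in> FMs s \<Longrightarrow> integrable M (\<lambda>p. norm (X p) powr s * norm (H p))"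
    by (rule common_lift[OF uv], rule that)
  note w = w0(1)[OF u] w0(2)[OF v]
  note [measurable] = borel_measurable_integrable[OF G] borel_measurable_integrable[OF H]
  have d: "(\<lambda>x. u x - v x) = lift M X (\<lambda>p. G p - H p)"
    unfolding ul vl by (intro ext lift_diff[symmetric] X G H)
  have i: "integrable M (\<lambda>p. G p - H p)" using G H by simp
  have wd: "integrable M (\<lambda>p. norm (X p) powr s * norm (G p - H p))"
  proof (rule Bochner_Integration.integrable_bound)
    show "integrable M (\<lambda>p. norm (X p) powr s * norm (G p) + norm (X p) powr s * norm (H p))" using w by simp
    have "norm (X p) powr s * norm (G p - H p) \<le> norm (X p) powr s * norm (G p) + norm (X p) powr s * norm (H p)" for p
      unfolding distrib_left[symmetric] by (intro mult_left_mono norm_triangle_ineq4) simp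
    then show "AE p in M. norm (norm (X p) powr s * norm (G p - H p)) \<le> norm (norm (X p) powr s * norm (G p) + norm (X p) powr s * norm (H p))"
      by (auto intro: order_trans[OF _ abs_ge_self])
  qed measurable
  show "(\<lambda>x. u x - v x) \<in> FMs s" unfolding d by (rule lift_in_FMs[OF X i wd])
  show "A_d \<alpha> \<Gamma>0 \<Gamma>2 (\<lambda>x. u x - v x) x = A_d \<alpha> \<Gamma>0 \<Gamma>2 u x - A_d \<alpha> \<Gamma>0 \<Gamma>2 v x" if "s = 4"
    using w wd that unfolding d unfolding ul vl
    by (simp add: powr_4 A_d_lift X i G H scaleR_diff_right lift_diff integrable_symb)
  show "pdiff i (\<lambda>x. u x - v x) x = pdiff i u x - pdiff i v x" if "s = 1"
  proof -
    have 1: "integrable M (\<lambda>p. norm (X p) * norm (G p))" "integrable M (\<lambda>p. norm (X p) * norm (H p))"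
      "integrable M (\<lambda>p. norm (X p) * norm (G p - H p))"
      using w wd that by simp_all
    show ?thesis
      unfolding d unfolding ul vl pdiff_lift[OF X i 1(3)] pdiff_lift[OF X G 1(1)] pdiff_lift[OF X H 1(2)] vsm.diff_right
      by (rule lift_diff[OF X integrable_pdiff[OF X G 1(1)] integrable_pdiff[OF X H 1(2)]])
  qed
qed

lemma
  assumes u: "u \<in> FM" and v: "fm_rep \<nu> g" "fm_of \<nu> g = v" and int: "integrable \<nu> (\<lambda>\<xi>. norm \<xi> * norm (g \<xi>))"
  shows advB_FM: "advB u v \<in> FM" and FM_norm_advB_le: "FM_norm (advB u v) \<le> FM_norm u * (\<integral>\<xi>. norm \<xi> * norm (g \<xi>) \<partial>\<nu>)"
proof -
  obtain \<nu>1 g1 where r: "fm_rep \<nu>1 g1" "fm_of \<nu>1 g1 = u" using FM_rep[OF u] by blast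
  note D = fm_repD[OF r(1)] and Dv = fm_repD[OF v(1)]
  have s: "sigma_finite_measure \<nu>1" "sigma_finite_measure \<nu>"
    using D(4) Dv(4) finite_measure.axioms(1) by blast+
  note * = s D(1) Dv(1) D(2) Dv(2) int
  have e: "advB u v = lift (\<nu>1 \<Otimes>\<^sub>M \<nu>) (\<lambda>z. fst z + snd z) (\<lambda>z. (- \<i> * cdot (snd z) (g1 (fst z))) *s g (snd z))"
    using advB_lift[OF *] r(2) v(2) by (simp add: fm_of_eq_lift)
  have X: "(\<lambda>z. fst z + snd z) \<in> borel_measurable (\<nu>1 \<Otimes>\<^sub>M \<nu>)"
    using D(1) Dv(1) by (intro borel_measurable_add) (auto intro: measurable_compose[OF measurable_fst] measurable_compose[OF measurable_snd])
  show "advB u v \<in> FM" unfolding e by (rule lift_in_FM[OF X integrable_advB[OF *]])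
  show "FM_norm (advB u v) \<le> FM_norm u * (\<integral>\<xi>. norm \<xi> * norm (g \<xi>) \<partial>\<nu>)"
    unfolding e using FM_norm_lift_le[OF X integrable_advB[OF *]] norm_advB_le[OF *] by (simp add: FM_norm_eq[OF r])
qed

lemma
  assumes u: "u \<in> FM" and v: "v \<in> FM" and w: "w \<in> FM"
  shows cubT_FM: "cubT u v w \<in> FM" and FM_norm_cubT_le: "FM_norm (cubT u v w) \<le> FM_norm u * (FM_norm v * FM_norm w)"
proof -
  obtain \<nu>1 g1 where r1: "fm_rep \<nu>1 g1" "fm_of \<nu>1 g1 = u" using FM_rep[OF u] by blast
  obtain \<nu>2 g2 where r2: "fm_rep \<nu>2 g2" "fm_of \<nu>2 g2 = v" using FM_rep[OF v] by blast
  obtain \<nu>3 g3 where r3: "fm_rep \<nu>3 g3" "fm_of \<nu>3 g3 = w" using FM_rep[OF w] by blast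
  note D1 = fm_repD[OF r1(1)] and D2 = fm_repD[OF r2(1)] and D3 = fm_repD[OF r3(1)]
  have s: "sigma_finite_measure \<nu>1" "sigma_finite_measure \<nu>2" "sigma_finite_measure \<nu>3"
    using D1(4) D2(4) D3(4) finite_measure.axioms(1) by blast+
  note [measurable] = D1(1) D2(1) D3(1)
  note * = s D1(1) D2(1) D3(1) D1(2) D2(2) D3(2)
  have e: "cubT u v w = lift (\<nu>1 \<Otimes>\<^sub>M \<nu>2 \<Otimes>\<^sub>M \<nu>3) (\<lambda>z. fst z - fst (snd z) + snd (snd z)) (\<lambda>z. hdot (g1 (fst z)) (g2 (fst (snd z))) *s g3 (snd (snd z)))"
    using cubT_lift[OF *] r1(2) r2(2) r3(2) by (simp add: fm_of_eq_lift)
  have X: "(\<lambda>z. fst z - fst (snd z) + snd (snd z)) \<in> borel_measurable (\<nu>1 \<Otimes>\<^sub>M \<nu>2 \<Otimes>\<^sub>M \<nu>3)" by measurable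
  show "cubT u v w \<in> FM" unfolding e by (rule lift_in_FM[OF X integrable_cubT[OF *]])
  show "FM_norm (cubT u v w) \<le> FM_norm u * (FM_norm v * FM_norm w)"
    unfolding e using FM_norm_lift_le[OF X integrable_cubT[OF *]] norm_cubT_le[OF *]
    by (simp add: FM_norm_eq[OF r1] FM_norm_eq[OF r2] FM_norm_eq[OF r3])
qed

section \<open>Uniqueness of strong solutions\<close>

text \<open>Only backward increments are controlled, because those are what the uniqueness argument
  can estimate; continuity turns this into a statement about all later times.\<close>

lemma dini_nonpos:
  fixes \<phi> :: "real \<Rightarrow> real"
  assumes cont: "continuous_on {0..} \<phi>" and z: "\<phi> 0 \<le> 0"
    and step: "\<And>t \<eta>. 0 < t \<Longrightarrow> 0 < \<eta> \<Longrightarrow> \<forall>\<^sub>F h in at_right 0. \<phi> t - \<phi> (t - h) \<le> \<eta> * h"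
    and t1: "0 \<le> t1"
  shows "\<phi> t1 \<le> 0"
proof (rule ccontr)
  assume "\<not> \<phi> t1 \<le> 0"
  then have pos: "\<phi> t1 > 0" by simp
  then have "t1 > 0" using z t1 by (cases "t1 = 0") auto
  \<comment> \<open>The slope is chosen such that the tilted function \<psi> still has half the
    value of \<phi> at \<open>t1\<close>.\<close>
  define \<eta> where "\<eta> = \<phi> t1 / (2 * t1)"
  have \<eta>: "\<eta> > 0" using pos \<open>t1 > 0\<close> by (simp add: \<eta>_def)
  define \<psi> where "\<psi> t = \<phi> t - \<eta> * t" for t
  have \<psi>1: "\<psi> t1 = \<phi> t1 / 2" using \<open>t1 > 0\<close> by (simp add: \<psi>_def \<eta>_def)
  have \<psi>c: "continuous_on {0..t1} \<psi>" unfolding \<psi>_def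
    by (intro continuous_intros continuous_on_subset[OF cont]) auto
  \<comment> \<open>At the first time where \<psi> reaches this level it is smaller immediately
    before, so \<phi> increases there at a rate above \<eta>, against \<open>step\<close>.\<close>
  define S where "S = {t \<in> {0..t1}. \<phi> t1 / 2 \<le> \<psi> t}"
  have "closed S" unfolding S_def
    by (rule continuous_on_closed_Collect_le[OF continuous_on_const \<psi>c closed_atLeastAtMost])
  have S1: "t1 \<in> S" using \<psi>1 \<open>t1 > 0\<close> by (simp add: S_def)
  have bdd: "bdd_below S" by (auto simp: S_def intro!: bdd_belowI[of _ 0])
  define s where "s = Inf S"
  have s: "s \<in> S" unfolding s_def using closed_contains_Inf[OF _ bdd \<open>closed S\<close>] S1 by blast
  have "s \<noteq> 0" using s pos z by (auto simp: S_def \<psi>_def)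
  then have s0: "s > 0" using s by (auto simp: S_def)
  have "\<forall>\<^sub>F h in at_right 0. \<phi> s - \<phi> (s - h) \<le> \<eta> * h" by (rule step[OF s0 \<eta>])
  moreover have "\<forall>\<^sub>F h in at_right 0. h \<in> {0<..<s}" using s0 by (rule eventually_at_right_real)
  ultimately have "\<forall>\<^sub>F h in at_right (0::real). False"
  proof eventually_elim
    case (elim h)
    have "s - h \<notin> S" using elim cInf_lower[OF _ bdd, of "s - h"] by (auto simp: s_def)
    then have "\<psi> (s - h) < \<phi> t1 / 2" using elim s by (auto simp: S_def)
    then have "\<psi> (s - h) < \<psi> s" using s by (auto simp: S_def)
    then show ?case using elim by (simp add: \<psi>_def algebra_simps)
  qed
  then show False by simp
qed

text \<open>Multiplication by \<open>exp (- C * t)\<close> removes the term proportional to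
  \<open>f\<close>; the error of this discrete product rule is of second order in \<open>h\<close>
  and joins \<open>e\<close>.\<close>

lemma dini_gronwall:
  fixes f :: "real \<Rightarrow> real"
  assumes cont: "continuous_on {0..} f" and f0: "f 0 = 0" and nn: "\<And>t. 0 \<le> t \<Longrightarrow> 0 \<le> f t" and C: "0 \<le> C"
    and step: "\<And>t. 0 < t \<Longrightarrow> \<exists>e. (e \<longlongrightarrow> 0) (at_right 0) \<and>
        (\<forall>\<^sub>F h in at_right 0. f t - f (t - h) \<le> C * h * f t + h * e h)"
    and t: "0 \<le> t"
  shows "f t = 0"
proof -
  define \<phi> where "\<phi> t = exp (- C * t) * f t" for t
  have "\<phi> t \<le> 0"
  proof (rule dini_nonpos[OF _ _ _ t])
    show "continuous_on {0..} \<phi>" unfolding \<phi>_def by (intro continuous_intros cont)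
    show "\<phi> 0 \<le> 0" by (simp add: \<phi>_def f0)
    fix t \<eta> :: real assume t: "0 < t" and \<eta>: "0 < \<eta>"
    obtain e where e: "(e \<longlongrightarrow> 0) (at_right 0)" and fe: "\<forall>\<^sub>F h in at_right 0. f t - f (t - h) \<le> C * h * f t + h * e h"
      using step[OF t] by blast
    \<comment> \<open>The error per unit of \<open>h\<close> after multiplication: the term with C^2
      comes from exp(C h) (1 - C h) \<ge> 1 - C^2 h^2.\<close>
    have "((\<lambda>h. exp (- C * t) * (f t * C\<^sup>2 * h + exp (C * h) * e h)) \<longlongrightarrow> exp (- C * t) * (f t * C\<^sup>2 * 0 + exp (C * 0) * 0)) (at_right 0)"
      by (intro tendsto_intros e)
    then have "((\<lambda>h. exp (- C * t) * (f t * C\<^sup>2 * h + exp (C * h) * e h)) \<longlongrightarrow> 0) (at_right 0)" by simp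
    from order_tendstoD(2)[OF this \<eta>] fe eventually_at_right_real[of 0 "1 / (C + 1)"]
    have "\<forall>\<^sub>F h in at_right 0. exp (- C * t) * (f t * C\<^sup>2 * h + exp (C * h) * e h) < \<eta> \<and>
        f t - f (t - h) \<le> C * h * f t + h * e h \<and> h \<in> {0<..<1 / (C + 1)}"
      using C by (simp add: eventually_conj_iff)
    then show "\<forall>\<^sub>F h in at_right 0. \<phi> t - \<phi> (t - h) \<le> \<eta> * h"
    proof eventually_elim
      case (elim h)
      then have h: "0 < h" "h < 1 / (C + 1)" by auto
      have "C * h \<le> C * (1 / (C + 1))" using h C by (intro mult_left_mono) auto
      also have "\<dots> \<le> 1" using C by (simp add: divide_simps)
      finally have Ch: "C * h \<le> 1" .
      have "(1 + C * h) * (1 - C * h) \<le> exp (C * h) * (1 - C * h)"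
        using Ch exp_ge_add_one_self[of "C * h"] by (intro mult_right_mono) auto
      then have q: "1 - exp (C * h) * (1 - C * h) \<le> C\<^sup>2 * h\<^sup>2"
        by (simp add: algebra_simps power2_eq_square)
      have "exp (C * h) * ((1 - C * h) * f t - h * e h) \<le> exp (C * h) * f (t - h)"
        using elim by (intro mult_left_mono) (auto simp: algebra_simps)
      then have "f t - exp (C * h) * f (t - h) \<le> (1 - exp (C * h) * (1 - C * h)) * f t + exp (C * h) * (h * e h)"
        by (simp add: algebra_simps)
      also have "\<dots> \<le> (C\<^sup>2 * h\<^sup>2) * f t + exp (C * h) * (h * e h)"
        using mult_right_mono[OF q nn[of t]] t by simp
      also have "\<dots> = h * (f t * C\<^sup>2 * h + exp (C * h) * e h)" by (simp add: algebra_simps power2_eq_square)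
      finally have "exp (- C * t) * (f t - exp (C * h) * f (t - h)) \<le> exp (- C * t) * (h * (f t * C\<^sup>2 * h + exp (C * h) * e h))"
        by (intro mult_left_mono) auto
      moreover have "\<phi> t - \<phi> (t - h) = exp (- C * t) * (f t - exp (C * h) * f (t - h))"
      proof -
        have "exp (- C * (t - h)) = exp (- C * t) * exp (C * h)"
          unfolding exp_add[symmetric] by (simp add: algebra_simps)
        then show ?thesis by (simp add: \<phi>_def right_diff_distrib mult.assoc)
      qed
      moreover have "h * (exp (- C * t) * (f t * C\<^sup>2 * h + exp (C * h) * e h)) \<le> h * \<eta>"
        using elim h by (intro mult_left_mono) auto
      then have "exp (- C * t) * (h * (f t * C\<^sup>2 * h + exp (C * h) * e h)) \<le> \<eta> * h"
        by (simp only: mult.left_commute mult.commute)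
      ultimately show ?case by linarith
    qed
  qed
  then have "f t \<le> 0" by (simp add: \<phi>_def mult_le_0_iff)
  with nn[OF t] show ?thesis by simp
qed

text \<open>The part of \<open>strong_sol\<close> that concerns a single positive time, without the solenoidality.\<close>

definition evol :: "real \<Rightarrow> real \<Rightarrow> real \<Rightarrow> real \<Rightarrow> real \<Rightarrow> (real \<Rightarrow> ('n::finite) vfield) \<Rightarrow> real \<Rightarrow> bool" where
  "evol \<alpha> \<Gamma>0 \<Gamma>2 \<beta> lam0 u t \<longleftrightarrow> u t \<in> FMs 4 \<and>
     (\<exists>u'. u' \<in> FM \<and>
        ((\<lambda>h. FM_norm (\<lambda>x. (u (t + h) x - u t x) /\<^sub>R h - u' x)) \<longlongrightarrow> 0) (at 0) \<and>
        (\<forall>x. u' x + A_d \<alpha> \<Gamma>0 \<Gamma>2 (u t) x + \<beta> *\<^sub>R helmholtz (cubic (u t)) x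
              + lam0 *\<^sub>R helmholtz (advect (u t)) x = 0))"

lemma symb_lower:
  assumes "\<Gamma>2 > 0"
  shows "\<exists>C\<ge>0. \<forall>\<xi>::real^'n. K * (1 + norm \<xi>) \<le> symb \<alpha> \<Gamma>0 \<Gamma>2 \<xi> + C"
proof -
  \<comment> \<open>Completing a square bounds L x^2 by \<Gamma>2 x^4 + L^2 / \<Gamma>2 with L = |K|
    + |\<Gamma>0|. The term 2 |K| comes from 1 + x \<le> 2 + x^2, and |\<alpha>| compensates a
    negative \<alpha>.\<close>
  define C where "C = \<bar>K\<bar> * 2 + \<bar>\<alpha>\<bar> + (\<bar>K\<bar> + \<bar>\<Gamma>0\<bar>)\<^sup>2 / \<Gamma>2"
  have "K * (1 + x) \<le> \<alpha> + \<Gamma>0 * x ^ 2 + \<Gamma>2 * x ^ 4 + C" if "x \<ge> 0" for x :: real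
  proof -
    have "K * (1 + x) \<le> \<bar>K\<bar> * (1 + x)" using that by (intro mult_right_mono) auto
    also have "\<dots> \<le> \<bar>K\<bar> * (2 + x ^ 2)"
    proof (intro mult_left_mono)
      have "0 \<le> (x - 1)\<^sup>2" by simp
      then have "2 * x \<le> 1 + x ^ 2" by (simp add: power2_diff)
      then show "1 + x \<le> 2 + x ^ 2" using that by linarith
    qed simp
    finally have 1: "K * (1 + x) \<le> \<bar>K\<bar> * 2 + \<bar>K\<bar> * x ^ 2" by (simp add: algebra_simps)
    have "- \<Gamma>0 * x ^ 2 \<le> \<bar>\<Gamma>0\<bar> * x ^ 2" by (intro mult_right_mono) auto
    with 1 have 2: "K * (1 + x) - \<Gamma>0 * x ^ 2 \<le> \<bar>K\<bar> * 2 + (\<bar>K\<bar> + \<bar>\<Gamma>0\<bar>) * x ^ 2" by (simp add: algebra_simps)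
    define L where "L = \<bar>K\<bar> + \<bar>\<Gamma>0\<bar>"
    have "L * x ^ 2 \<le> \<Gamma>2 * x ^ 4 + L\<^sup>2 / \<Gamma>2"
    proof -
      have "0 \<le> (\<Gamma>2 * x ^ 2 - L)\<^sup>2 + \<Gamma>2 * (L * x ^ 2)"
        using assms by (simp add: L_def)
      also have "\<dots> = \<Gamma>2 * (\<Gamma>2 * x ^ 4 + L\<^sup>2 / \<Gamma>2 - L * x ^ 2)"
        using assms by (simp add: field_simps power2_eq_square power4_eq_xxxx)
      finally show ?thesis using assms by (simp add: zero_le_mult_iff)
    qed
    with 2 show ?thesis unfolding C_def L_def[symmetric] by (simp add: L_def[symmetric])
  qed
  from this[OF norm_ge_zero] show ?thesis
    using assms by (intro exI[of _ C]) (auto simp: symb_def C_def)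
qed

lemma FM_norm_diff_swap:
  assumes "u \<in> FM" "v \<in> FM"
  shows "\<bar>FM_norm u - FM_norm v\<bar> \<le> FM_norm (\<lambda>x. u x - v x)"
proof -
  have d: "(\<lambda>x. u x - v x) \<in> FM" by (rule FM_diff[OF assms])
  have "FM_norm u \<le> FM_norm v + FM_norm (\<lambda>x. u x - v x)"
    using FM_norm_add_le[OF assms(2) d] by simp
  moreover have "FM_norm v \<le> FM_norm u + FM_norm (\<lambda>x. u x - v x)"
    using FM_norm_diff_le[OF assms(1) d] by simp
  ultimately show ?thesis by linarith
qed

lemma hdot_diff_left: "hdot (a - b) c = hdot a c - hdot b c"
  by (simp add: hdot_def left_diff_distrib sum_subtractf)

lemma hdot_diff_right: "hdot a (b - c) = hdot a b - hdot a c"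
  by (simp add: hdot_def right_diff_distrib sum_subtractf)

lemma FM_norm_cubic_diff_le:
  assumes u: "u \<in> FM" "FM_norm u \<le> R" and v: "v \<in> FM" "FM_norm v \<le> R"
  shows "(\<lambda>x. cubic u x - cubic v x) \<in> FM"
    and "FM_norm (\<lambda>x. cubic u x - cubic v x) \<le> 3 * R\<^sup>2 * FM_norm (\<lambda>x. u x - v x)"
proof -
  define w where "w = (\<lambda>x. u x - v x)"
  have w: "w \<in> FM" unfolding w_def by (rule FM_diff[OF u(1) v(1)])
  \<comment> \<open>Telescoping: the factors of the cubic term are exchanged one after the other,
    each time leaving \<open>w\<close> in one place.\<close>
  have e: "(\<lambda>x. cubic u x - cubic v x) = (\<lambda>x. (cubT w u u x + cubT v w u x) + cubT v v w x)"
    by (auto simp: cubic_eq_cubT cubT_def w_def fun_eq_iff hdot_diff_left hdot_diff_right vsm.diff_left vsm.diff_right)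
  note c = cubT_FM[OF w u(1) u(1)] cubT_FM[OF v(1) w u(1)] cubT_FM[OF v(1) v(1) w]
  note n = FM_norm_nonneg[OF u(1)] FM_norm_nonneg[OF v(1)] FM_norm_nonneg[OF w]
  show "(\<lambda>x. cubic u x - cubic v x) \<in> FM" unfolding e by (intro FM_add c)
  have "FM_norm (\<lambda>x. cubic u x - cubic v x) \<le> (FM_norm (cubT w u u) + FM_norm (cubT v w u)) + FM_norm (cubT v v w)"
    unfolding e
    by (rule order_trans[OF FM_norm_add_le[OF FM_add[OF c(1,2)] c(3)] add_right_mono[OF FM_norm_add_le[OF c(1,2)]]])
  also have "\<dots> \<le> (FM_norm w * (R * R) + R * (FM_norm w * R)) + R * (R * FM_norm w)"
    by (intro add_mono order_trans[OF FM_norm_cubT_le] mult_mono w u v mult_nonneg_nonneg n order_trans[OF n(1) u(2)] order.refl)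
  finally show "FM_norm (\<lambda>x. cubic u x - cubic v x) \<le> 3 * R\<^sup>2 * FM_norm (\<lambda>x. u x - v x)"
    unfolding w_def[symmetric] by (simp add: power2_eq_square)
qed

lemma FMs_1_rep: "u \<in> FMs 1 \<Longrightarrow> fm_rep \<nu> g \<Longrightarrow> fm_of \<nu> g = u \<Longrightarrow> integrable \<nu> (\<lambda>\<xi>. norm \<xi> * norm (g \<xi>))"
  using FMs_rep[of u 1] by simp

text \<open>The gradient of \<open>u - v\<close> is not controlled by its \<open>FM_norm\<close>.
  The bound therefore contains the first moment of its density, the quantity that dissipation can
  absorb.\<close>

lemma FM_norm_advect_diff_le:
  assumes u: "u \<in> FMs 1" "FMs_norm 1 u \<le> R" and v: "v \<in> FMs 1" "FMs_norm 1 v \<le> R"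
    and r: "fm_rep \<nu> g" "fm_of \<nu> g = (\<lambda>x. u x - v x)"
  shows "(\<lambda>x. advect u x - advect v x) \<in> FM"
    and "FM_norm (\<lambda>x. advect u x - advect v x) \<le> R * (\<integral>\<xi>. (1 + norm \<xi>) * norm (g \<xi>) \<partial>\<nu>)"
proof -
  define w where "w = (\<lambda>x. u x - v x)"
  have w1: "w \<in> FMs 1" unfolding w_def by (rule FMs_diff[OF u(1) v(1)])
  have uF: "u \<in> FM" and vF: "v \<in> FM" and wF: "w \<in> FM" using u v w1 FMs_subset_FM by blast+
  obtain \<nu>u gu where ru: "fm_rep \<nu>u gu" "fm_of \<nu>u gu = u" using FM_rep[OF uF] by blast
  note iu = FMs_1_rep[OF u(1) ru]
  have rw: "fm_rep \<nu> g" "fm_of \<nu> g = w" using r by (simp_all add: w_def)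
  note iw = FMs_1_rep[OF w1 rw]
  have e: "(\<lambda>x. advect u x - advect v x) = (\<lambda>x. advB w u x + advB v w x)"
    unfolding w_def advect_eq_advB advB_def
    by (simp add: fun_eq_iff vec_eq_iff pdiff_diff[OF u(1) v(1)] algebra_simps sum_subtractf sum.distrib)
  note b = advB_FM[OF wF ru iu] advB_FM[OF vF rw iw]
  show "(\<lambda>x. advect u x - advect v x) \<in> FM" unfolding e by (intro FM_add b)
  have Ru: "(\<integral>\<xi>. norm \<xi> * norm (gu \<xi>) \<partial>\<nu>u) \<le> R"
    using FMs_norm_eq[OF ru u(1)] u(2) FM_norm_nonneg[OF uF] by simp
  have Rv: "FM_norm v \<le> R" using FM_norm_le_FMs_norm[OF v(1)] v(2) by simp
  have "FM_norm (\<lambda>x. advect u x - advect v x) \<le> FM_norm w * R + R * (\<integral>\<xi>. norm \<xi> * norm (g \<xi>) \<partial>\<nu>)"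
    unfolding e
    by (rule order_trans[OF FM_norm_add_le[OF b]], rule add_mono)
      (rule order_trans[OF FM_norm_advB_le[OF wF ru iu] mult_left_mono[OF Ru FM_norm_nonneg[OF wF]]],
       rule order_trans[OF FM_norm_advB_le[OF vF rw iw] mult_right_mono[OF Rv]], simp)
  also have "\<dots> = R * (\<integral>\<xi>. (1 + norm \<xi>) * norm (g \<xi>) \<partial>\<nu>)"
    using iw fm_repD(2)[OF r(1)] by (simp add: FM_norm_eq[OF rw] distrib_right distrib_left)
  finally show "FM_norm (\<lambda>x. advect u x - advect v x) \<le> R * (\<integral>\<xi>. (1 + norm \<xi>) * norm (g \<xi>) \<partial>\<nu>)" .
qed

text \<open>Since the symbol grows faster than \<open>norm \<xi>\<close>, dissipation absorbs the derivative in the advection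
  term within the \<open>L\<^sup>1\<close>-type norm itself: the total variation of the difference of two solutions
  satisfies a backward Dini differential inequality, so no Duhamel formula is needed.\<close>

theorem evol_unique:
  fixes u v :: "real \<Rightarrow> ('n::finite) vfield"
  assumes \<Gamma>2: "\<Gamma>2 > 0" and init: "u 0 = v 0"
    and uF: "\<And>t. 0 \<le> t \<Longrightarrow> u t \<in> FM" and vF: "\<And>t. 0 \<le> t \<Longrightarrow> v t \<in> FM"
    and uc: "\<And>t. 0 \<le> t \<Longrightarrow> ((\<lambda>s. FM_norm (\<lambda>x. u s x - u t x)) \<longlongrightarrow> 0) (at t within {0..})"
    and vc: "\<And>t. 0 \<le> t \<Longrightarrow> ((\<lambda>s. FM_norm (\<lambda>x. v s x - v t x)) \<longlongrightarrow> 0) (at t within {0..})"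
    and ue: "\<And>t. 0 < t \<Longrightarrow> evol \<alpha> \<Gamma>0 \<Gamma>2 \<beta> lam0 u t" and ve: "\<And>t. 0 < t \<Longrightarrow> evol \<alpha> \<Gamma>0 \<Gamma>2 \<beta> lam0 v t"
    and ub: "\<And>t. 0 < t \<Longrightarrow> FMs_norm 1 (u t) \<le> R" and vb: "\<And>t. 0 < t \<Longrightarrow> FMs_norm 1 (v t) \<le> R"
    and t: "0 \<le> t"
  shows "u t = v t"
proof -
  define w where "w t = (\<lambda>x. u t x - v t x)" for t
  define f where "f t = FM_norm (w t)" for t
  have wF: "w t \<in> FM" if "0 \<le> t" for t unfolding w_def by (rule FM_diff[OF uF[OF that] vF[OF that]])
  \<comment> \<open>The factors 2 come from the Helmholtz projection, \<open>3 * R\<^sup>2\<close>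
    from the cubic difference and |R| from the advection difference; dissipation must beat
    \<open>K * (1 + norm \<xi>)\<close>.\<close>
  define K where "K = 2 * \<bar>\<beta>\<bar> * (3 * R\<^sup>2) + 2 * \<bar>lam0\<bar> * \<bar>R\<bar>"
  have K0: "0 \<le> K" by (simp add: K_def)
  obtain C where C: "0 \<le> C" "\<And>\<xi>::real^'n. K * (1 + norm \<xi>) \<le> symb \<alpha> \<Gamma>0 \<Gamma>2 \<xi> + C"
    using symb_lower[OF \<Gamma>2] by blast
  have "f t = 0"
  proof (rule dini_gronwall[OF _ _ _ C(1) _ t])
    show "continuous_on {0..} f"
      unfolding continuous_on
    proof
      fix t :: real assume "t \<in> {0..}"
      then have t: "0 \<le> t" by simp
      have lim: "((\<lambda>s. FM_norm (\<lambda>x. u s x - u t x) + FM_norm (\<lambda>x. v s x - v t x)) \<longlongrightarrow> 0) (at t within {0..})"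
        using tendsto_add[OF uc[OF t] vc[OF t]] by simp
      have "((\<lambda>s. f s - f t) \<longlongrightarrow> 0) (at t within {0..})"
      proof (rule Lim_null_comparison[OF _ lim])
        show "\<forall>\<^sub>F s in at t within {0..}. norm (f s - f t) \<le> FM_norm (\<lambda>x. u s x - u t x) + FM_norm (\<lambda>x. v s x - v t x)"
          unfolding eventually_at_filter
        proof (intro always_eventually allI impI)
          fix s :: real assume "s \<in> {0..}"
          then have s: "0 \<le> s" by simp
          have "norm (f s - f t) \<le> FM_norm (\<lambda>x. w s x - w t x)"
            unfolding f_def real_norm_def by (rule FM_norm_diff_swap[OF wF[OF s] wF[OF t]])
          also have "(\<lambda>x. w s x - w t x) = (\<lambda>x. (u s x - u t x) - (v s x - v t x))" by (auto simp: w_def)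
          also have "FM_norm \<dots> \<le> FM_norm (\<lambda>x. u s x - u t x) + FM_norm (\<lambda>x. v s x - v t x)"
            by (intro FM_norm_diff_le FM_diff uF vF s t)
          finally show "norm (f s - f t) \<le> FM_norm (\<lambda>x. u s x - u t x) + FM_norm (\<lambda>x. v s x - v t x)" .
        qed
      qed
      then show "(f \<longlongrightarrow> f t) (at t within {0..})" by (simp add: Lim_null[of f])
    qed
    have "FM_norm (w 0) \<le> 0"
      using FM_norm_scaleR_le[OF wF[of 0], of 0] by (simp add: w_def init)
    then show "f 0 = 0" using FM_norm_nonneg[OF wF[of 0]] by (simp add: f_def)
    show "0 \<le> f t" if "0 \<le> t" for t unfolding f_def by (rule FM_norm_nonneg[OF wF[OF that]])
    fix t :: real assume t: "0 < t"
    obtain u' where u4: "u t \<in> FMs 4" and u': "u' \<in> FM"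
      and ud: "((\<lambda>h. FM_norm (\<lambda>x. (u (t + h) x - u t x) /\<^sub>R h - u' x)) \<longlongrightarrow> 0) (at 0)"
      and ueq: "\<And>x. u' x + A_d \<alpha> \<Gamma>0 \<Gamma>2 (u t) x + \<beta> *\<^sub>R helmholtz (cubic (u t)) x + lam0 *\<^sub>R helmholtz (advect (u t)) x = 0"
      using ue[OF t] unfolding evol_def by blast
    obtain v' where v4: "v t \<in> FMs 4" and v': "v' \<in> FM"
      and vd: "((\<lambda>h. FM_norm (\<lambda>x. (v (t + h) x - v t x) /\<^sub>R h - v' x)) \<longlongrightarrow> 0) (at 0)"
      and veq: "\<And>x. v' x + A_d \<alpha> \<Gamma>0 \<Gamma>2 (v t) x + \<beta> *\<^sub>R helmholtz (cubic (v t)) x + lam0 *\<^sub>R helmholtz (advect (v t)) x = 0"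
      using ve[OF t] unfolding evol_def by blast
    have t0: "0 \<le> t" using t by simp
    have u1: "u t \<in> FMs 1" and v1: "v t \<in> FMs 1" using FMs_mono[of 1 4] u4 v4 by auto
    have w4: "w t \<in> FMs 4" unfolding w_def by (rule FMs_diff[OF u4 v4])
    obtain \<nu> g where r: "fm_rep \<nu> g" "fm_of \<nu> g = w t" using FM_rep[OF wF[OF t0]] by blast
    note D = fm_repD[OF r(1)]
    have wl: "w t = lift \<nu> (\<lambda>\<xi>. \<xi>) g" using r(2) by (simp add: fm_of_eq_lift)
    have i4: "integrable \<nu> (\<lambda>\<xi>. norm \<xi> ^ 4 * norm (g \<xi>))" using FMs_rep[OF w4 r] by (simp add: powr_4)
    have i1: "integrable \<nu> (\<lambda>\<xi>. norm \<xi> * norm (g \<xi>))"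
      using FMs_mono[of 1 4] w4 by (intro FMs_1_rep[OF _ r]) auto
    have isy: "integrable \<nu> (\<lambda>\<xi>. symb \<alpha> \<Gamma>0 \<Gamma>2 \<xi> *\<^sub>R g \<xi>)" by (rule integrable_symb[OF D(1,2) i4])
    have isy': "integrable \<nu> (\<lambda>\<xi>. symb \<alpha> \<Gamma>0 \<Gamma>2 \<xi> * norm (g \<xi>))"
    proof (rule Bochner_Integration.integrable_bound[OF isy])
      have "symb \<alpha> \<Gamma>0 \<Gamma>2 \<in> borel_measurable \<nu>" using symb_measurable measurable_cong_sets[OF D(3) refl] by blast
      then show "(\<lambda>\<xi>. symb \<alpha> \<Gamma>0 \<Gamma>2 \<xi> * norm (g \<xi>)) \<in> borel_measurable \<nu>"
        using borel_measurable_integrable[OF D(2)] by measurable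
    qed (simp add: abs_mult)
    define I where "I = (\<integral>\<xi>. (1 + norm \<xi>) * norm (g \<xi>) \<partial>\<nu>)"
    have iI: "integrable \<nu> (\<lambda>\<xi>. (1 + norm \<xi>) * norm (g \<xi>))"
      using Bochner_Integration.integrable_add[OF integrable_norm[OF D(2)] i1] by (simp add: distrib_right)
    have fI: "f t \<le> I"
      unfolding f_def I_def FM_norm_eq[OF r]
      by (rule integral_mono[OF integrable_norm[OF D(2)] iI]) (simp add: distrib_right)
    have f0: "0 \<le> f t" unfolding f_def by (rule FM_norm_nonneg[OF wF[OF t0]])
    have uR: "FM_norm (u t) \<le> \<bar>R\<bar>" and vR: "FM_norm (v t) \<le> \<bar>R\<bar>"
      using FM_norm_le_FMs_norm[OF u1] ub[OF t] FM_norm_le_FMs_norm[OF v1] vb[OF t] by linarith+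
    have uR': "FMs_norm 1 (u t) \<le> \<bar>R\<bar>" and vR': "FMs_norm 1 (v t) \<le> \<bar>R\<bar>" using ub[OF t] vb[OF t] by linarith+
    note cd = FM_norm_cubic_diff_le[OF uF[OF t0] uR vF[OF t0] vR]
    note ad = FM_norm_advect_diff_le[OF u1 uR' v1 vR' r[unfolded w_def]]
    define Hc where "Hc = helmholtz (\<lambda>x. cubic (u t) x - cubic (v t) x)"
    define Ha where "Ha = helmholtz (\<lambda>x. advect (u t) x - advect (v t) x)"
    have HcF: "Hc \<in> FM" and HaF: "Ha \<in> FM" unfolding Hc_def Ha_def by (intro helmholtz_FM cd ad)+
    have cF: "cubic (u t) \<in> FM" "cubic (v t) \<in> FM" unfolding cubic_eq_cubT by (intro cubT_FM uF vF t0)+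
    have aF: "advect z \<in> FM" if z: "z \<in> FMs 1" for z :: "'n vfield"
    proof -
      have "z \<in> FM" using z FMs_subset_FM by blast
      then obtain \<nu> g where r: "fm_rep \<nu> g" "fm_of \<nu> g = z" using FM_rep by blast
      show ?thesis unfolding advect_eq_advB by (rule advB_FM[OF \<open>z \<in> FM\<close> r FMs_1_rep[OF z r]])
    qed
    define F where "F = (\<lambda>x. (- \<beta>) *\<^sub>R Hc x + (- lam0) *\<^sub>R Ha x)"
    have FF: "F \<in> FM" unfolding F_def by (intro FM_add FM_scaleR HcF HaF)
    have "FM_norm F \<le> \<bar>\<beta>\<bar> * FM_norm Hc + \<bar>lam0\<bar> * FM_norm Ha"
      unfolding F_def
      using FM_norm_add_le[OF FM_scaleR[OF HcF, of "- \<beta>"] FM_scaleR[OF HaF, of "- lam0"]]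
        FM_norm_scaleR_le[OF HcF, of "- \<beta>"] FM_norm_scaleR_le[OF HaF, of "- lam0"] by simp
    also have "\<dots> \<le> \<bar>\<beta>\<bar> * (2 * (3 * \<bar>R\<bar>\<^sup>2 * I)) + \<bar>lam0\<bar> * (2 * (\<bar>R\<bar> * I))"
    proof (intro add_mono mult_left_mono)
      have "FM_norm Hc \<le> 2 * (3 * \<bar>R\<bar>\<^sup>2 * FM_norm (\<lambda>x. u t x - v t x))"
        unfolding Hc_def using FM_norm_helmholtz_le[OF cd(1)] cd(2) by linarith
      also have "\<dots> \<le> 2 * (3 * \<bar>R\<bar>\<^sup>2 * I)"
        using fI unfolding f_def w_def by (intro mult_left_mono) auto
      finally show "FM_norm Hc \<le> 2 * (3 * \<bar>R\<bar>\<^sup>2 * I)" .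
      show "FM_norm Ha \<le> 2 * (\<bar>R\<bar> * I)"
        unfolding Ha_def I_def using FM_norm_helmholtz_le[OF ad(1)] ad(2) by linarith
    qed auto
    also have "\<dots> = K * I" by (simp add: K_def algebra_simps)
    finally have FK: "FM_norm F \<le> K * I" .
    have Feq: "u' x - v' x + A_d \<alpha> \<Gamma>0 \<Gamma>2 (w t) x = F x" for x
    proof -
      have A: "A_d \<alpha> \<Gamma>0 \<Gamma>2 (w t) x = A_d \<alpha> \<Gamma>0 \<Gamma>2 (u t) x - A_d \<alpha> \<Gamma>0 \<Gamma>2 (v t) x"
        unfolding w_def by (rule A_d_diff[OF u4 v4 refl])
      have "Hc x = helmholtz (cubic (u t)) x - helmholtz (cubic (v t)) x"
        unfolding Hc_def by (rule helmholtz_diff[OF cF])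
      moreover have "Ha x = helmholtz (advect (u t)) x - helmholtz (advect (v t)) x"
        unfolding Ha_def by (rule helmholtz_diff[OF aF[OF u1] aF[OF v1]])
      ultimately have "F x = (- \<beta>) *\<^sub>R helmholtz (cubic (u t)) x + \<beta> *\<^sub>R helmholtz (cubic (v t)) x
          - lam0 *\<^sub>R helmholtz (advect (u t)) x + lam0 *\<^sub>R helmholtz (advect (v t)) x"
        unfolding F_def by (simp add: scaleR_diff_right)
      moreover have "u' x = - (A_d \<alpha> \<Gamma>0 \<Gamma>2 (u t) x + \<beta> *\<^sub>R helmholtz (cubic (u t)) x + lam0 *\<^sub>R helmholtz (advect (u t)) x)"
        by (rule eq_neg_iff_add_eq_0[THEN iffD2]) (use ueq[of x] in \<open>simp add: add.assoc\<close>)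
      moreover have "v' x = - (A_d \<alpha> \<Gamma>0 \<Gamma>2 (v t) x + \<beta> *\<^sub>R helmholtz (cubic (v t)) x + lam0 *\<^sub>R helmholtz (advect (v t)) x)"
        by (rule eq_neg_iff_add_eq_0[THEN iffD2]) (use veq[of x] in \<open>simp add: add.assoc\<close>)
      ultimately show ?thesis by (simp add: A)
    qed
    \<comment> \<open>Difference quotients with the step \<open>- h\<close>: the two-sided
      derivatives are used for backward increments only.\<close>
    define e where "e h = FM_norm (\<lambda>x. (u (t + (- h)) x - u t x) /\<^sub>R (- h) - u' x) + FM_norm (\<lambda>x. (v (t + (- h)) x - v t x) /\<^sub>R (- h) - v' x)" for h
    have neg: "filterlim uminus (at (0::real)) (at_right 0)"
      by (rule filterlim_atI) (auto intro!: tendsto_eq_intros simp: eventually_at_filter)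
    have elim: "(e \<longlongrightarrow> 0) (at_right 0)"
      unfolding e_def using tendsto_add[OF filterlim_compose[OF ud neg] filterlim_compose[OF vd neg]] by simp
    show "\<exists>e. (e \<longlongrightarrow> 0) (at_right 0) \<and> (\<forall>\<^sub>F h in at_right 0. f t - f (t - h) \<le> C * h * f t + h * e h)"
    proof (intro exI conjI)
      show "(e \<longlongrightarrow> 0) (at_right 0)" by (rule elim)
      show "\<forall>\<^sub>F h in at_right 0. f t - f (t - h) \<le> C * h * f t + h * e h"
        using eventually_at_right_real[OF t]
      proof eventually_elim
        case (elim h)
        then have h: "0 < h" "0 \<le> t - h" by auto
        define Q where "Q = (\<lambda>x. ((u (t + (- h)) x - u t x) /\<^sub>R (- h) - u' x) - ((v (t + (- h)) x - v t x) /\<^sub>R (- h) - v' x))"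
        have QF: "Q \<in> FM" "FM_norm Q \<le> e h"
          unfolding Q_def e_def using h by (intro FM_diff FM_norm_diff_le FM_scaleR uF vF u' v' t0; simp)+
        \<comment> \<open>\<open>Z\<close> is (1 + h A) w(t), an implicit Euler step read backwards.
          Its norm is at least the integral of (1 + h symb) |g|, whatever the size of the symbol; a
          forward step would lead to |1 - h symb|, which cannot be bounded by 1 - h symb at high
          frequencies.\<close>
        define Z where "Z = lift \<nu> (\<lambda>\<xi>. \<xi>) (\<lambda>\<xi>. g \<xi> + h *\<^sub>R (symb \<alpha> \<Gamma>0 \<Gamma>2 \<xi> *\<^sub>R g \<xi>))"
        have Zi: "integrable \<nu> (\<lambda>\<xi>. g \<xi> + h *\<^sub>R (symb \<alpha> \<Gamma>0 \<Gamma>2 \<xi> *\<^sub>R g \<xi>))" 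
          by (intro Bochner_Integration.integrable_add integrable_scaleR_right D(2) isy)
        have Zx: "Z x = w t x + h *\<^sub>R A_d \<alpha> \<Gamma>0 \<Gamma>2 (w t) x" for x
          unfolding Z_def wl A_d_lift[OF D(1,2) i4] lift_scaleR[symmetric]
          by (rule lift_add[OF D(1,2)]) (intro integrable_scaleR_right isy)
        have Zeq: "Z = (\<lambda>x. w (t - h) x + (h *\<^sub>R F x + h *\<^sub>R Q x))"
        proof
          fix x
          have "h *\<^sub>R Q x = - (w (t - h) x - w t x) - h *\<^sub>R (u' x - v' x)"
            using h by (simp add: Q_def w_def scaleR_diff_right)
          then show "Z x = w (t - h) x + (h *\<^sub>R F x + h *\<^sub>R Q x)"
            unfolding Zx Feq[symmetric] by (simp add: scaleR_add_right)
        qed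
        have "FM_norm Z \<le> f (t - h) + (h * FM_norm F + h * FM_norm Q)"
          unfolding Zeq f_def
          using FM_norm_add_le[OF wF[OF h(2)] FM_add[OF FM_scaleR[OF FF, of h] FM_scaleR[OF QF(1), of h]]]
            FM_norm_add_le[OF FM_scaleR[OF FF, of h] FM_scaleR[OF QF(1), of h]]
            FM_norm_scaleR_le[OF FF, of h] FM_norm_scaleR_le[OF QF(1), of h] h(1) by simp
        also have "\<dots> \<le> f (t - h) + (h * (K * I) + h * e h)"
          using h FK QF(2) by (intro add_mono mult_left_mono) auto
        finally have up: "FM_norm Z \<le> f (t - h) + (h * (K * I) + h * e h)" .
        have Zr: "fm_rep \<nu> (\<lambda>\<xi>. g \<xi> + h *\<^sub>R (symb \<alpha> \<Gamma>0 \<Gamma>2 \<xi> *\<^sub>R g \<xi>))"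
          using r(1) Zi by (simp add: fm_rep_def)
        have "f t + h * (\<integral>\<xi>. symb \<alpha> \<Gamma>0 \<Gamma>2 \<xi> * norm (g \<xi>) \<partial>\<nu>) = (\<integral>\<xi>. norm (g \<xi>) + h * (symb \<alpha> \<Gamma>0 \<Gamma>2 \<xi> * norm (g \<xi>)) \<partial>\<nu>)"
          unfolding f_def FM_norm_eq[OF r] using D(2) isy' by simp
        also have "\<dots> \<le> (\<integral>\<xi>. norm (g \<xi> + h *\<^sub>R (symb \<alpha> \<Gamma>0 \<Gamma>2 \<xi> *\<^sub>R g \<xi>)) \<partial>\<nu>)"
        proof (rule integral_mono)
          fix \<xi>
          have "norm (g \<xi> + h *\<^sub>R (symb \<alpha> \<Gamma>0 \<Gamma>2 \<xi> *\<^sub>R g \<xi>)) = norm ((1 + h * symb \<alpha> \<Gamma>0 \<Gamma>2 \<xi>) *\<^sub>R g \<xi>)"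
            by (simp add: scaleR_add_left)
          also have "\<dots> \<ge> (1 + h * symb \<alpha> \<Gamma>0 \<Gamma>2 \<xi>) * norm (g \<xi>)"
            by (simp add: mult_right_mono)
          finally show "norm (g \<xi>) + h * (symb \<alpha> \<Gamma>0 \<Gamma>2 \<xi> * norm (g \<xi>)) \<le> norm (g \<xi> + h *\<^sub>R (symb \<alpha> \<Gamma>0 \<Gamma>2 \<xi> *\<^sub>R g \<xi>))"
            by (simp add: distrib_right mult.assoc)
        qed (use D(2) isy' Zi in auto)
        also have "\<dots> = FM_norm Z"
          by (rule FM_norm_eq[symmetric, OF Zr]) (simp add: Z_def fm_of_eq_lift)
        finally have low: "f t + h * (\<integral>\<xi>. symb \<alpha> \<Gamma>0 \<Gamma>2 \<xi> * norm (g \<xi>) \<partial>\<nu>) \<le> FM_norm Z" .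
        \<comment> \<open>The choice of \<open>C\<close> enters: the nonlinear terms cost
          \<open>K * I\<close>, which the symbol absorbs up to \<open>C * f t\<close>.\<close>
        have "K * I = (\<integral>\<xi>. K * ((1 + norm \<xi>) * norm (g \<xi>)) \<partial>\<nu>)" by (simp add: I_def)
        also have "\<dots> \<le> (\<integral>\<xi>. symb \<alpha> \<Gamma>0 \<Gamma>2 \<xi> * norm (g \<xi>) + C * norm (g \<xi>) \<partial>\<nu>)"
        proof (rule integral_mono)
          show "K * ((1 + norm \<xi>) * norm (g \<xi>)) \<le> symb \<alpha> \<Gamma>0 \<Gamma>2 \<xi> * norm (g \<xi>) + C * norm (g \<xi>)" for \<xi>
            using mult_right_mono[OF C(2)[of \<xi>] norm_ge_zero[of "g \<xi>"]] by (simp add: algebra_simps)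
        qed (use iI isy' D(2) in auto)
        also have "\<dots> = (\<integral>\<xi>. symb \<alpha> \<Gamma>0 \<Gamma>2 \<xi> * norm (g \<xi>) \<partial>\<nu>) + C * f t"
          unfolding f_def FM_norm_eq[OF r] using isy' D(2) by simp
        finally have "h * (K * I) \<le> h * ((\<integral>\<xi>. symb \<alpha> \<Gamma>0 \<Gamma>2 \<xi> * norm (g \<xi>) \<partial>\<nu>) + C * f t)"
          using h by (intro mult_left_mono) auto
        with up low show ?case by (simp add: algebra_simps)
      qed
    qed
  qed
  then have "w t = (\<lambda>_. 0)" using FM_norm_eq_0[OF wF[OF t]] by (simp add: f_def)
  then show ?thesis by (auto simp: w_def fun_eq_iff)
qed

section \<open>Plane waves and instability\<close>

lemma integrable_return:
  fixes f :: "'a::{second_countable_topology, t2_space} \<Rightarrow> 'b::{banach, second_countable_topology}"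
  assumes [measurable]: "f \<in> borel_measurable borel"
  shows "integrable (return borel a) f"
proof -
  interpret prob_space "return borel a" by (rule prob_space_return) simp
  have "AE y in return borel a. f a = f y"
    by (subst AE_return) (auto intro!: pred_eq_const1 simp: pred_def)
  moreover have "integrable (return borel a) (\<lambda>_. f a)" by simp
  ultimately show ?thesis
    by (subst integrable_cong_AE[of f _ "\<lambda>_. f a"]) auto
qed

definition plane_wave :: "real^'n \<Rightarrow> complex^'n \<Rightarrow> real \<Rightarrow> ('n::finite) vfield" where
  "plane_wave \<xi> c r = (\<lambda>x. cis (- (x \<bullet> \<xi>)) *s (r *\<^sub>R c))"

lemma lift_return:
  fixes \<xi> :: "real^'n" and G :: "real^'n \<Rightarrow> complex^'n"
  assumes [measurable]: "G \<in> borel_measurable borel"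
  shows "lift (return borel \<xi>) (\<lambda>\<xi>. \<xi>) G x = cis (- (x \<bullet> \<xi>)) *s G \<xi>"
  unfolding lift_def by (subst integral_return) auto

lemma plane_wave_lift: "plane_wave \<xi> c r = lift (return borel \<xi>) (\<lambda>\<xi>. \<xi>) (\<lambda>_. r *\<^sub>R c)"
  by (auto simp: plane_wave_def lift_return)

lemma plane_wave_rep:
  "fm_rep (return borel \<xi>) (\<lambda>_. r *\<^sub>R c)" "fm_of (return borel \<xi>) (\<lambda>_. r *\<^sub>R c) = plane_wave \<xi> c r"
  by (simp_all add: fm_rep_def integrable_return prob_space.finite_measure prob_space_return fm_of_eq_lift plane_wave_lift)

lemma plane_wave_FM: "plane_wave \<xi> c r \<in> FM"
  using plane_wave_rep[of \<xi> r c] by (auto simp: FM_def fm_reps_def)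

lemma FM_norm_plane_wave: "FM_norm (plane_wave \<xi> c r) = \<bar>r\<bar> * norm c"
  by (subst FM_norm_eq[OF plane_wave_rep]) (simp add: measure_return)

lemma plane_wave_FMs: "plane_wave \<xi> c r \<in> FMs s"
proof -
  note D = fm_repD[OF plane_wave_rep(1)[of \<xi> r c]]
  show ?thesis unfolding plane_wave_lift by (rule lift_in_FMs[OF D(1,2)]) (simp add: integrable_return)
qed

lemma FMs_norm_plane_wave: "FMs_norm s (plane_wave \<xi> c r) = \<bar>r\<bar> * norm c * (1 + norm \<xi> powr s)"
  by (subst FMs_norm_eq[OF plane_wave_rep plane_wave_FMs]) (simp add: FM_norm_plane_wave integral_return measure_return algebra_simps)

lemma plane_wave_lincomb:
  "plane_wave \<xi> c a x - plane_wave \<xi> c b x = plane_wave \<xi> c (a - b) x"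
  "plane_wave \<xi> c a x + plane_wave \<xi> c b x = plane_wave \<xi> c (a + b) x"
  "k *\<^sub>R plane_wave \<xi> c a x = plane_wave \<xi> c (k * a) x"
  unfolding plane_wave_def vsm.diff_right[symmetric] vsm.add_right[symmetric] vsm.scaleR_right[symmetric]
    scaleR_diff_left scaleR_add_left scaleR_scaleR by (rule refl)+

lemma plane_wave_FM0_sigma:
  assumes "\<xi> \<noteq> 0" "cdot \<xi> c = 0"
  shows "plane_wave \<xi> c r \<in> FM0_sigma"
proof -
  have "proj \<xi> (r *\<^sub>R c) = r *\<^sub>R c" using assms by (intro proj_id) (simp_all add: cdot_scaleR)
  \<comment> \<open>With the constant frequency map the projection identity holds at every point,
    not only at the atom.\<close>
  then have e: "plane_wave \<xi> c r = lift (return borel \<xi>) (\<lambda>_. \<xi>) (\<lambda>_. r *\<^sub>R c)"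
    by (auto simp: plane_wave_def lift_def measure_return)
  show ?thesis unfolding e
    by (rule lift_in_FM0_sigma) (auto simp: integrable_return \<open>proj \<xi> (r *\<^sub>R c) = r *\<^sub>R c\<close>)
qed

text \<open>The wave is complex valued, so its modulus is constant in space and the cubic term is
  the same wave again; a real wave would generate harmonics.\<close>

lemma plane_wave_evol:
  assumes \<xi>: "\<xi> \<noteq> 0" "cdot \<xi> c = 0" "norm c = 1"
    and r: "(r has_real_derivative - (symb \<alpha> \<Gamma>0 \<Gamma>2 \<xi> * r t) - \<beta> * r t ^ 3) (at t)"
  shows "evol \<alpha> \<Gamma>0 \<Gamma>2 \<beta> lam0 (\<lambda>t. plane_wave \<xi> c (r t)) t"
  unfolding evol_def
proof (intro conjI exI[of _ "plane_wave \<xi> c (- (symb \<alpha> \<Gamma>0 \<Gamma>2 \<xi> * r t) - \<beta> * r t ^ 3)"] allI)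
  let ?r' = "- (symb \<alpha> \<Gamma>0 \<Gamma>2 \<xi> * r t) - \<beta> * r t ^ 3"
  note D = fm_repD[OF plane_wave_rep(1)[of \<xi> "r t" c]]
  show "plane_wave \<xi> c (r t) \<in> FMs 4" by (rule plane_wave_FMs)
  show "plane_wave \<xi> c ?r' \<in> FM" by (rule plane_wave_FM)
  have "((\<lambda>h. (r (t + h) - r t) / h) \<longlongrightarrow> ?r') (at 0)" using r by (simp add: DERIV_def)
  then have "((\<lambda>h. \<bar>(r (t + h) - r t) / h - ?r'\<bar>) \<longlongrightarrow> 0) (at 0)"
    by (rule tendsto_rabs_zero[OF LIM_zero])
  moreover have "FM_norm (\<lambda>x. (plane_wave \<xi> c (r (t + h)) x - plane_wave \<xi> c (r t) x) /\<^sub>R h - plane_wave \<xi> c ?r' x) = \<bar>(r (t + h) - r t) / h - ?r'\<bar>" for h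
    unfolding plane_wave_lincomb FM_norm_plane_wave \<xi>(3) by (simp add: divide_inverse mult.commute)
  ultimately show "((\<lambda>h. FM_norm (\<lambda>x. (plane_wave \<xi> c (r (t + h)) x - plane_wave \<xi> c (r t) x) /\<^sub>R h - plane_wave \<xi> c ?r' x)) \<longlongrightarrow> 0) (at 0)"
    by simp
  have A: "A_d \<alpha> \<Gamma>0 \<Gamma>2 (plane_wave \<xi> c (r t)) = plane_wave \<xi> c (symb \<alpha> \<Gamma>0 \<Gamma>2 \<xi> * r t)"
    unfolding plane_wave_lift
    by (subst A_d_lift[OF D(1,2)]) (auto simp: integrable_return lift_return)
  have nsq: "(\<Sum>i\<in>UNIV. (cmod (v $ i))\<^sup>2) = (norm v)\<^sup>2" for v :: "complex^'a"
    by (simp add: norm_vec_def L2_set_def sum_nonneg)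
  have "cubic (plane_wave \<xi> c (r t)) x = plane_wave \<xi> c (r t ^ 3) x" for x
  proof -
    have "norm (plane_wave \<xi> c (r t) x) = \<bar>r t\<bar>" by (simp add: plane_wave_def norm_vector_scalar_mult \<xi>)
    then show ?thesis
      unfolding cubic_def nsq by (simp add: plane_wave_lincomb power2_eq_square power3_eq_cube mult.assoc)
  qed
  then have C: "cubic (plane_wave \<xi> c (r t)) = plane_wave \<xi> c (r t ^ 3)" by blast
  have HC: "helmholtz (plane_wave \<xi> c s) = plane_wave \<xi> c s" for s
  proof -
    note Ds = fm_repD[OF plane_wave_rep(1)[of \<xi> s c]]
    have [measurable]: "(\<lambda>\<xi>. proj \<xi> (s *\<^sub>R c)) \<in> borel_measurable borel"
      unfolding proj_def by measurable
    have "proj \<xi> (s *\<^sub>R c) = s *\<^sub>R c" using \<xi> by (intro proj_id) (simp_all add: cdot_scaleR)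
    then show ?thesis
      unfolding plane_wave_lift by (subst helmholtz_lift[OF Ds(1,2)]) (auto simp: lift_return)
  qed
  have pd: "pdiff i (plane_wave \<xi> c (r t)) x = (- \<i> * complex_of_real (\<xi> $ i)) *s plane_wave \<xi> c (r t) x" for i x
    unfolding plane_wave_lift
    by (subst pdiff_lift[OF D(1,2)]) (auto simp: integrable_return lift_return vec_eq_iff)
  have "advect (plane_wave \<xi> c (r t)) x = 0" for x
  proof -
    have "(\<Sum>i\<in>UNIV. plane_wave \<xi> c (r t) x $ i * (- \<i> * complex_of_real (\<xi> $ i))) = - \<i> * cdot \<xi> (plane_wave \<xi> c (r t) x)"
      by (simp add: cdot_def sum_distrib_left mult_ac)
    also have "cdot \<xi> (plane_wave \<xi> c (r t) x) = cis (- (x \<bullet> \<xi>)) * cdot \<xi> (r t *\<^sub>R c)"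
      by (simp add: cdot_def plane_wave_def sum_distrib_left mult_ac)
    finally have "(\<Sum>i\<in>UNIV. plane_wave \<xi> c (r t) x $ i * (- \<i> * complex_of_real (\<xi> $ i))) = 0"
      using \<xi> by (simp add: cdot_scaleR)
    then have "(\<Sum>i\<in>UNIV. plane_wave \<xi> c (r t) x $ i * (- \<i> * complex_of_real (\<xi> $ i))) * plane_wave \<xi> c (r t) x $ j = 0" for j
      by simp
    then show ?thesis unfolding advect_def pd by (simp add: vec_eq_iff sum_distrib_right mult.assoc)
  qed
  then have "advect (plane_wave \<xi> c (r t)) = plane_wave \<xi> c 0" by (auto simp: plane_wave_def)
  then have HA: "helmholtz (advect (plane_wave \<xi> c (r t))) = plane_wave \<xi> c 0" by (simp add: HC)
  show "plane_wave \<xi> c ?r' x + A_d \<alpha> \<Gamma>0 \<Gamma>2 (plane_wave \<xi> c (r t)) x + \<beta> *\<^sub>R helmholtz (cubic (plane_wave \<xi> c (r t))) x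
      + lam0 *\<^sub>R helmholtz (advect (plane_wave \<xi> c (r t))) x = 0" for x
    unfolding A C HC HA plane_wave_lincomb by (simp add: plane_wave_def)
qed

text \<open>With y = 1 / r^2 the Bernoulli equation becomes the linear equation y' = 2 \<beta> - 2
  \<kappa> y, which is solved by (\<beta> + D exp(- 2 \<kappa> t)) / \<kappa>.\<close>

lemma bernoulli_solution:
  fixes \<kappa> \<beta> D :: real
  assumes "\<kappa> > 0" "\<beta> > 0" "D > 0"
  defines "r \<equiv> \<lambda>t. sqrt \<kappa> / sqrt (\<beta> + D * exp (- 2 * \<kappa> * t))"
  shows "(r has_real_derivative \<kappa> * r t - \<beta> * r t ^ 3) (at t)"
proof -
  define y where "y = \<beta> + D * exp (- 2 * \<kappa> * t)"
  have y: "y > 0" using assms by (simp add: y_def add_pos_pos)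
  then have sy: "sqrt y > 0" "sqrt y * sqrt y = y" by simp_all
  have ye: "\<beta> + D * exp (- (\<kappa> * (t * 2))) = y" by (simp add: y_def ac_simps)
  have "(r has_real_derivative - (sqrt \<kappa> * (D * (exp (- 2 * \<kappa> * t) * (- 2 * \<kappa>)) * (inverse (sqrt y) / 2))) / (sqrt y * sqrt y)) (at t)"
    unfolding r_def using y by (auto intro!: derivative_eq_intros simp: ye ac_simps)
  also have "- (sqrt \<kappa> * (D * (exp (- 2 * \<kappa> * t) * (- 2 * \<kappa>)) * (inverse (sqrt y) / 2))) / (sqrt y * sqrt y)
      = \<kappa> * sqrt \<kappa> * (y - \<beta>) / (sqrt y) ^ 3"
    using sy(1) by (simp add: y_def power3_eq_cube field_simps)
  also have "\<dots> = \<kappa> * r t - \<beta> * r t ^ 3"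
  proof -
    have rt: "r t = sqrt \<kappa> / sqrt y" by (simp add: r_def y_def)
    have "\<kappa> * r t = \<kappa> * sqrt \<kappa> * y / (sqrt y) ^ 3"
      using sy by (simp add: rt power3_eq_cube field_simps)
    moreover have "\<beta> * r t ^ 3 = \<kappa> * sqrt \<kappa> * \<beta> / (sqrt y) ^ 3"
      using assms(1) by (simp add: rt power_divide power3_eq_cube)
    ultimately show ?thesis by (simp add: right_diff_distrib diff_divide_distrib)
  qed
  finally show ?thesis .
qed

text \<open>Here \<open>1 \<le> s\<close>, that is \<gamma> \<ge> 1/4, enters: the phase space norm
  has to control one derivative for \<open>evol_unique\<close> to apply. The factor 2 comes from
  |\<xi>| \<le> 1 + |\<xi>|^s.\<close>

lemma FMs_norm_1_le:
  assumes u: "u \<in> FMs s" and s: "1 \<le> s"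
  shows "FMs_norm 1 u \<le> 2 * FMs_norm s u"
proof -
  have F: "u \<in> FM" and u1: "u \<in> FMs 1" using u s FMs_subset_FM FMs_mono[of 1 s] by auto
  obtain \<nu> g where r: "fm_rep \<nu> g" "fm_of \<nu> g = u" using FM_rep[OF F] by blast
  note i = FMs_rep[OF u r] and i1 = FMs_rep[OF u1 r] and D = fm_repD[OF r(1)]
  have "(\<integral>\<xi>. norm \<xi> powr 1 * norm (g \<xi>) \<partial>\<nu>) \<le> (\<integral>\<xi>. norm (g \<xi>) + norm \<xi> powr s * norm (g \<xi>) \<partial>\<nu>)"
  proof (rule integral_mono[OF i1])
    show "norm \<xi> powr 1 * norm (g \<xi>) \<le> norm (g \<xi>) + norm \<xi> powr s * norm (g \<xi>)" for \<xi>
      using mult_right_mono[OF powr_le_one_plus[of 1 s "norm \<xi>"] norm_ge_zero[of "g \<xi>"]] s by (simp add: distrib_right)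
  qed (use i D in simp)
  also have "\<dots> = FM_norm u + (\<integral>\<xi>. norm \<xi> powr s * norm (g \<xi>) \<partial>\<nu>)" using i D by (simp add: FM_norm_eq[OF r])
  finally have "FMs_norm 1 u \<le> 2 * FM_norm u + (\<integral>\<xi>. norm \<xi> powr s * norm (g \<xi>) \<partial>\<nu>)"
    by (simp add: FMs_norm_eq[OF r u1])
  also have "\<dots> \<le> 2 * FM_norm u + 2 * (\<integral>\<xi>. norm \<xi> powr s * norm (g \<xi>) \<partial>\<nu>)"
    by (intro add_left_mono) (simp add: integral_nonneg_AE)
  also have "\<dots> = 2 * FMs_norm s u" unfolding FMs_norm_eq[OF r u] by simp
  finally show ?thesis .
qed

theorem plane_wave_instability:
  fixes \<xi> :: "real^('n::finite)"
  assumes \<Gamma>2: "\<Gamma>2 > 0" and \<beta>: "\<beta> > 0" and \<xi>: "\<xi> \<noteq> 0" "cdot \<xi> c = 0" "norm c = 1"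
    and neg: "symb \<alpha> \<Gamma>0 \<Gamma>2 \<xi> < 0" and s: "1 \<le> s"
  shows "\<exists>\<epsilon>>0. \<forall>\<delta>>0. \<exists>u0 \<in> FMs s \<inter> (FM0_sigma :: 'n vfield set). FMs_norm s u0 < \<delta> \<and>
         \<not> (\<exists>u. strong_sol (FMs s \<inter> FM0_sigma) (FMs_norm s) \<alpha> \<Gamma>0 \<Gamma>2 \<beta> lam0 \<infinity> u0 u \<and>
                 (\<forall>t\<ge>0. FMs_norm s (u t) < \<epsilon>))"
proof -
  define \<kappa> where "\<kappa> = - symb \<alpha> \<Gamma>0 \<Gamma>2 \<xi>"
  have \<kappa>: "\<kappa> > 0" using neg by (simp add: \<kappa>_def)
  \<comment> \<open>Half of the limit sqrt(\<kappa> / \<beta>) of the amplitude.\<close>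
  define \<epsilon> where "\<epsilon> = sqrt (\<kappa> / (4 * \<beta>))"
  have \<epsilon>: "\<epsilon> > 0" using \<kappa> \<beta> by (simp add: \<epsilon>_def)
  show ?thesis
  proof (intro exI[of _ \<epsilon>] conjI allI impI \<epsilon>)
    fix \<delta> :: real assume \<delta>: "\<delta> > 0"
    define \<rho> where "\<rho> = 1 + norm \<xi> powr s"
    have \<rho>: "\<rho> > 0" unfolding \<rho>_def using powr_ge_zero[of "norm \<xi>" s] by linarith
    \<comment> \<open>Makes sqrt(\<kappa> / D) equal to \<delta> / \<rho>, which exceeds r(0)
      because \<beta> > 0; \<rho> is the FM^s norm of the wave with amplitude 1.\<close>
    define D where "D = \<kappa> / (\<delta> / \<rho>)\<^sup>2"
    have D: "D > 0" using \<kappa> \<delta> \<rho> by (simp add: D_def)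
    define r where "r t = sqrt \<kappa> / sqrt (\<beta> + D * exp (- 2 * \<kappa> * t))" for t
    have r0: "0 \<le> r t" for t using \<kappa> \<beta> D by (simp add: r_def add_nonneg_nonneg)
    have rbound: "r t \<le> sqrt \<kappa> / sqrt \<beta>" for t
      unfolding r_def using \<kappa> \<beta> D by (intro divide_left_mono) (auto simp: add_pos_pos)
    have deriv: "(r has_real_derivative - (symb \<alpha> \<Gamma>0 \<Gamma>2 \<xi> * r t) - \<beta> * r t ^ 3) (at t)" for t
      using bernoulli_solution[OF \<kappa> \<beta> D, of t] by (simp add: r_def[abs_def] \<kappa>_def)
    define v where "v t = plane_wave \<xi> c (r t)" for t
    have "r 0 < \<delta> / \<rho>"
    proof -
      have "r 0 < sqrt \<kappa> / sqrt D"
        unfolding r_def using \<kappa> \<beta> D by (intro divide_strict_left_mono) (auto simp: add_pos_pos)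
      also have "\<dots> = \<delta> / \<rho>" using \<kappa> \<delta> \<rho> by (simp add: D_def real_sqrt_divide)
      finally show ?thesis .
    qed
    then have small: "FMs_norm s (v 0) < \<delta>"
      using \<rho> r0[of 0] by (simp add: v_def FMs_norm_plane_wave \<xi> \<rho>_def[symmetric] pos_less_divide_eq)
    have "\<not> (\<exists>u. strong_sol (FMs s \<inter> FM0_sigma) (FMs_norm s) \<alpha> \<Gamma>0 \<Gamma>2 \<beta> lam0 \<infinity> (v 0) u \<and> (\<forall>t\<ge>0. FMs_norm s (u t) < \<epsilon>))"
    proof
      assume "\<exists>u. strong_sol (FMs s \<inter> FM0_sigma) (FMs_norm s) \<alpha> \<Gamma>0 \<Gamma>2 \<beta> lam0 \<infinity> (v 0) u \<and> (\<forall>t\<ge>0. FMs_norm s (u t) < \<epsilon>)"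
      then obtain u where sol: "strong_sol (FMs s \<inter> FM0_sigma) (FMs_norm s) \<alpha> \<Gamma>0 \<Gamma>2 \<beta> lam0 \<infinity> (v 0) u"
        and ub: "\<And>t. t \<ge> 0 \<Longrightarrow> FMs_norm s (u t) < \<epsilon>" by blast
      have u0: "u 0 = v 0" using sol by (simp add: strong_sol_def)
      have uS: "u t \<in> FMs s" if "0 \<le> t" for t using sol that by (simp add: strong_sol_def)
      have uc: "((\<lambda>s'. FMs_norm s (\<lambda>x. u s' x - u t x)) \<longlongrightarrow> 0) (at t within {0..})" if "0 \<le> t" for t
        using sol that by (simp add: strong_sol_def atLeast_def)
      have ue: "evol \<alpha> \<Gamma>0 \<Gamma>2 \<beta> lam0 u t" if "0 < t" for t
        using sol that by (simp add: strong_sol_def evol_def)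
      \<comment> \<open>The bound \<epsilon> assumed for the hypothetical solution itself provides
        the gradient bound that uniqueness demands; the second entry bounds the plane wave.\<close>
      define R where "R = max (2 * \<epsilon>) (sqrt \<kappa> / sqrt \<beta> * (1 + norm \<xi>))"
      have uv: "u t = v t" if t: "0 \<le> t" for t
      proof (rule evol_unique[where u = u and v = v and R = R, OF \<Gamma>2 u0 _ _ _ _ ue])
        show "u t \<in> FM" if "0 \<le> t" for t using uS[OF that] FMs_subset_FM by blast
        show "v t \<in> FM" for t unfolding v_def by (rule plane_wave_FM)
        show "((\<lambda>s. FM_norm (\<lambda>x. u s x - u t x)) \<longlongrightarrow> 0) (at t within {0..})" if t: "0 \<le> t" for t
        proof (rule tendsto_sandwich[OF _ _ tendsto_const uc[OF t]])
          show "\<forall>\<^sub>F s in at t within {0..}. 0 \<le> FM_norm (\<lambda>x. u s x - u t x)"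
            unfolding eventually_at_filter using FMs_subset_FM[of s] uS t
            by (intro always_eventually allI impI FM_norm_nonneg FM_diff) auto
          show "\<forall>\<^sub>F s' in at t within {0..}. FM_norm (\<lambda>x. u s' x - u t x) \<le> FMs_norm s (\<lambda>x. u s' x - u t x)"
            unfolding eventually_at_filter using uS t
            by (intro always_eventually allI impI FM_norm_le_FMs_norm FMs_diff) auto
        qed
        show "((\<lambda>s. FM_norm (\<lambda>x. v s x - v t x)) \<longlongrightarrow> 0) (at t within {0..})" for t
        proof -
          have "((\<lambda>s. \<bar>r s - r t\<bar>) \<longlongrightarrow> 0) (at t within {0..})"
            using DERIV_isCont[OF deriv[of t]]
            by (intro tendsto_rabs_zero LIM_zero) (auto simp: isCont_def intro: tendsto_within_subset)
          then show ?thesis by (simp add: v_def plane_wave_lincomb FM_norm_plane_wave \<xi>)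
        qed
        show "evol \<alpha> \<Gamma>0 \<Gamma>2 \<beta> lam0 v t" if "0 < t" for t
          using plane_wave_evol[OF \<xi> deriv] by (simp add: v_def[abs_def])
        show "FMs_norm 1 (u t) \<le> R" if "0 < t" for t
          using FMs_norm_1_le[OF uS s, of t] ub[of t] that by (simp add: R_def)
        show "FMs_norm 1 (v t) \<le> R" for t
          using mult_right_mono[OF rbound[of t], of "1 + norm \<xi>"] r0[of t]
          by (simp add: v_def FMs_norm_plane_wave \<xi> R_def)
      qed (use t in auto)
      \<comment> \<open>From exp x \<ge> x with x = D / (3 \<beta>) the decaying term is at most 3
        \<beta> at this time, so that r(t) has reached sqrt(\<kappa> / (4 \<beta>)).\<close>
      define t where "t = D / (3 * \<beta>) / (2 * \<kappa>)"
      have t: "t \<ge> 0" using D \<beta> \<kappa> by (simp add: t_def)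
      have "D / (3 * \<beta>) \<le> exp (2 * \<kappa> * t)"
      proof -
        have "2 * \<kappa> * t = D / (3 * \<beta>)" using \<kappa> by (simp add: t_def)
        then show ?thesis using exp_ge_add_one_self[of "2 * \<kappa> * t"] by linarith
      qed
      then have "D * exp (- 2 * \<kappa> * t) \<le> 3 * \<beta>"
        using \<beta> by (simp add: exp_minus field_simps)
      then have "sqrt (\<beta> + D * exp (- 2 * \<kappa> * t)) \<le> sqrt (4 * \<beta>)" by simp
      then have "sqrt \<kappa> / sqrt (4 * \<beta>) \<le> r t"
        unfolding r_def using \<kappa> \<beta> D by (intro divide_left_mono) (auto simp: add_pos_pos)
      then have "\<epsilon> \<le> FM_norm (u t)"
        using r0[of t] by (simp add: uv[OF t] v_def FM_norm_plane_wave \<xi> \<epsilon>_def real_sqrt_divide)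
      also have "\<dots> \<le> FMs_norm s (u t)" by (rule FM_norm_le_FMs_norm[OF uS[OF t]])
      finally show False using ub[OF t] by simp
    qed
    moreover have "v 0 \<in> FMs s \<inter> FM0_sigma"
      unfolding v_def using plane_wave_FMs plane_wave_FM0_sigma[OF \<xi>(1,2)] by blast
    ultimately show "\<exists>u0 \<in> FMs s \<inter> (FM0_sigma :: 'n vfield set). FMs_norm s u0 < \<delta> \<and>
         \<not> (\<exists>u. strong_sol (FMs s \<inter> FM0_sigma) (FMs_norm s) \<alpha> \<Gamma>0 \<Gamma>2 \<beta> lam0 \<infinity> u0 u \<and> (\<forall>t\<ge>0. FMs_norm s (u t) < \<epsilon>))"
      using small by blast
  qed
qed

text \<open>A strictly positive \<rho> is required because \<open>FM0\<close> excludes the frequency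
  0; for \<Gamma>0 \<ge> 0 the negativity of the symbol at 0 has to be carried over to small
  frequencies.\<close>

lemma unstable_frequency:
  fixes \<Gamma>0 \<Gamma>2 \<alpha> :: real
  assumes \<Gamma>2: "\<Gamma>2 > 0" and c: "(\<Gamma>0 < 0 \<and> 4 * \<alpha> < \<Gamma>0\<^sup>2 / \<Gamma>2) \<or> (\<Gamma>0 \<ge> 0 \<and> \<alpha> < 0)"
  shows "\<exists>\<rho>>0. \<alpha> + \<Gamma>0 * \<rho> ^ 2 + \<Gamma>2 * \<rho> ^ 4 < 0"
  using c
proof
  assume h: "\<Gamma>0 < 0 \<and> 4 * \<alpha> < \<Gamma>0\<^sup>2 / \<Gamma>2"
  \<comment> \<open>The vertex of the parabola in \<rho>^2, where the value is \<alpha> -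
    \<Gamma>0^2 / (4 \<Gamma>2).\<close>
  define \<rho> where "\<rho> = sqrt (- \<Gamma>0 / (2 * \<Gamma>2))"
  have p: "0 < - \<Gamma>0 / (2 * \<Gamma>2)" using h \<Gamma>2 by (simp add: divide_neg_pos)
  then have "\<rho> > 0" and 2: "\<rho> ^ 2 = - \<Gamma>0 / (2 * \<Gamma>2)" by (simp_all add: \<rho>_def)
  have 4: "\<rho> ^ 4 = (- \<Gamma>0 / (2 * \<Gamma>2)) ^ 2" unfolding 2[symmetric] by (simp flip: power_mult)
  have "\<alpha> + \<Gamma>0 * \<rho> ^ 2 + \<Gamma>2 * \<rho> ^ 4 = \<alpha> - \<Gamma>0\<^sup>2 / \<Gamma>2 / 4"
    unfolding 2 4 using \<Gamma>2 by (simp add: power2_eq_square field_simps)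
  with h \<open>\<rho> > 0\<close> show ?thesis by (intro exI[of _ \<rho>]) simp
next
  assume h: "\<Gamma>0 \<ge> 0 \<and> \<alpha> < 0"
  \<comment> \<open>\<open>x\<close> stands for \<rho>^2; x \<le> 1 gives x^2 \<le> x, so the two
    nonnegative terms together cost at most - \<alpha> / 2.\<close>
  define x where "x = min 1 (- \<alpha> / (2 * (\<Gamma>0 + \<Gamma>2)))"
  have x: "0 < x" "x \<le> 1" using h \<Gamma>2 by (auto simp: x_def divide_neg_pos)
  have "(\<Gamma>0 + \<Gamma>2) * x \<le> (\<Gamma>0 + \<Gamma>2) * (- \<alpha> / (2 * (\<Gamma>0 + \<Gamma>2)))"
    using h \<Gamma>2 by (intro mult_left_mono) (auto simp: x_def)
  also have "\<dots> = - \<alpha> / 2" using h \<Gamma>2 by (simp add: field_simps)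
  finally have 1: "(\<Gamma>0 + \<Gamma>2) * x \<le> - \<alpha> / 2" .
  have "x * x \<le> x" using x by (simp add: mult_left_le)
  then have "\<Gamma>2 * (x * x) \<le> \<Gamma>2 * x" using \<Gamma>2 by simp
  then have "\<alpha> + \<Gamma>0 * x + \<Gamma>2 * (x * x) < 0" using 1 h by (simp add: distrib_right)
  moreover have "(sqrt x) ^ 4 = x * x" using x by (simp add: power4_eq_xxxx)
  ultimately show ?thesis using x by (intro exI[of _ "sqrt x"]) simp
qed

theorem instability:
  fixes \<alpha> \<Gamma>0 \<Gamma>2 \<beta> lam0 :: real
  assumes card: "2 \<le> CARD('n::finite)" and \<Gamma>2: "\<Gamma>2 > 0" and \<beta>: "\<beta> > 0"
    and c: "(\<Gamma>0 < 0 \<and> 4 * \<alpha> < \<Gamma>0\<^sup>2 / \<Gamma>2) \<or> (\<Gamma>0 \<ge> 0 \<and> \<alpha> < 0)" and s: "1 \<le> s"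
  shows "\<exists>\<epsilon>>0. \<forall>\<delta>>0. \<exists>u0 \<in> FMs s \<inter> (FM0_sigma :: 'n vfield set). FMs_norm s u0 < \<delta> \<and>
         \<not> (\<exists>u. strong_sol (FMs s \<inter> FM0_sigma) (FMs_norm s) \<alpha> \<Gamma>0 \<Gamma>2 \<beta> lam0 \<infinity> u0 u \<and>
                 (\<forall>t\<ge>0. FMs_norm s (u t) < \<epsilon>))"
proof -
  \<comment> \<open>Two different axes provide a frequency and an amplitude orthogonal to it; this
    is where the dimension has to be at least 2.\<close>
  obtain i j :: 'n where ij: "i \<noteq> j"
    using card by (metis (full_types) One_nat_def UNIV_I card_1_singletonE card_le_Suc0_iff_eq finite not_less_eq_eq numeral_2_eq_2)
  obtain \<rho> where \<rho>: "\<rho> > 0" "\<alpha> + \<Gamma>0 * \<rho> ^ 2 + \<Gamma>2 * \<rho> ^ 4 < 0" using unstable_frequency[OF \<Gamma>2 c] by blast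
  show ?thesis
  proof (rule plane_wave_instability[OF \<Gamma>2 \<beta> _ _ _ _ s])
    show "\<rho> *\<^sub>R (axis i 1 :: real^'n) \<noteq> 0" using \<rho> by simp
    show "cdot (\<rho> *\<^sub>R (axis i 1 :: real^'n)) (axis j 1) = 0"
      using ij by (auto simp: cdot_def axis_def intro!: sum.neutral)
    show "norm (axis j 1 :: complex^'n) = 1" by (simp add: norm_eq_sqrt_inner inner_axis_axis)
    show "symb \<alpha> \<Gamma>0 \<Gamma>2 (\<rho> *\<^sub>R (axis i 1 :: real^'n)) < 0" using \<rho> by (simp add: symb_def)
  qed
qed

section \<open>Splitting independent sequences of frequencies\<close>

text \<open>Splitting by parity hands each of two subtrees a full infinite sequence with the same
  law, however large the subtrees are, so the positions of leaves require no bookkeeping.\<close>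

definition evs :: "(nat \<Rightarrow> 'a) \<Rightarrow> nat \<Rightarrow> 'a" where "evs \<omega> = (\<lambda>n. \<omega> (2 * n))"
definition ods :: "(nat \<Rightarrow> 'a) \<Rightarrow> nat \<Rightarrow> 'a" where "ods \<omega> = (\<lambda>n. \<omega> (2 * n + 1))"

lemma evs_measurable[measurable]: "evs \<in> measurable (PiM UNIV (\<lambda>_::nat. \<nu>)) (PiM UNIV (\<lambda>_::nat. \<nu>))"
  unfolding evs_def by (rule measurable_PiM_single') (auto simp: space_PiM PiE_def)

lemma ods_measurable[measurable]: "ods \<in> measurable (PiM UNIV (\<lambda>_::nat. \<nu>)) (PiM UNIV (\<lambda>_::nat. \<nu>))"
  unfolding ods_def by (rule measurable_PiM_single') (auto simp: space_PiM PiE_def)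

lemma
  assumes "prob_space \<nu>"
  defines "P \<equiv> PiM UNIV (\<lambda>_::nat. \<nu>)"
  shows distr_evs: "distr P P evs = P" and distr_ods: "distr P P ods = P"
  using distr_PiM_reindex[of UNIV "\<lambda>_::nat. \<nu>" "\<lambda>n::nat. 2 * n" UNIV]
    distr_PiM_reindex[of UNIV "\<lambda>_::nat. \<nu>" "\<lambda>n::nat. 2 * n + 1" UNIV] assms
  by (auto simp: evs_def[abs_def] ods_def[abs_def] inj_on_def restrict_def)

text \<open>The even and the odd subsequence are functions of disjoint families of independent
  coordinates, hence independent, and each is a reindexing of the original product.\<close>

lemma distr_split_sequence:
  assumes \<nu>: "prob_space \<nu>"
  defines "P \<equiv> PiM UNIV (\<lambda>_::nat. \<nu>)"
  shows "distr P (P \<Otimes>\<^sub>M P) (\<lambda>\<omega>. (evs \<omega>, ods \<omega>)) = P \<Otimes>\<^sub>M P"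
proof -
  interpret P: product_prob_space "\<lambda>_::nat. \<nu>" UNIV
    using \<nu> by (intro product_prob_spaceI)
  interpret PP: prob_space P unfolding P_def by (rule P.prob_space_axioms)
  have [measurable]: "evs \<in> measurable P P" "ods \<in> measurable P P" unfolding P_def by measurable
  have coord: "PP.indep_vars (\<lambda>_. \<nu>) (\<lambda>i \<omega>. \<omega> i) (UNIV::nat set)"
  proof (subst PP.indep_vars_iff_distr_eq_PiM)
    show "PP.random_variable \<nu> (\<lambda>\<omega>. \<omega> i)" for i unfolding P_def by measurable
    have "distr P (PiM UNIV (\<lambda>_. \<nu>)) (\<lambda>x. \<lambda>i\<in>UNIV. x i) = P"
      unfolding P_def restrict_UNIV by (rule distr_id)
    also have "P = PiM UNIV (\<lambda>i. distr P \<nu> (\<lambda>\<omega>. \<omega> i))"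
      unfolding P_def by (simp add: P.PiM_component)
    finally show "distr P (PiM UNIV (\<lambda>_. \<nu>)) (\<lambda>x. \<lambda>i\<in>UNIV. x i) = PiM UNIV (\<lambda>i. distr P \<nu> (\<lambda>\<omega>. \<omega> i))" .
  qed simp
  define K where "K b = (if b then {n::nat. even n} else {n. odd n})" for b
  have "PP.indep_vars (\<lambda>b. PiM (K b) (\<lambda>_. \<nu>)) (\<lambda>b \<omega>. restrict (\<lambda>i. \<omega> i) (K b)) (UNIV::bool set)"
    by (rule PP.indep_vars_restrict[OF coord]) (auto simp: disjoint_family_on_def K_def)
  \<comment> \<open>The restrictions to even and odd coordinates live on different index sets;
    renumbering brings both to the same space of sequences.\<close>
  then have "PP.indep_vars (\<lambda>_. P) (\<lambda>b \<omega>. (\<lambda>n. restrict (\<lambda>i. \<omega> i) (K b) (if b then 2 * n else 2 * n + 1))) (UNIV::bool set)"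
  proof (rule PP.indep_vars_compose2)
    fix b :: bool
    show "(\<lambda>x n. x (if b then 2 * n else 2 * n + 1)) \<in> measurable (PiM (K b) (\<lambda>_. \<nu>)) P"
      unfolding P_def
      by (rule measurable_PiM_single') (auto simp: space_PiM PiE_def K_def intro!: measurable_component_singleton)
  qed
  then have indep: "PP.indep_vars (\<lambda>_. P) (\<lambda>b. if b then evs else ods) (UNIV::bool set)"
    by (rule PP.indep_vars_cong[THEN iffD1, rotated -1]) (auto simp: evs_def ods_def K_def)
  have "P \<Otimes>\<^sub>M P = distr P (P \<Otimes>\<^sub>M P) (\<lambda>\<omega>. (evs \<omega>, ods \<omega>))"
  proof (rule pair_measure_eqI)
    show "sigma_finite_measure P" "sigma_finite_measure P" by unfold_locales
    show "sets (P \<Otimes>\<^sub>M P) = sets (distr P (P \<Otimes>\<^sub>M P) (\<lambda>\<omega>. (evs \<omega>, ods \<omega>)))" by simp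
    fix A B assume A[measurable]: "A \<in> sets P" and B[measurable]: "B \<in> sets P"
    have "emeasure (distr P (P \<Otimes>\<^sub>M P) (\<lambda>\<omega>. (evs \<omega>, ods \<omega>))) (A \<times> B) = emeasure P ((\<lambda>\<omega>. (evs \<omega>, ods \<omega>)) -` (A \<times> B) \<inter> space P)"
      by (rule emeasure_distr) measurable
    also have "(\<lambda>\<omega>. (evs \<omega>, ods \<omega>)) -` (A \<times> B) \<inter> space P = (\<Inter>b\<in>UNIV. (if b then evs else ods) -` (if b then A else B) \<inter> space P)"
      by (auto split: if_splits)
    also have "emeasure P \<dots> = ennreal (\<Prod>b\<in>UNIV. PP.prob ((if b then evs else ods) -` (if b then A else B) \<inter> space P))"
      unfolding PP.emeasure_eq_measure
      by (subst PP.indep_varsD[OF indep]) auto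
    also have "\<dots> = emeasure P (evs -` A \<inter> space P) * emeasure P (ods -` B \<inter> space P)"
      by (simp add: UNIV_bool PP.emeasure_eq_measure ennreal_mult mult.commute)
    also have "emeasure P (evs -` A \<inter> space P) = emeasure P A"
      by (subst emeasure_distr[symmetric, of evs P P]) (simp_all add: distr_evs[OF \<nu>, folded P_def])
    also have "emeasure P (ods -` B \<inter> space P) = emeasure P B"
      by (subst emeasure_distr[symmetric, of ods P P]) (simp_all add: distr_ods[OF \<nu>, folded P_def])
    finally show "emeasure P A * emeasure P B = emeasure (distr P (P \<Otimes>\<^sub>M P) (\<lambda>\<omega>. (evs \<omega>, ods \<omega>))) (A \<times> B)" by simp
  qed
  then show ?thesis by simp
qed

text \<open>Indexing the terms of a series by an arbitrary countable type \<open>'s\<close>: a term lives on the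
  sequence space, and multiplying terms \<open>a\<close> and \<open>b\<close> gives a term indexed by \<open>c (a, b)\<close>, with the
  even and odd parts of the sequence feeding the two factors.\<close>

definition idx :: "'x measure \<Rightarrow> ('s::countable \<times> (nat \<Rightarrow> 'x)) measure" where
  "idx \<nu> = count_space UNIV \<Otimes>\<^sub>M PiM UNIV (\<lambda>_::nat. \<nu>)"

definition splt :: "('a \<times> 'b \<Rightarrow> 's) \<Rightarrow> 's \<times> (nat \<Rightarrow> 'x) \<Rightarrow> ('a \<times> (nat \<Rightarrow> 'x)) \<times> ('b \<times> (nat \<Rightarrow> 'x))" where
  "splt c p = ((fst (inv c (fst p)), evs (snd p)), (snd (inv c (fst p)), ods (snd p)))"

lemma sigma_finite_idx: "prob_space \<nu> \<Longrightarrow> sigma_finite_measure (idx \<nu>)"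
  unfolding idx_def
  by (intro sigma_finite_pair_measure sigma_finite_measure_count_space prob_space_imp_sigma_finite prob_space_PiM)

lemma measurable_idx:
  "(\<And>a. (\<lambda>\<omega>. f (a, \<omega>)) \<in> measurable (PiM UNIV (\<lambda>_::nat. \<nu>)) K) \<Longrightarrow> f \<in> measurable (idx \<nu>) K"
  unfolding idx_def by (rule measurable_pair_measure_countable1) auto

lemma nn_integral_idx:
  assumes "prob_space \<nu>" and [measurable]: "f \<in> borel_measurable (idx \<nu>)"
  shows "(\<integral>\<^sup>+p. f p \<partial>idx \<nu>) = (\<integral>\<^sup>+a. \<integral>\<^sup>+\<omega>. f (a, \<omega>) \<partial>PiM UNIV (\<lambda>_::nat. \<nu>) \<partial>count_space UNIV)"
proof -
  interpret sigma_finite_measure "PiM UNIV (\<lambda>_::nat. \<nu>)"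
    using assms by (intro prob_space_imp_sigma_finite prob_space_PiM)
  show ?thesis using nn_integral_fst[of f "count_space UNIV"] assms(2) unfolding idx_def by simp
qed

lemma splt_measurable: "splt c \<in> measurable (idx \<nu>) (idx \<nu> \<Otimes>\<^sub>M idx \<nu>)"
proof (rule measurable_idx)
  fix a
  show "(\<lambda>\<omega>. splt c (a, \<omega>)) \<in> measurable (PiM UNIV (\<lambda>_. \<nu>)) (idx \<nu> \<Otimes>\<^sub>M idx \<nu>)"
    unfolding splt_def idx_def by simp
qed

lemma nn_integral_count_space_range:
  fixes c :: "'a \<Rightarrow> 's"
  assumes "inj c" and "\<And>s. s \<notin> range c \<Longrightarrow> f s = 0"
  shows "(\<integral>\<^sup>+s. f s \<partial>count_space UNIV) = (\<integral>\<^sup>+a. f (c a) \<partial>count_space UNIV)"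
proof -
  have "(\<integral>\<^sup>+a. f (c a) \<partial>count_space UNIV) = (\<integral>\<^sup>+s. f s \<partial>count_space (range c))"
    by (rule nn_integral_bij_count_space) (use assms(1) in \<open>simp add: bij_betw_def\<close>)
  also have "\<dots> = (\<integral>\<^sup>+s. f s * indicator (range c) s \<partial>count_space UNIV)"
    by (subst nn_integral_count_space_indicator) auto
  also have "\<dots> = (\<integral>\<^sup>+s. f s \<partial>count_space UNIV)"
    by (intro nn_integral_cong) (use assms(2) in \<open>auto split: split_indicator\<close>)
  finally show ?thesis by simp
qed

text \<open>The key to multiplying series: on the labels hit by \<open>c\<close>,
  \<open>splt\<close> identifies one copy of the index space with a product of two. Injectivity
  matches the counting measures, \<open>distr_split_sequence\<close> the sequence parts; the density
  discards the remaining labels.\<close>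

lemma distr_splt:
  fixes c :: "'a::countable \<times> 'b::countable \<Rightarrow> 's::countable" and \<nu> :: "'x measure"
  assumes \<nu>: "prob_space \<nu>" and c: "inj c"
  shows "distr (density (idx \<nu>) (\<lambda>p. indicator (range c) (fst p))) (idx \<nu> \<Otimes>\<^sub>M idx \<nu>) (splt c) = idx \<nu> \<Otimes>\<^sub>M idx \<nu>"
proof -
  define P where "P = PiM UNIV (\<lambda>_::nat. \<nu>)"
  interpret P: prob_space P unfolding P_def using \<nu> by (intro prob_space_PiM)
  let ?D = "density (idx \<nu>) (\<lambda>p. indicator (range c) (fst p)) :: ('s \<times> (nat \<Rightarrow> _)) measure"
  have [measurable]: "evs \<in> measurable P P" "ods \<in> measurable P P" unfolding P_def by measurable
  have ind: "(\<lambda>p. indicator (range c) (fst p) :: ennreal) \<in> borel_measurable (idx \<nu>)"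
    by (rule measurable_idx) simp
  note sm[measurable] = splt_measurable[of c \<nu>]
  have "idx \<nu> \<Otimes>\<^sub>M idx \<nu> = distr ?D (idx \<nu> \<Otimes>\<^sub>M idx \<nu>) (splt c)"
  proof (rule pair_measure_eqI)
    show "sigma_finite_measure (idx \<nu> :: ('a \<times> _) measure)" "sigma_finite_measure (idx \<nu> :: ('b \<times> _) measure)"
      by (rule sigma_finite_idx[OF \<nu>])+
    fix A :: "('a \<times> _) set" and B :: "('b \<times> _) set" assume A[measurable]: "A \<in> sets (idx \<nu>)" and B[measurable]: "B \<in> sets (idx \<nu>)"
    have em: "emeasure (idx \<nu>) C = (\<integral>\<^sup>+a. emeasure P {\<omega> \<in> space P. (a, \<omega>) \<in> C} \<partial>count_space UNIV)"
      if C[measurable]: "C \<in> sets (idx \<nu>)" for C :: "('k::countable \<times> (nat \<Rightarrow> 'x)) set"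
    proof -
      have "emeasure (idx \<nu>) C = (\<integral>\<^sup>+p. indicator C p \<partial>idx \<nu>)" by simp
      also have "\<dots> = (\<integral>\<^sup>+a. \<integral>\<^sup>+\<omega>. indicator C (a, \<omega>) \<partial>P \<partial>count_space UNIV)"
        unfolding P_def by (rule nn_integral_idx[OF \<nu>]) simp
      also have "\<dots> = (\<integral>\<^sup>+a. emeasure P {\<omega> \<in> space P. (a, \<omega>) \<in> C} \<partial>count_space UNIV)"
      proof (rule nn_integral_cong)
        fix a :: 'k
        have "(\<lambda>\<omega>. (a, \<omega>)) \<in> measurable P (idx \<nu>)" unfolding idx_def P_def by simp
        from measurable_sets[OF this C] have m: "{\<omega> \<in> space P. (a, \<omega>) \<in> C} \<in> sets P"
          by (simp add: vimage_def Int_def conj_commute)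
        have "(\<integral>\<^sup>+\<omega>. indicator C (a, \<omega>) \<partial>P) = (\<integral>\<^sup>+\<omega>. indicator {\<omega> \<in> space P. (a, \<omega>) \<in> C} \<omega> \<partial>P)"
          by (intro nn_integral_cong) (auto split: split_indicator)
        also have "\<dots> = emeasure P {\<omega> \<in> space P. (a, \<omega>) \<in> C}"
          by (rule nn_integral_indicator[OF m])
        finally show "(\<integral>\<^sup>+\<omega>. indicator C (a, \<omega>) \<partial>P) = emeasure P {\<omega> \<in> space P. (a, \<omega>) \<in> C}" .
      qed
      finally show ?thesis .
    qed
    have sec: "{\<omega> \<in> space P. (a, \<omega>) \<in> C} \<in> sets P" if C: "C \<in> sets (idx \<nu>)" for a and C :: "('k::countable \<times> (nat \<Rightarrow> 'x)) set"
    proof -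
      have "(\<lambda>\<omega>. (a, \<omega>)) \<in> measurable P (idx \<nu>)" unfolding idx_def P_def by simp
      from measurable_sets[OF this C] show ?thesis by (simp add: vimage_def Int_def conj_commute)
    qed
    let ?A = "\<lambda>a. {\<omega> \<in> space P. (a, \<omega>) \<in> A}" and ?B = "\<lambda>b. {\<omega> \<in> space P. (b, \<omega>) \<in> B}"
    have "emeasure (distr ?D (idx \<nu> \<Otimes>\<^sub>M idx \<nu>) (splt c)) (A \<times> B) = emeasure ?D (splt c -` (A \<times> B) \<inter> space ?D)"
      by (rule emeasure_distr) simp_all
    also have "\<dots> = (\<integral>\<^sup>+p. indicator (range c) (fst p) * indicator (splt c -` (A \<times> B) \<inter> space (idx \<nu>)) p \<partial>idx \<nu>)"
      by (subst emeasure_density[OF ind]) simp_all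
    also have "\<dots> = (\<integral>\<^sup>+p. indicator (range c) (fst p) * indicator (A \<times> B) (splt c p) \<partial>idx \<nu>)"
      by (intro nn_integral_cong) (auto split: split_indicator)
    also have "\<dots> = (\<integral>\<^sup>+s. \<integral>\<^sup>+\<omega>. indicator (range c) s * indicator (A \<times> B) (splt c (s, \<omega>)) \<partial>P \<partial>count_space UNIV)"
      unfolding P_def by (subst nn_integral_idx[OF \<nu>]) (use ind in simp_all)
    also have "\<dots> = (\<integral>\<^sup>+z. \<integral>\<^sup>+\<omega>. indicator (range c) (c z) * indicator (A \<times> B) (splt c (c z, \<omega>)) \<partial>P \<partial>count_space UNIV)"
      by (rule nn_integral_count_space_range[OF c]) simp
    also have "\<dots> = (\<integral>\<^sup>+z. emeasure P (?A (fst z)) * emeasure P (?B (snd z)) \<partial>count_space UNIV)"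
    proof (rule nn_integral_cong)
      fix z
      have "(\<integral>\<^sup>+\<omega>. indicator (range c) (c z) * indicator (A \<times> B) (splt c (c z, \<omega>)) \<partial>P)
          = (\<integral>\<^sup>+\<omega>. indicator (?A (fst z) \<times> ?B (snd z)) (evs \<omega>, ods \<omega>) \<partial>P)"
      proof (rule nn_integral_cong)
        fix \<omega> assume \<omega>: "\<omega> \<in> space P"
        have "evs \<omega> \<in> space P" "ods \<omega> \<in> space P"
          using \<omega> measurable_space[of evs P P] measurable_space[of ods P P] by auto
        then show "indicator (range c) (c z) * indicator (A \<times> B) (splt c (c z, \<omega>)) = (indicator (?A (fst z) \<times> ?B (snd z)) (evs \<omega>, ods \<omega>) :: ennreal)"
          using c by (auto simp: splt_def split: split_indicator)
      qed
      also have "\<dots> = (\<integral>\<^sup>+y. indicator (?A (fst z) \<times> ?B (snd z)) y \<partial>distr P (P \<Otimes>\<^sub>M P) (\<lambda>\<omega>. (evs \<omega>, ods \<omega>)))"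
        using sec[OF A] sec[OF B] by (subst nn_integral_distr) auto
      also have "\<dots> = emeasure (P \<Otimes>\<^sub>M P) (?A (fst z) \<times> ?B (snd z))"
        unfolding P_def distr_split_sequence[OF \<nu>] using sec[OF A] sec[OF B] by (simp add: P_def)
      also have "\<dots> = emeasure P (?A (fst z)) * emeasure P (?B (snd z))"
        using sec[OF A] sec[OF B] by (rule P.emeasure_pair_measure_Times)
      finally show "(\<integral>\<^sup>+\<omega>. indicator (range c) (c z) * indicator (A \<times> B) (splt c (c z, \<omega>)) \<partial>P) = emeasure P (?A (fst z)) * emeasure P (?B (snd z))" .
    qed
    also have "\<dots> = (\<integral>\<^sup>+a. \<integral>\<^sup>+b. emeasure P (?A a) * emeasure P (?B b) \<partial>count_space UNIV \<partial>count_space UNIV)"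
      using nn_integral_fst_count_space[of "\<lambda>z. emeasure P (?A (fst z)) * emeasure P (?B (snd z))"] by simp
    also have "\<dots> = emeasure (idx \<nu>) A * emeasure (idx \<nu>) B"
      by (simp add: em nn_integral_cmult nn_integral_multc)
    finally show "emeasure (idx \<nu>) A * emeasure (idx \<nu>) B = emeasure (distr ?D (idx \<nu> \<Otimes>\<^sub>M idx \<nu>) (splt c)) (A \<times> B)" by simp
  qed simp
  then show ?thesis by simp
qed

lemma
  fixes c :: "'a::countable \<times> 'b::countable \<Rightarrow> 's::countable" and F :: "_ \<Rightarrow> 'e::{banach, second_countable_topology}"
  assumes \<nu>: "prob_space \<nu>" and c: "inj c" and F: "integrable (idx \<nu> \<Otimes>\<^sub>M idx \<nu>) F"
  defines "F' \<equiv> (\<lambda>p. if fst p \<in> range c then F (splt c p) else 0)"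
  shows integrable_splt: "integrable (idx \<nu>) F'"
    and integral_splt: "(\<integral>p. F' p \<partial>idx \<nu>) = (\<integral>z. F z \<partial>(idx \<nu> \<Otimes>\<^sub>M idx \<nu>))"
proof -
  let ?D = "density (idx \<nu>) (\<lambda>p. ennreal (indicator (range c) (fst p))) :: ('s \<times> (nat \<Rightarrow> _)) measure"
  have ind: "(\<lambda>p. indicator (range c) (fst p) :: real) \<in> borel_measurable (idx \<nu>)"
    by (rule measurable_idx) simp
  note sm[measurable] = splt_measurable[of c \<nu>]
  have d: "distr ?D (idx \<nu> \<Otimes>\<^sub>M idx \<nu>) (splt c) = idx \<nu> \<Otimes>\<^sub>M idx \<nu>"
    using distr_splt[OF \<nu> c] by (simp add: ennreal_indicator)
  have Fm[measurable]: "F \<in> borel_measurable (idx \<nu> \<Otimes>\<^sub>M idx \<nu>)" using F by simp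
  have e: "F' p = indicator (range c) (fst p) *\<^sub>R F (splt c p)" for p by (simp add: F'_def)
  have "integrable ?D (\<lambda>p. F (splt c p))"
    using F integrable_distr_eq[of "splt c" ?D "idx \<nu> \<Otimes>\<^sub>M idx \<nu>" F] by (simp add: d)
  then show "integrable (idx \<nu>) F'"
    unfolding e by (subst (asm) integrable_density) (use ind in auto)
  have "(\<integral>z. F z \<partial>(idx \<nu> \<Otimes>\<^sub>M idx \<nu>)) = (\<integral>p. F (splt c p) \<partial>?D)"
    using integral_distr[of "splt c" ?D "idx \<nu> \<Otimes>\<^sub>M idx \<nu>" F] by (simp add: d)
  also have "\<dots> = (\<integral>p. F' p \<partial>idx \<nu>)"
    unfolding e by (subst integral_density) (use ind in auto)
  finally show "(\<integral>p. F' p \<partial>idx \<nu>) = (\<integral>z. F z \<partial>(idx \<nu> \<Otimes>\<^sub>M idx \<nu>))" by simp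
qed

lemma
  fixes c :: "'a::countable \<times> 'b::countable \<Rightarrow> 's::countable" and H :: "_ \<Rightarrow> complex^'n"
  assumes \<nu>: "prob_space \<nu>" and c: "inj c" and Y: "Y \<in> borel_measurable (idx \<nu> \<Otimes>\<^sub>M idx \<nu>)"
    and H: "integrable (idx \<nu> \<Otimes>\<^sub>M idx \<nu>) H"
    and Y': "\<And>p. fst p \<in> range c \<Longrightarrow> Y' p = Y (splt c p)"
    and H': "\<And>p. fst p \<in> range c \<Longrightarrow> H' p = H (splt c p)" and H0: "\<And>p. fst p \<notin> range c \<Longrightarrow> H' p = 0"
  shows integrable_lift_splt: "integrable (idx \<nu>) H'"
    and lift_splt: "lift (idx \<nu> \<Otimes>\<^sub>M idx \<nu>) Y H = lift (idx \<nu>) Y' H'"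
proof -
  have e: "H' = (\<lambda>p. if fst p \<in> range c then H (splt c p) else 0)" using H' H0 by auto
  show "integrable (idx \<nu>) H'" unfolding e by (rule integrable_splt[OF \<nu> c H])
  have "lift (idx \<nu> \<Otimes>\<^sub>M idx \<nu>) Y H x = lift (idx \<nu>) Y' H' x" for x
    unfolding lift_def integral_splt[OF \<nu> c integrable_lift[OF Y H], symmetric]
    by (intro Bochner_Integration.integral_cong) (auto simp: H' H0 Y')
  then show "lift (idx \<nu> \<Otimes>\<^sub>M idx \<nu>) Y H = lift (idx \<nu>) Y' H'" by auto
qed

text \<open>A triple product is split twice, the second time with the identity as pairing of labels;
  accordingly the three factors read the coordinates through \<open>evs\<close>, through
  \<open>evs\<close> after \<open>ods\<close>, and through \<open>ods\<close> after
  \<open>ods\<close>.\<close>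

lemma
  fixes c :: "'a::countable \<times> 'b::countable \<times> 'd::countable \<Rightarrow> 's::countable" and H :: "_ \<Rightarrow> complex^'n"
  assumes \<nu>: "prob_space \<nu>" and c: "inj c" and Y[measurable]: "Y \<in> borel_measurable (idx \<nu> \<Otimes>\<^sub>M (idx \<nu> \<Otimes>\<^sub>M idx \<nu>))"
    and H: "integrable (idx \<nu> \<Otimes>\<^sub>M (idx \<nu> \<Otimes>\<^sub>M idx \<nu>)) H"
    and Y': "\<And>p q r. fst p \<in> range c \<Longrightarrow> splt c p = (q, r) \<Longrightarrow> Y' p = Y (q, splt (\<lambda>z. z) r)"
    and H': "\<And>p q r. fst p \<in> range c \<Longrightarrow> splt c p = (q, r) \<Longrightarrow> H' p = H (q, splt (\<lambda>z. z) r)"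
    and H0: "\<And>p. fst p \<notin> range c \<Longrightarrow> H' p = 0"
  shows integrable_lift_splt3: "integrable (idx \<nu>) H'"
    and lift_splt3: "lift (idx \<nu> \<Otimes>\<^sub>M (idx \<nu> \<Otimes>\<^sub>M idx \<nu>)) Y H = lift (idx \<nu>) Y' H'"
proof -
  let ?I = "idx \<nu> \<Otimes>\<^sub>M idx \<nu> :: (('b \<times> _) \<times> ('d \<times> _)) measure"
  let ?J = "idx \<nu> :: (('b \<times> 'd) \<times> _) measure"
  let ?A = "idx \<nu> :: ('a \<times> _) measure"
  note sm[measurable] = splt_measurable[of "\<lambda>z :: 'b \<times> 'd. z" \<nu>]
  have "distr ?J ?I (splt (\<lambda>z. z)) = ?I"
    using distr_splt[OF \<nu>, of "\<lambda>z :: 'b \<times> 'd. z"] by (simp add: density_1)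
  moreover have "sigma_finite_measure ?I" by (intro sigma_finite_pair_measure sigma_finite_idx \<nu>)
  ultimately have d: "distr (?A \<Otimes>\<^sub>M ?J) (?A \<Otimes>\<^sub>M ?I) (\<lambda>(p, r). (p, splt (\<lambda>z. z) r)) = ?A \<Otimes>\<^sub>M ?I"
    using pair_measure_distr[of "\<lambda>p. p" ?A ?A "splt (\<lambda>z. z)" ?J ?I] by simp
  let ?f = "\<lambda>(p, r). (p, splt (\<lambda>z. z) r) :: ('a \<times> _) \<times> ('b \<times> _) \<times> ('d \<times> _)"
  have fm[measurable]: "?f \<in> measurable (?A \<Otimes>\<^sub>M ?J) (?A \<Otimes>\<^sub>M ?I)" by measurable
  have H2: "integrable (?A \<Otimes>\<^sub>M ?J) (\<lambda>z. H (?f z))"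
    using H integrable_distr_eq[OF fm, of H] by (simp add: d)
  have Y2: "(\<lambda>z. Y (?f z)) \<in> borel_measurable (?A \<Otimes>\<^sub>M ?J)" by measurable
  have l: "lift (?A \<Otimes>\<^sub>M ?I) Y H = lift (?A \<Otimes>\<^sub>M ?J) (\<lambda>z. Y (?f z)) (\<lambda>z. H (?f z))"
  proof
    fix x
    have "(\<lambda>z. cis (- (x \<bullet> Y z)) *s H z) \<in> borel_measurable (?A \<Otimes>\<^sub>M ?I)"
      using integrable_lift[OF Y H] by simp
    from integral_distr[OF fm this] show "lift (?A \<Otimes>\<^sub>M ?I) Y H x = lift (?A \<Otimes>\<^sub>M ?J) (\<lambda>z. Y (?f z)) (\<lambda>z. H (?f z)) x"
      by (simp add: lift_def d)
  qed
  have Y'': "Y' p = Y (?f (splt c p))" if "fst p \<in> range c" for p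
    using Y'[OF that, of "fst (splt c p)" "snd (splt c p)"] by (simp add: case_prod_beta)
  have H'': "H' p = H (?f (splt c p))" if "fst p \<in> range c" for p
    using H'[OF that, of "fst (splt c p)" "snd (splt c p)"] by (simp add: case_prod_beta)
  show "integrable (idx \<nu>) H'" by (rule integrable_lift_splt[OF \<nu> c Y2 H2 Y'' H'' H0])
  show "lift (?A \<Otimes>\<^sub>M ?I) Y H = lift (idx \<nu>) Y' H'"
    unfolding l by (rule lift_splt[OF \<nu> c Y2 H2 Y'' H'' H0])
qed

section \<open>The tree expansion and stability\<close>

text \<open>A Lebesgue integral over the line with an indicator, rather than an integral over an
  interval: in this form \<open>t\<close> is an ordinary parameter, and joint measurability in time
  and frequencies follows as for any parameter integral.\<close>

definition duhamel :: "real \<Rightarrow> (real \<Rightarrow> complex^'n) \<Rightarrow> real \<Rightarrow> complex^'n" where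
  "duhamel a f t = (\<integral>s. indicator {0..t} s *\<^sub>R (exp (- a * (t - s)) *\<^sub>R f s) \<partial>lborel)"

lemma duhamel_eq:
  assumes f: "continuous_on {0..} f" and t: "0 \<le> t"
  shows "duhamel a f t = exp (- a * t) *\<^sub>R integral {0..t} (\<lambda>s. exp (a * s) *\<^sub>R f s)"
proof -
  have c: "continuous_on {0..t} (\<lambda>s. exp (a * s) *\<^sub>R f s)"
    by (intro continuous_intros continuous_on_subset[OF f]) auto
  have "duhamel a f t = (\<integral>s. exp (- a * t) *\<^sub>R (indicator {0..t} s *\<^sub>R (exp (a * s) *\<^sub>R f s)) \<partial>lborel)"
    unfolding duhamel_def
    by (intro Bochner_Integration.integral_cong) (auto simp: algebra_simps simp flip: exp_add)
  also have "\<dots> = exp (- a * t) *\<^sub>R (\<integral>s. indicator {0..t} s *\<^sub>R (exp (a * s) *\<^sub>R f s) \<partial>lborel)"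
    by (rule integral_scaleR_right)
  also have "(\<integral>s. indicator {0..t} s *\<^sub>R (exp (a * s) *\<^sub>R f s) \<partial>lborel) = integral {0..t} (\<lambda>s. exp (a * s) *\<^sub>R f s)"
    using set_borel_integral_eq_integral(2)[OF borel_integrable_atLeastAtMost'[OF c]] by (simp add: set_lebesgue_integral_def)
  finally show ?thesis .
qed

lemma duhamel_deriv:
  assumes f: "continuous_on {0..} f" and t: "0 \<le> t"
  shows "(duhamel a f has_vector_derivative f t - a *\<^sub>R duhamel a f t) (at t within {0..})"
proof -
  \<comment> \<open>An end point beyond \<open>t\<close> makes the derivative within the interval
    agree with the one within \<open>{0..}\<close>: two-sided for t > 0, one-sided at 0.\<close>
  have c: "continuous_on {0..t+1} (\<lambda>s. exp (a * s) *\<^sub>R f s)"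
    by (intro continuous_intros continuous_on_subset[OF f]) auto
  have "((\<lambda>u. exp (- a * u) *\<^sub>R integral {0..u} (\<lambda>s. exp (a * s) *\<^sub>R f s)) has_vector_derivative
      exp (- a * t) *\<^sub>R (exp (a * t) *\<^sub>R f t) + (- a * exp (- a * t)) *\<^sub>R integral {0..t} (\<lambda>s. exp (a * s) *\<^sub>R f s)) (at t within {0..t+1})"
    by (rule has_vector_derivative_scaleR)
      (use t in \<open>auto intro!: derivative_eq_intros integral_has_vector_derivative[OF c]\<close>)
  also have "exp (- a * t) *\<^sub>R (exp (a * t) *\<^sub>R f t) + (- a * exp (- a * t)) *\<^sub>R integral {0..t} (\<lambda>s. exp (a * s) *\<^sub>R f s)
      = f t - a *\<^sub>R duhamel a f t"
    by (simp add: duhamel_eq[OF f t] flip: exp_add)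
  finally have "(duhamel a f has_vector_derivative f t - a *\<^sub>R duhamel a f t) (at t within {0..t+1})"
    by (rule has_vector_derivative_transform[rotated 2]) (use t in \<open>auto simp: duhamel_eq[OF f]\<close>)
  moreover have "at t within {0..t+1} = at t within {0..}"
    by (rule at_within_nhd[of _ "{..<t+1}"]) auto
  ultimately show ?thesis by simp
qed

lemma duhamel_continuous:
  "continuous_on {0..} f \<Longrightarrow> continuous_on {0..} (duhamel a f)"
  unfolding continuous_on_eq_continuous_within
  using duhamel_deriv has_vector_derivative_continuous
  by (metis atLeast_iff continuous_on_eq_continuous_within)

text \<open>The rate \<open>a\<close> is divided: \<open>c\<close> is the decay retained, and the
  rest \<open>d\<close> is spent on the kernel, since d exp(- d (t - s)) has integral at most 1. A
  force larger than the result by the factor \<open>d\<close> is thus admissible uniformly in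
  \<open>t\<close>, which is how a power of the frequency is regained.\<close>

lemma duhamel_bound:
  assumes f: "continuous_on {0..} f" and t: "0 \<le> t" and d: "0 < d" and a: "c + d \<le> a"
    and B: "\<And>s. 0 \<le> s \<Longrightarrow> s \<le> t \<Longrightarrow> norm (f s) \<le> d * B * exp (- c * s)" and B0: "0 \<le> B"
  shows "norm (duhamel a f t) \<le> B * exp (- c * t)"
proof -
  define h where "h s = d * B * exp (- c * t) * exp (- d * (t - s))" for s
  have c1: "continuous_on {0..t} (\<lambda>s. exp (- a * (t - s)) *\<^sub>R f s)" and c2: "continuous_on {0..t} h"
    unfolding h_def by (intro continuous_intros continuous_on_subset[OF f]; auto)+
  have "duhamel a f t = integral {0..t} (\<lambda>s. exp (- a * (t - s)) *\<^sub>R f s)"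
    using set_borel_integral_eq_integral(2)[OF borel_integrable_atLeastAtMost'[OF c1]] by (simp add: set_lebesgue_integral_def duhamel_def)
  also have "norm \<dots> \<le> integral {0..t} h"
  proof (rule integral_norm_bound_integral)
    fix s assume s: "s \<in> {0..t}"
    have "(c + d) * (t - s) \<le> a * (t - s)" using s a by (intro mult_right_mono) auto
    then have "exp (- a * (t - s)) \<le> exp (- (c + d) * (t - s))"
      by (simp only: exp_le_cancel_iff mult_minus_left neg_le_iff_le)
    then have "exp (- a * (t - s)) * norm (f s) \<le> exp (- (c + d) * (t - s)) * (d * B * exp (- c * s))"
      using s by (intro mult_mono B) simp_all
    then have "norm (exp (- a * (t - s)) *\<^sub>R f s) \<le> exp (- (c + d) * (t - s)) * (d * B * exp (- c * s))" by simp
    also have "\<dots> = h s" by (simp add: h_def mult_ac flip: exp_add) (simp add: algebra_simps)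
    finally show "norm (exp (- a * (t - s)) *\<^sub>R f s) \<le> h s" .
  qed (use c1 c2 in \<open>auto intro: integrable_continuous_interval\<close>)
  also have "integral {0..t} h = B * exp (- c * t) * exp (- d * (t - t)) - B * exp (- c * t) * exp (- d * (t - 0))"
  proof (rule integral_unique, rule fundamental_theorem_of_calculus[OF t])
    show "((\<lambda>s. B * exp (- c * t) * exp (- d * (t - s))) has_vector_derivative h s) (at s within {0..t})" for s
      unfolding has_real_derivative_iff_has_vector_derivative[symmetric] h_def
      by (auto intro!: derivative_eq_intros)
  qed
  also have "\<dots> \<le> B * exp (- c * t)" using B0 by simp
  finally show ?thesis .
qed

lemma duhamel_proj:
  assumes f: "continuous_on {0..} f" and t: "0 \<le> t" and p: "\<And>s. proj \<xi> (f s) = f s"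
  shows "proj \<xi> (duhamel a f t) = duhamel a f t"
proof -
  have c: "continuous_on {0..t} (\<lambda>s. exp (- a * (t - s)) *\<^sub>R f s)"
    by (intro continuous_intros continuous_on_subset[OF f]) auto
  have "integrable lborel (\<lambda>s. indicator {0..t} s *\<^sub>R (exp (- a * (t - s)) *\<^sub>R f s))"
    using borel_integrable_atLeastAtMost'[OF c] by (simp add: set_integrable_def)
  then show ?thesis unfolding duhamel_def
    by (subst integral_bounded_linear[OF bounded_linear_proj, symmetric]) (simp_all add: proj_scaleR p)
qed

text \<open>Stated jointly in time and parameter because \<open>amp\<close> is recursive: the
  measurability of a tree uses that of its subtrees at all earlier times.\<close>

lemma duhamel_measurable:
  fixes a :: "'a \<Rightarrow> real" and f :: "real \<times> 'a \<Rightarrow> complex^'n"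
  assumes [measurable]: "a \<in> borel_measurable P" "f \<in> borel_measurable (borel \<Otimes>\<^sub>M P)"
  shows "(\<lambda>z. duhamel (a (snd z)) (\<lambda>s. f (s, snd z)) (fst z)) \<in> borel_measurable (borel \<Otimes>\<^sub>M P)"
proof -
  have [measurable]: "Measurable.pred ((borel \<Otimes>\<^sub>M P) \<Otimes>\<^sub>M borel) (\<lambda>w. (0::real) \<le> snd w \<and> snd w \<le> (fst (fst w) :: real))"
    by measurable
  have "(\<lambda>w. indicator {0..fst (fst w)} (snd w) *\<^sub>R (exp (- a (snd (fst w)) * (fst (fst w) - snd w)) *\<^sub>R f (snd w, snd (fst w))))
      \<in> borel_measurable ((borel \<Otimes>\<^sub>M P) \<Otimes>\<^sub>M borel)"
    unfolding indicator_def atLeastAtMost_iff by measurable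
  then have "(\<lambda>w. indicator {0..fst (fst w)} (snd w) *\<^sub>R (exp (- a (snd (fst w)) * (fst (fst w) - snd w)) *\<^sub>R f (snd w, snd (fst w))))
      \<in> borel_measurable ((borel \<Otimes>\<^sub>M P) \<Otimes>\<^sub>M lborel)"
    by (simp only: measurable_cong_sets[OF sets_pair_measure_cong[OF refl sets_lborel] refl])
  then show ?thesis
    unfolding duhamel_def
    by (intro lborel.borel_measurable_lebesgue_integral) (simp add: case_prod_beta)
qed

section \<open>Trees, their weights and their amplitudes\<close>

datatype tree = Leaf | Quad tree tree | Cub tree tree tree

instance tree :: countable
  by countable_datatype

primrec weight :: "real \<Rightarrow> real \<Rightarrow> tree \<Rightarrow> real" where
  "weight K N Leaf = N"
| "weight K N (Quad a b) = K * (weight K N a * weight K N b)"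
| "weight K N (Cub a b d) = K * (weight K N a * (weight K N b * weight K N d))"

lemma weight_nonneg: "0 \<le> K \<Longrightarrow> 0 \<le> N \<Longrightarrow> 0 \<le> weight K N \<tau>"
  by (induction \<tau>) auto

text \<open>An exhaustion by finite sets according to height. Beginning with the empty set makes the
  partial sums of weights the iterates of the majorant equation started at 0.\<close>

primrec trees :: "nat \<Rightarrow> tree set" where
  "trees 0 = {}"
| "trees (Suc h) = insert Leaf ((\<lambda>(a, b). Quad a b) ` (trees h \<times> trees h) \<union> (\<lambda>(a, b, d). Cub a b d) ` (trees h \<times> trees h \<times> trees h))"

lemma finite_trees: "finite (trees h)"
  by (induction h) auto

lemma in_trees_Suc: "\<tau> \<in> trees (Suc h) \<longleftrightarrow> \<tau> = Leaf \<or> (\<exists>a\<in>trees h. \<exists>b\<in>trees h. \<tau> = Quad a b) \<or>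
    (\<exists>a\<in>trees h. \<exists>b\<in>trees h. \<exists>d\<in>trees h. \<tau> = Cub a b d)"
  unfolding trees.simps(2) by force

lemma trees_mono: "trees h \<subseteq> trees (Suc h)"
proof (induction h)
  case (Suc h)
  show ?case
  proof
    fix \<tau> assume "\<tau> \<in> trees (Suc h)"
    then show "\<tau> \<in> trees (Suc (Suc h))"
      using Suc unfolding in_trees_Suc[of \<tau>] by blast
  qed
qed simp

lemma trees_mono_le: "h \<le> k \<Longrightarrow> trees h \<subseteq> trees k"
  by (rule lift_Suc_mono_le[of trees]) (use trees_mono in auto)

lemma tree_in_trees: "\<exists>h. \<tau> \<in> trees h"
proof (induction \<tau>)
  case Leaf
  show ?case by (intro exI[of _ 1]) simp
next
  case (Quad a b)
  then obtain h k where "a \<in> trees h" "b \<in> trees k" by blast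
  then have "a \<in> trees (max h k)" "b \<in> trees (max h k)" using trees_mono_le[of h "max h k"] trees_mono_le[of k "max h k"] by auto
  then show ?case by (intro exI[of _ "Suc (max h k)"]) (simp add: in_trees_Suc del: trees.simps)
next
  case (Cub a b d)
  then obtain h k l where "a \<in> trees h" "b \<in> trees k" "d \<in> trees l" by blast
  moreover define m where "m = max h (max k l)"
  moreover have "h \<le> m" "k \<le> m" "l \<le> m" by (simp_all add: m_def)
  ultimately have "a \<in> trees m" "b \<in> trees m" "d \<in> trees m"
    using trees_mono_le by blast+
  then show ?case by (intro exI[of _ "Suc m"]) (simp add: in_trees_Suc del: trees.simps)
qed

text \<open>The majorant equation \<open>S = N + K S\<^sup>2 + K S\<^sup>3\<close> has a solution below \<open>2 N\<close> when \<open>N\<close> is small.\<close>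

lemma sum_weight_trees:
  assumes K: "0 \<le> K" and N: "0 \<le> N" and small: "4 * K * N + 8 * K * N\<^sup>2 \<le> 1"
  shows "(\<Sum>\<tau>\<in>trees h. weight K N \<tau>) \<le> 2 * N"
proof (induction h)
  case (Suc h)
  let ?S = "\<Sum>\<tau>\<in>trees h. weight K N \<tau>"
  let ?Q = "(\<lambda>(a, b). Quad a b) ` (trees h \<times> trees h)" and ?C = "(\<lambda>(a, b, d). Cub a b d) ` (trees h \<times> trees h \<times> trees h)"
  have fin: "finite ?Q" "finite ?C" using finite_trees by auto
  have S0: "0 \<le> ?S" by (intro sum_nonneg weight_nonneg K N)
  have "(\<Sum>\<tau>\<in>trees (Suc h). weight K N \<tau>) = N + (sum (weight K N) ?Q + sum (weight K N) ?C)"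
    using fin by (simp add: sum.insert_if) (subst sum.union_disjoint, auto)
  also have "sum (weight K N) ?Q = (\<Sum>(a, b)\<in>trees h \<times> trees h. K * (weight K N a * weight K N b))"
    by (subst sum.reindex) (auto simp: inj_on_def intro!: sum.cong)
  also have "\<dots> = K * (?S * ?S)"
    unfolding sum.cartesian_product[symmetric] unfolding sum_product unfolding sum_distrib_left ..
  also have "sum (weight K N) ?C = (\<Sum>(a, b, d)\<in>trees h \<times> trees h \<times> trees h. K * (weight K N a * (weight K N b * weight K N d)))"
    by (subst sum.reindex) (auto simp: inj_on_def intro!: sum.cong)
  also have "\<dots> = K * (?S * (?S * ?S))"
    unfolding sum.cartesian_product[symmetric] unfolding sum_product unfolding sum_distrib_left ..
  \<comment> \<open>The smallness assumption is what makes \<open>2 * N\<close> a supersolution of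
    the majorant equation, so the iterates cannot pass it.\<close>
  also have "N + (K * (?S * ?S) + K * (?S * (?S * ?S))) \<le> N + (K * ((2 * N) * (2 * N)) + K * ((2 * N) * ((2 * N) * (2 * N))))"
    using Suc S0 K N by (intro add_left_mono add_mono mult_left_mono mult_mono mult_nonneg_nonneg) auto
  also have "\<dots> = N + N * (4 * K * N + 8 * K * N\<^sup>2)" by (simp add: power2_eq_square algebra_simps)
  also have "\<dots> \<le> N + N * 1" using small N by (intro add_left_mono mult_left_mono) auto
  finally show ?case by simp
qed (use N in simp)

lemma nn_integral_weight:
  assumes "0 \<le> K" "0 \<le> N" "4 * K * N + 8 * K * N\<^sup>2 \<le> 1"
  shows "(\<integral>\<^sup>+\<tau>. ennreal (weight K N \<tau>) \<partial>count_space UNIV) \<le> ennreal (2 * N)"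
proof -
  have "(\<integral>\<^sup>+\<tau>. ennreal (weight K N \<tau>) \<partial>count_space UNIV) = (\<integral>\<^sup>+\<tau>. (SUP h. ennreal (weight K N \<tau>) * indicator (trees h) \<tau>) \<partial>count_space UNIV)"
  proof (rule nn_integral_cong)
    fix \<tau> :: tree
    obtain h where h: "\<tau> \<in> trees h" using tree_in_trees by blast
    show "ennreal (weight K N \<tau>) = (SUP h. ennreal (weight K N \<tau>) * indicator (trees h) \<tau>)"
    proof (rule antisym)
      show "ennreal (weight K N \<tau>) \<le> (SUP h. ennreal (weight K N \<tau>) * indicator (trees h) \<tau>)"
        by (rule SUP_upper2[of h]) (use h in auto)
      show "(SUP h. ennreal (weight K N \<tau>) * indicator (trees h) \<tau>) \<le> ennreal (weight K N \<tau>)"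
        by (rule SUP_least) (auto split: split_indicator)
    qed
  qed
  also have "\<dots> = (SUP h. \<integral>\<^sup>+\<tau>. ennreal (weight K N \<tau>) * indicator (trees h) \<tau> \<partial>count_space UNIV)"
    by (rule nn_integral_monotone_convergence_SUP)
      (use trees_mono_le in \<open>auto simp: incseq_def le_fun_def split: split_indicator\<close>)
  also have "\<dots> \<le> ennreal (2 * N)"
  proof (rule SUP_least)
    fix h
    have "(\<integral>\<^sup>+\<tau>. ennreal (weight K N \<tau>) * indicator (trees h) \<tau> \<partial>count_space UNIV) = (\<integral>\<^sup>+\<tau>. ennreal (weight K N \<tau>) \<partial>count_space (trees h))"
      by (subst (2) nn_integral_count_space_indicator) auto
    also have "\<dots> = ennreal (\<Sum>\<tau>\<in>trees h. weight K N \<tau>)"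
      by (subst nn_integral_count_space_finite[OF finite_trees]) (rule sum_ennreal, intro weight_nonneg assms)
    also have "\<dots> \<le> ennreal (2 * N)" by (intro ennreal_leI sum_weight_trees assms)
    finally show "(\<integral>\<^sup>+\<tau>. ennreal (weight K N \<tau>) * indicator (trees h) \<tau> \<partial>count_space UNIV) \<le> ennreal (2 * N)" .
  qed
  finally show ?thesis .
qed

text \<open>The middle child of a cubic node enters conjugated, so its frequency is subtracted. A
  leaf reads coordinate 0 of whatever sequence has been handed down to it.\<close>

primrec freq :: "tree \<Rightarrow> (nat \<Rightarrow> real^'n) \<Rightarrow> real^'n" where
  "freq Leaf \<omega> = \<omega> 0"
| "freq (Quad a b) \<omega> = freq a (evs \<omega>) + freq b (ods \<omega>)"
| "freq (Cub a b d) \<omega> = freq a (evs \<omega>) - freq b (evs (ods \<omega>)) + freq d (ods (ods \<omega>))"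

text \<open>\<open>amp\<close> solves the Fourier-transformed equation on the free algebra of trees: a tree is forced only
  by its proper subtrees, so the solution is obtained by structural recursion.\<close>

locale tree_sol =
  fixes \<alpha> \<Gamma>0 \<Gamma>2 \<beta> lam0 m N :: real and \<nu> :: "(real^'n) measure" and g :: "real^'n \<Rightarrow> complex^'n"
  assumes prob: "prob_space \<nu>" and sets_\<nu>: "sets \<nu> = sets borel" and g_meas: "g \<in> borel_measurable borel"
    and g_bound: "\<And>\<xi>. norm (g \<xi>) \<le> N" and g_proj: "\<And>\<xi>. proj \<xi> (g \<xi>) = g \<xi>"
    and m: "0 < m" and symb_ge: "\<And>\<xi>::real^'n. 2 * m * (1 + norm \<xi>) \<le> symb \<alpha> \<Gamma>0 \<Gamma>2 \<xi>"
begin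

primrec amp :: "tree \<Rightarrow> (nat \<Rightarrow> real^'n) \<Rightarrow> real \<Rightarrow> complex^'n" where
  "amp Leaf \<omega> t = exp (- symb \<alpha> \<Gamma>0 \<Gamma>2 (\<omega> 0) * t) *\<^sub>R g (\<omega> 0)"
| "amp (Quad a b) \<omega> t = duhamel (symb \<alpha> \<Gamma>0 \<Gamma>2 (freq (Quad a b) \<omega>))
     (\<lambda>s. (- lam0) *\<^sub>R proj (freq (Quad a b) \<omega>) ((- \<i> * cdot (freq b (ods \<omega>)) (amp a (evs \<omega>) s)) *s amp b (ods \<omega>) s)) t"
| "amp (Cub a b d) \<omega> t = duhamel (symb \<alpha> \<Gamma>0 \<Gamma>2 (freq (Cub a b d) \<omega>))
     (\<lambda>s. (- \<beta>) *\<^sub>R proj (freq (Cub a b d) \<omega>) (hdot (amp a (evs \<omega>) s) (amp b (evs (ods \<omega>)) s) *s amp d (ods (ods \<omega>)) s)) t"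

text \<open>The unprojected advection term, set to 0 on trees whose root is of another kind, so that
  both nonlinearities become series over the same index set. In \<open>amp\<close> the terms are
  written out, because the recursion has to display the calls on subtrees.\<close>

definition quad_force :: "tree \<Rightarrow> (nat \<Rightarrow> real^'n) \<Rightarrow> real \<Rightarrow> complex^'n" where
  "quad_force \<tau> \<omega> t = (case \<tau> of Quad a b \<Rightarrow> (- \<i> * cdot (freq b (ods \<omega>)) (amp a (evs \<omega>) t)) *s amp b (ods \<omega>) t | _ \<Rightarrow> 0)"

definition cub_force :: "tree \<Rightarrow> (nat \<Rightarrow> real^'n) \<Rightarrow> real \<Rightarrow> complex^'n" where
  "cub_force \<tau> \<omega> t = (case \<tau> of Cub a b d \<Rightarrow> hdot (amp a (evs \<omega>) t) (amp b (evs (ods \<omega>)) t) *s amp d (ods (ods \<omega>)) t | _ \<Rightarrow> 0)"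

definition force :: "tree \<Rightarrow> (nat \<Rightarrow> real^'n) \<Rightarrow> real \<Rightarrow> complex^'n" where
  "force \<tau> \<omega> t = (- lam0) *\<^sub>R proj (freq \<tau> \<omega>) (quad_force \<tau> \<omega> t) + (- \<beta>) *\<^sub>R proj (freq \<tau> \<omega>) (cub_force \<tau> \<omega> t)"

text \<open>The 2 bounds the Helmholtz projection; the division by \<open>m\<close> turns the bound
  on the force into a multiple of m (1 + |\<xi>|), the factor that \<open>duhamel_bound\<close>
  removes.\<close>

definition K :: real where "K = 2 * (\<bar>lam0\<bar> + \<bar>\<beta>\<bar>) / m"

end

lemma (in tree_sol) force_simps:
  "force Leaf \<omega> t = 0"
  "force (Quad a b) \<omega> t = (- lam0) *\<^sub>R proj (freq (Quad a b) \<omega>) ((- \<i> * cdot (freq b (ods \<omega>)) (amp a (evs \<omega>) t)) *s amp b (ods \<omega>) t)"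
  "force (Cub a b d) \<omega> t = (- \<beta>) *\<^sub>R proj (freq (Cub a b d) \<omega>) (hdot (amp a (evs \<omega>) t) (amp b (evs (ods \<omega>)) t) *s amp d (ods (ods \<omega>)) t)"
  by (simp_all only: force_def quad_force_def cub_force_def tree.case
      linear_0[OF bounded_linear.linear[OF bounded_linear_proj]] scaleR_zero_right add_0_left add_0_right)

lemma (in tree_sol) amp_duhamel: "\<tau> \<noteq> Leaf \<Longrightarrow> amp \<tau> \<omega> = duhamel (symb \<alpha> \<Gamma>0 \<Gamma>2 (freq \<tau> \<omega>)) (force \<tau> \<omega>)"
proof (cases \<tau>)
  case (Quad a b)
  have "force (Quad a b) \<omega> = (\<lambda>s. (- lam0) *\<^sub>R proj (freq (Quad a b) \<omega>) ((- \<i> * cdot (freq b (ods \<omega>)) (amp a (evs \<omega>) s)) *s amp b (ods \<omega>) s))"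
    by (intro ext) (rule force_simps)
  then show ?thesis unfolding Quad by (intro ext) (simp only: amp.simps)
next
  case (Cub a b d)
  have "force (Cub a b d) \<omega> = (\<lambda>s. (- \<beta>) *\<^sub>R proj (freq (Cub a b d) \<omega>) (hdot (amp a (evs \<omega>) s) (amp b (evs (ods \<omega>)) s) *s amp d (ods (ods \<omega>)) s))"
    by (intro ext) (rule force_simps)
  then show ?thesis unfolding Cub by (intro ext) (simp only: amp.simps)
qed simp

lemma (in tree_sol) proj_force: "proj (freq \<tau> \<omega>) (force \<tau> \<omega> t) = force \<tau> \<omega> t"
  by (simp add: force_def proj_add proj_diff proj_scaleR proj_idem linear_neg[OF bounded_linear.linear[OF bounded_linear_proj]])

lemma (in tree_sol) continuous_amp: "continuous_on {0..} (amp \<tau> \<omega>)"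
proof (induction \<tau> arbitrary: \<omega>)
  case Leaf
  show ?case by (simp, intro continuous_intros)
next
  case (Quad a b)
  have "continuous_on {0..} (\<lambda>t. cdot \<xi> (amp a (evs \<omega>) t))" for \<xi>
    unfolding cdot_def by (intro continuous_intros Quad)
  then have "continuous_on {0..} (force (Quad a b) \<omega>)"
    unfolding force_simps[abs_def]
    by (intro continuous_on_scaleR continuous_on_const bounded_linear.continuous_on[OF bounded_linear_proj]
        vsm.continuous_on continuous_on_mult Quad)
  then show ?case by (simp only: amp_duhamel[OF tree.distinct(2)] duhamel_continuous)
next
  case (Cub a b d)
  have "continuous_on {0..} (\<lambda>t. hdot (amp a (evs \<omega>) t) (amp b (evs (ods \<omega>)) t))"
    unfolding hdot_def by (intro continuous_intros Cub)
  then have "continuous_on {0..} (force (Cub a b d) \<omega>)"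
    unfolding force_simps[abs_def]
    by (intro continuous_on_scaleR continuous_on_const bounded_linear.continuous_on[OF bounded_linear_proj]
        vsm.continuous_on Cub)
  then show ?case by (simp only: amp_duhamel[OF tree.distinct(4)] duhamel_continuous)
qed

lemma (in tree_sol) continuous_force: "continuous_on {0..} (force \<tau> \<omega>)"
proof (cases \<tau>)
  case Leaf
  then show ?thesis by (simp add: force_simps[abs_def])
next
  case (Quad a b)
  have "continuous_on {0..} (\<lambda>t. cdot \<xi> (amp a (evs \<omega>) t))" for \<xi>
    unfolding cdot_def by (intro continuous_intros continuous_amp)
  then show ?thesis
    unfolding Quad force_simps[abs_def]
    by (intro continuous_on_scaleR continuous_on_const bounded_linear.continuous_on[OF bounded_linear_proj]
        vsm.continuous_on continuous_on_mult continuous_amp)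
next
  case (Cub a b d)
  have "continuous_on {0..} (\<lambda>t. hdot (amp a (evs \<omega>) t) (amp b (evs (ods \<omega>)) t))"
    unfolding hdot_def by (intro continuous_intros continuous_amp)
  then show ?thesis
    unfolding Cub force_simps[abs_def]
    by (intro continuous_on_scaleR continuous_on_const bounded_linear.continuous_on[OF bounded_linear_proj]
        vsm.continuous_on continuous_amp)
qed

lemma (in tree_sol) amp_0: "amp \<tau> \<omega> 0 = (if \<tau> = Leaf then g (\<omega> 0) else 0)"
proof (cases "\<tau> = Leaf")
  case False
  then show ?thesis by (simp add: amp_duhamel duhamel_eq[OF continuous_force])
qed simp

lemma (in tree_sol) proj_amp: "0 \<le> t \<Longrightarrow> proj (freq \<tau> \<omega>) (amp \<tau> \<omega> t) = amp \<tau> \<omega> t"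
proof (cases "\<tau> = Leaf")
  case True
  then show ?thesis by (simp add: proj_scaleR g_proj)
next
  case False
  assume "0 \<le> t"
  then show ?thesis unfolding amp_duhamel[OF False] by (rule duhamel_proj[OF continuous_force _ proj_force])
qed

lemma (in tree_sol) amp_deriv:
  assumes t: "0 \<le> t"
  shows "(amp \<tau> \<omega> has_vector_derivative force \<tau> \<omega> t - symb \<alpha> \<Gamma>0 \<Gamma>2 (freq \<tau> \<omega>) *\<^sub>R amp \<tau> \<omega> t) (at t within {0..})"
proof (cases "\<tau> = Leaf")
  case True
  have "((\<lambda>t. exp (- symb \<alpha> \<Gamma>0 \<Gamma>2 (\<omega> 0) * t) *\<^sub>R g (\<omega> 0)) has_vector_derivative
      - (symb \<alpha> \<Gamma>0 \<Gamma>2 (\<omega> 0) * exp (- symb \<alpha> \<Gamma>0 \<Gamma>2 (\<omega> 0) * t)) *\<^sub>R g (\<omega> 0)) (at t within {0..})"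
    by (auto intro!: derivative_eq_intros simp: has_real_derivative_iff_has_vector_derivative[symmetric])
  moreover have "amp Leaf \<omega> = (\<lambda>t. exp (- symb \<alpha> \<Gamma>0 \<Gamma>2 (\<omega> 0) * t) *\<^sub>R g (\<omega> 0))" by (intro ext) simp
  ultimately show ?thesis using True by (simp add: force_simps)
next
  case False
  show ?thesis unfolding amp_duhamel[OF False] by (rule duhamel_deriv[OF continuous_force t])
qed

lemma (in tree_sol) N_nonneg: "0 \<le> N"
  using g_bound norm_ge_zero order_trans by blast

lemma (in tree_sol) K_nonneg: "0 \<le> K"
  using m by (simp add: K_def)

lemma (in tree_sol) w_nonneg: "0 \<le> weight K N \<tau>"
  by (intro weight_nonneg K_nonneg N_nonneg)

text \<open>Solenoidality turns the derivative of the second factor into one of the whole product, so a single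
  power of the frequency is lost, which Duhamel's integral regains. The exponential weight in the
  frequency is submultiplicative and yields the smoothing for positive times.\<close>

lemma (in tree_sol) force_bound_step:
  assumes t: "0 \<le> t"
    and sub: "\<And>\<sigma> \<omega>. size \<sigma> < size \<tau> \<Longrightarrow> norm (amp \<sigma> \<omega> t) \<le> weight K N \<sigma> * exp (- (m * (1 + norm (freq \<sigma> \<omega>))) * t)"
  shows "norm (force \<tau> \<omega> t) \<le> (m * (1 + norm (freq \<tau> \<omega>))) * weight K N \<tau> * exp (- (m * (1 + norm (freq \<tau> \<omega>))) * t)"
proof (cases \<tau>)
  case Leaf
  then show ?thesis using m w_nonneg[of \<tau>] by (simp add: force_simps N_nonneg)
next
  case (Quad a b)
  define \<xi> where "\<xi> = freq \<tau> \<omega>"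
  define A where "A = weight K N a" define B where "B = weight K N b"
  have AB: "0 \<le> A" "0 \<le> B" unfolding A_def B_def by (rule w_nonneg)+
  have na: "norm (amp a (evs \<omega>) t) \<le> A * exp (- (m * (1 + norm (freq a (evs \<omega>)))) * t)"
    and nb: "norm (amp b (ods \<omega>) t) \<le> B * exp (- (m * (1 + norm (freq b (ods \<omega>)))) * t)"
    unfolding A_def B_def using Quad by (intro sub; simp)+
  have "cdot (freq a (evs \<omega>)) (amp a (evs \<omega>) t) = 0"
    using cdot_proj[of "freq a (evs \<omega>)" "amp a (evs \<omega>) t"] by (simp add: proj_amp[OF t])
  then have c: "cdot (freq b (ods \<omega>)) (amp a (evs \<omega>) t) = cdot \<xi> (amp a (evs \<omega>) t)"
    by (simp add: \<xi>_def Quad cdot_add_left)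
  have "norm (force \<tau> \<omega> t) \<le> \<bar>lam0\<bar> * (2 * (cmod (cdot \<xi> (amp a (evs \<omega>) t)) * norm (amp b (ods \<omega>) t)))"
  proof -
    have "freq (Quad a b) \<omega> = \<xi>" by (simp add: \<xi>_def Quad)
    then have "norm (force \<tau> \<omega> t) = \<bar>lam0\<bar> * norm (proj \<xi> ((- \<i> * cdot \<xi> (amp a (evs \<omega>) t)) *s amp b (ods \<omega>) t))"
      by (simp only: Quad force_simps c norm_scaleR abs_minus_cancel)
    also have "\<dots> \<le> \<bar>lam0\<bar> * (2 * norm ((- \<i> * cdot \<xi> (amp a (evs \<omega>) t)) *s amp b (ods \<omega>) t))"
      by (intro mult_left_mono norm_proj_le) simp
    finally show ?thesis by (simp only: norm_vector_scalar_mult norm_mult norm_minus_cancel norm_ii mult_1)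
  qed
  also have "\<dots> \<le> \<bar>lam0\<bar> * (2 * ((norm \<xi> * norm (amp a (evs \<omega>) t)) * norm (amp b (ods \<omega>) t)))"
    by (intro mult_left_mono mult_right_mono cmod_cdot_le) auto
  also have "\<dots> \<le> \<bar>lam0\<bar> * (2 * ((norm \<xi> * (A * exp (- (m * (1 + norm (freq a (evs \<omega>)))) * t))) * (B * exp (- (m * (1 + norm (freq b (ods \<omega>)))) * t))))"
    using AB by (intro mult_left_mono mult_mono na nb) auto
  also have "\<dots> = 2 * \<bar>lam0\<bar> * norm \<xi> * (A * B) *
      (exp (- (m * (1 + norm (freq a (evs \<omega>)))) * t) * exp (- (m * (1 + norm (freq b (ods \<omega>)))) * t))"
    by (simp only: mult_ac)
  also have "exp (- (m * (1 + norm (freq a (evs \<omega>)))) * t) * exp (- (m * (1 + norm (freq b (ods \<omega>)))) * t)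
      = exp (- m * t * (2 + norm (freq a (evs \<omega>)) + norm (freq b (ods \<omega>))))"
    unfolding exp_add[symmetric] by (simp add: algebra_simps)
  also have "2 * \<bar>lam0\<bar> * norm \<xi> * (A * B) * exp (- m * t * (2 + norm (freq a (evs \<omega>)) + norm (freq b (ods \<omega>))))
      \<le> (m * K) * (1 + norm \<xi>) * (A * B) * exp (- (m * (1 + norm \<xi>)) * t)"
  proof -
    have h1: "2 * \<bar>lam0\<bar> \<le> m * K" using m by (simp add: K_def)
    have h2: "norm \<xi> \<le> 1 + norm \<xi>" by simp
    \<comment> \<open>The exponents add up to one m t more than the claim asks for; the triangle
      inequality for the frequencies does the rest.\<close>
    have "1 + norm \<xi> \<le> 2 + norm (freq a (evs \<omega>)) + norm (freq b (ods \<omega>))"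
      using norm_triangle_ineq[of "freq a (evs \<omega>)" "freq b (ods \<omega>)"] by (simp add: \<xi>_def Quad)
    then have "(m * t) * (1 + norm \<xi>) \<le> (m * t) * (2 + norm (freq a (evs \<omega>)) + norm (freq b (ods \<omega>)))"
      using m t by (intro mult_left_mono) auto
    then have h3: "exp (- m * t * (2 + norm (freq a (evs \<omega>)) + norm (freq b (ods \<omega>)))) \<le> exp (- (m * (1 + norm \<xi>)) * t)"
      by (simp add: mult_ac)
    show ?thesis
      by (rule mult_mono[OF mult_mono[OF mult_mono[OF h1 h2] order.refl] h3]) (use AB m K_nonneg in auto)
  qed
  finally show ?thesis unfolding \<xi>_def[symmetric] by (simp add: Quad A_def B_def mult_ac)
next
  case (Cub a b d)
  define \<xi> where "\<xi> = freq \<tau> \<omega>"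
  define A where "A = weight K N a" define B where "B = weight K N b" define D where "D = weight K N d"
  have AB: "0 \<le> A" "0 \<le> B" "0 \<le> D" unfolding A_def B_def D_def by (rule w_nonneg)+
  define x where "x = norm (freq a (evs \<omega>))" define y where "y = norm (freq b (evs (ods \<omega>)))"
  define z where "z = norm (freq d (ods (ods \<omega>)))"
  have na: "norm (amp a (evs \<omega>) t) \<le> A * exp (- (m * (1 + x)) * t)"
    and nb: "norm (amp b (evs (ods \<omega>)) t) \<le> B * exp (- (m * (1 + y)) * t)"
    and nd: "norm (amp d (ods (ods \<omega>)) t) \<le> D * exp (- (m * (1 + z)) * t)"
    unfolding A_def B_def D_def x_def y_def z_def using Cub by (intro sub; simp)+
  have "norm (force \<tau> \<omega> t) \<le> \<bar>\<beta>\<bar> * (2 * (cmod (hdot (amp a (evs \<omega>) t) (amp b (evs (ods \<omega>)) t)) * norm (amp d (ods (ods \<omega>)) t)))"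
    unfolding Cub force_simps norm_scaleR
    by (intro mult_mono order_trans[OF norm_proj_le]) (auto simp: norm_vector_scalar_mult)
  also have "\<dots> \<le> \<bar>\<beta>\<bar> * (2 * ((norm (amp a (evs \<omega>) t) * norm (amp b (evs (ods \<omega>)) t)) * norm (amp d (ods (ods \<omega>)) t)))"
    by (intro mult_left_mono mult_right_mono cmod_hdot_le) auto
  also have "\<dots> \<le> \<bar>\<beta>\<bar> * (2 * (((A * exp (- (m * (1 + x)) * t)) * (B * exp (- (m * (1 + y)) * t))) * (D * exp (- (m * (1 + z)) * t))))"
    using AB by (intro mult_left_mono mult_mono na nb nd mult_nonneg_nonneg) auto
  also have "\<dots> = 2 * \<bar>\<beta>\<bar> * 1 * (A * (B * D)) *
      (exp (- (m * (1 + x)) * t) * exp (- (m * (1 + y)) * t) * exp (- (m * (1 + z)) * t))"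
    by (simp only: mult_ac mult_1_right)
  also have "exp (- (m * (1 + x)) * t) * exp (- (m * (1 + y)) * t) * exp (- (m * (1 + z)) * t) = exp (- m * t * (3 + x + y + z))"
    unfolding exp_add[symmetric] by (simp add: algebra_simps)
  also have "2 * \<bar>\<beta>\<bar> * 1 * (A * (B * D)) * exp (- m * t * (3 + x + y + z)) \<le> (m * K) * (1 + norm \<xi>) * (A * (B * D)) * exp (- (m * (1 + norm \<xi>)) * t)"
  proof -
    have h1: "2 * \<bar>\<beta>\<bar> \<le> m * K" using m by (simp add: K_def)
    have h2: "1 \<le> 1 + norm \<xi>" by simp
    have "1 + norm \<xi> \<le> 3 + x + y + z"
      using norm_triangle_ineq[of "freq a (evs \<omega>) - freq b (evs (ods \<omega>))" "freq d (ods (ods \<omega>))"]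
        norm_triangle_ineq4[of "freq a (evs \<omega>)" "freq b (evs (ods \<omega>))"] by (simp add: \<xi>_def Cub x_def y_def z_def)
    then have "(m * t) * (1 + norm \<xi>) \<le> (m * t) * (3 + x + y + z)"
      using m t by (intro mult_left_mono) auto
    then have h3: "exp (- m * t * (3 + x + y + z)) \<le> exp (- (m * (1 + norm \<xi>)) * t)"
      by (simp add: mult_ac)
    show ?thesis
      by (rule mult_mono[OF mult_mono[OF mult_mono[OF h1 h2] order.refl] h3]) (use AB m K_nonneg in auto)
  qed
  finally show ?thesis unfolding \<xi>_def[symmetric] by (simp add: Cub A_def B_def D_def mult_ac)
qed

text \<open>The lower bound of the symbol is twice m (1 + |\<xi>|): one half becomes the exponential
  weight, the other the rate \<open>d\<close> in \<open>duhamel_bound\<close>. The induction is on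
  the size so that the force estimate can be quoted for arbitrary smaller trees and
  sequences.\<close>

lemma (in tree_sol) amp_bound:
  "0 \<le> t \<Longrightarrow> norm (amp \<tau> \<omega> t) \<le> weight K N \<tau> * exp (- (m * (1 + norm (freq \<tau> \<omega>))) * t)"
proof (induction \<tau> arbitrary: \<omega> t rule: measure_induct_rule[of size])
  case (less \<tau>)
  show ?case
  proof (cases "\<tau> = Leaf")
    case True
    have "m * (1 + norm (\<omega> 0)) * t \<le> symb \<alpha> \<Gamma>0 \<Gamma>2 (\<omega> 0) * t"
    proof (rule mult_right_mono[OF _ less.prems])
      have "m * (1 + norm (\<omega> 0)) \<le> 2 * m * (1 + norm (\<omega> 0))" using m by (intro mult_right_mono) auto
      then show "m * (1 + norm (\<omega> 0)) \<le> symb \<alpha> \<Gamma>0 \<Gamma>2 (\<omega> 0)" using symb_ge[of "\<omega> 0"] by linarith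
    qed
    then have "exp (- symb \<alpha> \<Gamma>0 \<Gamma>2 (\<omega> 0) * t) * norm (g (\<omega> 0)) \<le> exp (- (m * (1 + norm (\<omega> 0))) * t) * N"
      by (intro mult_mono g_bound) auto
    then show ?thesis using True by (simp add: mult.commute)
  next
    case False
    show ?thesis
      unfolding amp_duhamel[OF False]
    proof (rule duhamel_bound[OF continuous_force less.prems, where d = "m * (1 + norm (freq \<tau> \<omega>))"])
      have "0 < 1 + norm (freq \<tau> \<omega>)" by (rule add_pos_nonneg) auto
      then show "0 < m * (1 + norm (freq \<tau> \<omega>))" using m by simp
      show "m * (1 + norm (freq \<tau> \<omega>)) + m * (1 + norm (freq \<tau> \<omega>)) \<le> symb \<alpha> \<Gamma>0 \<Gamma>2 (freq \<tau> \<omega>)"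
        using symb_ge[of "freq \<tau> \<omega>"] by simp
      show "norm (force \<tau> \<omega> s) \<le> m * (1 + norm (freq \<tau> \<omega>)) * weight K N \<tau> * exp (- (m * (1 + norm (freq \<tau> \<omega>))) * s)"
        if "0 \<le> s" for s
        by (rule force_bound_step[OF that less.IH[OF _ that]])
    qed (rule w_nonneg)
  qed
qed

lemma (in tree_sol) force_bound:
  "0 \<le> t \<Longrightarrow> norm (force \<tau> \<omega> t) \<le> (m * (1 + norm (freq \<tau> \<omega>))) * weight K N \<tau> * exp (- (m * (1 + norm (freq \<tau> \<omega>))) * t)"
  by (rule force_bound_step[OF _ amp_bound])

lemma (in tree_sol) freq_measurable[measurable]: "freq \<tau> \<in> borel_measurable (PiM UNIV (\<lambda>_::nat. \<nu>))"
proof (induction \<tau>)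
  case Leaf
  have "(\<lambda>\<omega>. \<omega> 0) \<in> measurable (PiM UNIV (\<lambda>_::nat. \<nu>)) \<nu>" by (rule measurable_component_singleton) simp
  then have "(\<lambda>\<omega>. \<omega> 0) \<in> borel_measurable (PiM UNIV (\<lambda>_::nat. \<nu>))"
    unfolding measurable_cong_sets[OF refl sets_\<nu>] .
  then show ?case by (simp only: freq.simps[abs_def])
next
  case (Quad a b)
  note [measurable] = Quad
  show ?case unfolding freq.simps[abs_def] by measurable
next
  case (Cub a b d)
  note [measurable] = Cub
  show ?case unfolding freq.simps[abs_def] by measurable
qed

lemma proj_measurable:
  fixes X :: "'a \<Rightarrow> real^'n" and G :: "'a \<Rightarrow> complex^'n"
  assumes [measurable]: "X \<in> borel_measurable M" "G \<in> borel_measurable M"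
  shows "(\<lambda>p. proj (X p) (G p)) \<in> borel_measurable M"
  unfolding proj_def by measurable

lemma borel_measurable_cdot[measurable]:
  fixes X :: "'a \<Rightarrow> real^'n" and G :: "'a \<Rightarrow> complex^'n"
  assumes [measurable]: "X \<in> borel_measurable M" "G \<in> borel_measurable M"
  shows "(\<lambda>p. cdot (X p) (G p)) \<in> borel_measurable M"
  unfolding cdot_def by measurable

lemma borel_measurable_hdot[measurable]:
  fixes G H :: "'a \<Rightarrow> complex^'n"
  assumes [measurable]: "G \<in> borel_measurable M" "H \<in> borel_measurable M"
  shows "(\<lambda>p. hdot (G p) (H p)) \<in> borel_measurable M"
proof -
  have [measurable]: "cnj \<in> borel_measurable borel"
    by (intro borel_measurable_continuous_onI continuous_intros)
  show ?thesis unfolding hdot_def by measurable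
qed

lemma (in tree_sol) amp_measurable_step:
  assumes f: "(\<lambda>z. force \<tau> (snd z) (fst z)) \<in> borel_measurable (borel \<Otimes>\<^sub>M PiM UNIV (\<lambda>_::nat. \<nu>))" and "\<tau> \<noteq> Leaf"
  shows "(\<lambda>z. amp \<tau> (snd z) (fst z)) \<in> borel_measurable (borel \<Otimes>\<^sub>M PiM UNIV (\<lambda>_::nat. \<nu>))"
proof -
  have "(\<lambda>\<omega>. symb \<alpha> \<Gamma>0 \<Gamma>2 (freq \<tau> \<omega>)) \<in> borel_measurable (PiM UNIV (\<lambda>_::nat. \<nu>))"
    by (rule measurable_compose[OF freq_measurable symb_measurable])
  from duhamel_measurable[OF this f] show ?thesis by (simp add: amp_duhamel[OF assms(2)])
qed

lemma (in tree_sol) amp_measurable: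
  "(\<lambda>z. amp \<tau> (snd z) (fst z)) \<in> borel_measurable (borel \<Otimes>\<^sub>M PiM UNIV (\<lambda>_::nat. \<nu>))"
proof (induction \<tau>)
  case Leaf
  have "(\<lambda>\<omega>. \<omega> 0) \<in> borel_measurable (PiM UNIV (\<lambda>_::nat. \<nu>))" using freq_measurable[of Leaf] by (simp only: freq.simps[abs_def])
  note [measurable] = this g_meas
  show ?case unfolding amp.simps[abs_def] by measurable
next
  case (Quad a b)
  have [measurable]: "(\<lambda>z. amp a (evs (snd z)) (fst z)) \<in> borel_measurable (borel \<Otimes>\<^sub>M PiM UNIV (\<lambda>_::nat. \<nu>))"
    using measurable_compose[OF _ Quad(1), of "\<lambda>z. (fst z, evs (snd z))"] by simp
  have [measurable]: "(\<lambda>z. amp b (ods (snd z)) (fst z)) \<in> borel_measurable (borel \<Otimes>\<^sub>M PiM UNIV (\<lambda>_::nat. \<nu>))"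
    using measurable_compose[OF _ Quad(2), of "\<lambda>z. (fst z, ods (snd z))"] by simp
  show ?case
    by (rule amp_measurable_step[OF _ tree.distinct(2)]) (simp only: force_simps, intro borel_measurable_scaleR proj_measurable, measurable)
next
  case (Cub a b d)
  have [measurable]: "(\<lambda>z. amp a (evs (snd z)) (fst z)) \<in> borel_measurable (borel \<Otimes>\<^sub>M PiM UNIV (\<lambda>_::nat. \<nu>))"
    using measurable_compose[OF _ Cub(1), of "\<lambda>z. (fst z, evs (snd z))"] by simp
  have [measurable]: "(\<lambda>z. amp b (evs (ods (snd z))) (fst z)) \<in> borel_measurable (borel \<Otimes>\<^sub>M PiM UNIV (\<lambda>_::nat. \<nu>))"
    using measurable_compose[OF _ Cub(2), of "\<lambda>z. (fst z, evs (ods (snd z)))"] by simp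
  have [measurable]: "(\<lambda>z. amp d (ods (ods (snd z))) (fst z)) \<in> borel_measurable (borel \<Otimes>\<^sub>M PiM UNIV (\<lambda>_::nat. \<nu>))"
    using measurable_compose[OF _ Cub(3), of "\<lambda>z. (fst z, ods (ods (snd z)))"] by simp
  show ?case
    by (rule amp_measurable_step[OF _ tree.distinct(4)]) (simp only: force_simps, intro borel_measurable_scaleR proj_measurable, measurable)
qed

lemma (in tree_sol) amp_measurable_section:
  "(\<lambda>\<omega>. amp \<tau> \<omega> t) \<in> borel_measurable (PiM UNIV (\<lambda>_::nat. \<nu>))"
  using measurable_compose[OF _ amp_measurable, of "\<lambda>\<omega>. (t, \<omega>)"] by simp

section \<open>Smoothing and summation over trees\<close>

lemma pow4_exp_le:
  assumes "0 < c" "0 \<le> x"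
  shows "x ^ 4 * exp (- c * x) \<le> 256 / (c::real) ^ 4"
proof -
  \<comment> \<open>The bound y / 4 \<le> exp(y / 4) is raised to the fourth power, whence 256 =
    4^4.\<close>
  have "c * x / 4 \<le> exp (c * x / 4)" using exp_ge_add_one_self[of "c * x / 4"] by linarith
  then have "(c * x / 4) ^ 4 \<le> exp (c * x / 4) ^ 4"
    using assms by (intro power_mono) auto
  also have "exp (c * x / 4) ^ 4 = exp (c * x)" by (simp flip: exp_of_nat_mult)
  finally have "c ^ 4 * x ^ 4 \<le> 256 * exp (c * x)" by (simp add: power_mult_distrib power_divide)
  then show ?thesis using assms by (simp add: exp_minus field_simps)
qed

lemma one_plus_le_pow4: "1 + x \<le> 2 * (1 + x ^ 4)" if "0 \<le> x" for x :: real
proof -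
  define y where "y = x ^ 4"
  have "x \<le> 1 + y" using powr_le_one_plus[of 1 4 x] that by (simp add: powr_4 y_def)
  moreover have "0 \<le> y" by (simp add: y_def)
  ultimately show ?thesis unfolding y_def[symmetric] by (simp add: distrib_left)
qed

context tree_sol
begin

abbreviation M :: "(tree \<times> (nat \<Rightarrow> real^'n)) measure" where "M \<equiv> idx \<nu>"

definition tfreq :: "tree \<times> (nat \<Rightarrow> real^'n) \<Rightarrow> real^'n" where "tfreq p = freq (fst p) (snd p)"
definition tamp :: "real \<Rightarrow> tree \<times> (nat \<Rightarrow> real^'n) \<Rightarrow> complex^'n" where "tamp t p = amp (fst p) (snd p) t"
definition tquad :: "real \<Rightarrow> tree \<times> (nat \<Rightarrow> real^'n) \<Rightarrow> complex^'n" where "tquad t p = quad_force (fst p) (snd p) t"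
definition tcub :: "real \<Rightarrow> tree \<times> (nat \<Rightarrow> real^'n) \<Rightarrow> complex^'n" where "tcub t p = cub_force (fst p) (snd p) t"
definition tdot :: "real \<Rightarrow> tree \<times> (nat \<Rightarrow> real^'n) \<Rightarrow> complex^'n" where
  "tdot t p = force (fst p) (snd p) t - symb \<alpha> \<Gamma>0 \<Gamma>2 (tfreq p) *\<^sub>R tamp t p"
definition tweight :: "tree \<times> (nat \<Rightarrow> real^'n) \<Rightarrow> real" where "tweight p = weight K N (fst p)"

definition sol :: "real \<Rightarrow> 'n vfield" where "sol t = lift M tfreq (tamp t)"

text \<open>Bounds (1 + |\<xi>|^4) exp(- m (1 + |\<xi>|) s) uniformly in the frequency for s \<ge>
  t. It blows up as t tends to 0, in accordance with initial data that lie only in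
  \<open>FM\<close>.\<close>

definition growth :: "real \<Rightarrow> real" where "growth t = 1 + 256 / (m * t) ^ 4"

definition slope :: "real \<Rightarrow> real" where "slope t = (2 * m + (\<bar>\<alpha>\<bar> + \<bar>\<Gamma>0\<bar> + \<bar>\<Gamma>2\<bar>)) * growth t"

end

lemma (in tree_sol) tfreq_measurable[measurable]: "tfreq \<in> borel_measurable M"
  by (rule measurable_idx) (simp add: tfreq_def)

lemma (in tree_sol) tamp_measurable[measurable]: "tamp t \<in> borel_measurable M"
  by (rule measurable_idx) (simp add: tamp_def amp_measurable_section)

lemma (in tree_sol) tweight_nonneg: "0 \<le> tweight p"
  unfolding tweight_def by (rule w_nonneg)

lemma (in tree_sol)
  assumes "4 * K * N + 8 * K * N\<^sup>2 \<le> 1"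
  shows integrable_tweight: "integrable M tweight" and integral_tweight_le: "(\<integral>p. tweight p \<partial>M) \<le> 2 * N"
proof -
  interpret P: prob_space "PiM UNIV (\<lambda>_::nat. \<nu>)" using prob by (intro prob_space_PiM)
  have [measurable]: "tweight \<in> borel_measurable M"
    by (rule measurable_idx) (simp add: tweight_def)
  \<comment> \<open>The weight depends on the tree alone, so integration over the sequences
    contributes the factor 1 and the sum over trees remains.\<close>
  have "(\<integral>\<^sup>+p. ennreal (tweight p) \<partial>M) = (\<integral>\<^sup>+a. \<integral>\<^sup>+\<omega>. ennreal (tweight (a, \<omega>)) \<partial>PiM UNIV (\<lambda>_::nat. \<nu>) \<partial>count_space UNIV)"
    by (rule nn_integral_idx[OF prob]) measurable
  also have "\<dots> = (\<integral>\<^sup>+a. ennreal (weight K N a) \<partial>count_space UNIV)"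
    by (simp add: tweight_def P.emeasure_space_1)
  also have "\<dots> \<le> ennreal (2 * N)" by (rule nn_integral_weight[OF K_nonneg N_nonneg assms])
  finally have le: "(\<integral>\<^sup>+p. ennreal (tweight p) \<partial>M) \<le> ennreal (2 * N)" .
  show i: "integrable M tweight"
    by (rule integrableI_nonneg) (use le tweight_nonneg in \<open>auto intro: le_less_trans\<close>)
  show "(\<integral>p. tweight p \<partial>M) \<le> 2 * N"
    using le N_nonneg tweight_nonneg by (simp add: nn_integral_eq_integral[OF i] integral_nonneg_AE)
qed

lemma (in tree_sol) tamp_bound:
  "0 \<le> t \<Longrightarrow> norm (tamp t p) \<le> tweight p * exp (- (m * (1 + norm (tfreq p))) * t)"
  unfolding tamp_def tweight_def tfreq_def by (rule amp_bound)

lemma (in tree_sol) tamp_le: "0 \<le> t \<Longrightarrow> norm (tamp t p) \<le> tweight p * exp (- m * t)"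
proof -
  assume t: "0 \<le> t"
  have "(m * 1) * t \<le> m * (1 + norm (tfreq p)) * t" using m t by (intro mult_right_mono mult_left_mono) auto
  then have "tweight p * exp (- (m * (1 + norm (tfreq p))) * t) \<le> tweight p * exp (- m * t)"
    by (intro mult_left_mono tweight_nonneg) simp
  with tamp_bound[OF t, of p] show ?thesis by linarith
qed

lemma (in tree_sol) growth_bound:
  assumes t: "0 < t" and s: "t \<le> s"
  shows "(1 + norm (tfreq p) ^ 4) * exp (- (m * (1 + norm (tfreq p))) * s) \<le> growth t"
proof -
  let ?x = "norm (tfreq p)"
  have "(m * t) * ?x \<le> m * (1 + ?x) * s"
  proof -
    have "m * t * ?x \<le> m * s * (1 + ?x)" using m t s by (intro mult_mono) auto
    then show ?thesis by (simp add: mult_ac)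
  qed
  then have "exp (- (m * (1 + ?x)) * s) \<le> exp (- (m * t) * ?x)" by simp
  then have "(1 + ?x ^ 4) * exp (- (m * (1 + ?x)) * s) \<le> (1 + ?x ^ 4) * exp (- (m * t) * ?x)"
    by (intro mult_left_mono) auto
  also have "\<dots> = exp (- (m * t) * ?x) + ?x ^ 4 * exp (- (m * t) * ?x)" by (simp add: distrib_right)
  also have "\<dots> \<le> 1 + 256 / (m * t) ^ 4"
    using m t by (intro add_mono pow4_exp_le) auto
  finally show ?thesis by (simp add: growth_def)
qed

lemma (in tree_sol) tamp_pow4_le:
  assumes t: "0 < t"
  shows "norm (tfreq p) ^ 4 * norm (tamp t p) \<le> growth t * tweight p"
proof -
  have "norm (tfreq p) ^ 4 * norm (tamp t p) \<le> (1 + norm (tfreq p) ^ 4) * (tweight p * exp (- (m * (1 + norm (tfreq p))) * t))"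
    using t by (intro mult_mono tamp_bound) auto
  also have "\<dots> = ((1 + norm (tfreq p) ^ 4) * exp (- (m * (1 + norm (tfreq p))) * t)) * tweight p" by simp
  also have "\<dots> \<le> growth t * tweight p" by (intro mult_right_mono growth_bound[OF t order.refl] tweight_nonneg)
  finally show ?thesis .
qed

lemma (in tree_sol) tdot_le:
  assumes t: "0 < t" and s: "t \<le> s"
  shows "norm (tdot s p) \<le> slope t * tweight p"
proof -
  let ?x = "norm (tfreq p)"
  let ?e = "exp (- (m * (1 + ?x)) * s)"
  have s0: "0 \<le> s" using t s by simp
  have factor: "2 * m * y * w * e + a * y * (w * e) = (2 * m + a) * (y * e) * w" for y w e a :: real
    by (simp add: algebra_simps)
  have "norm (tdot s p) \<le> norm (force (fst p) (snd p) s) + \<bar>symb \<alpha> \<Gamma>0 \<Gamma>2 (tfreq p)\<bar> * norm (tamp s p)"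
    unfolding tdot_def by (rule order_trans[OF norm_triangle_ineq4]) simp
  also have "\<dots> \<le> (m * (1 + ?x)) * tweight p * ?e + ((\<bar>\<alpha>\<bar> + \<bar>\<Gamma>0\<bar> + \<bar>\<Gamma>2\<bar>) * (1 + ?x ^ 4)) * (tweight p * ?e)"
    unfolding tweight_def tfreq_def tamp_def
    by (intro add_mono mult_mono force_bound amp_bound abs_symb_le s0) auto
  also have "\<dots> \<le> (2 * m * (1 + ?x ^ 4)) * tweight p * ?e + ((\<bar>\<alpha>\<bar> + \<bar>\<Gamma>0\<bar> + \<bar>\<Gamma>2\<bar>) * (1 + ?x ^ 4)) * (tweight p * ?e)"
  proof (intro add_right_mono mult_right_mono tweight_nonneg)
    have "1 + ?x \<le> 2 * (1 + ?x ^ 4)"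
      by (rule one_plus_le_pow4) simp
    then have "m * (1 + ?x) \<le> m * (2 * (1 + ?x ^ 4))" using m by (intro mult_left_mono) auto
    then show "m * (1 + ?x) \<le> 2 * m * (1 + ?x ^ 4)" by (simp only: mult_ac)
  qed simp
  also have "\<dots> = (2 * m + (\<bar>\<alpha>\<bar> + \<bar>\<Gamma>0\<bar> + \<bar>\<Gamma>2\<bar>)) * ((1 + ?x ^ 4) * ?e) * tweight p"
    by (rule factor)
  also have "\<dots> \<le> (2 * m + (\<bar>\<alpha>\<bar> + \<bar>\<Gamma>0\<bar> + \<bar>\<Gamma>2\<bar>)) * growth t * tweight p"
    using m by (intro mult_right_mono mult_left_mono growth_bound[OF t s] tweight_nonneg) auto
  finally show ?thesis by (simp add: slope_def)
qed

lemma (in tree_sol) tamp_deriv: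
  assumes "0 \<le> t"
  shows "((\<lambda>t. tamp t p) has_vector_derivative tdot t p) (at t within {0..})"
  unfolding tamp_def tdot_def tfreq_def using amp_deriv[OF assms, of "fst p" "snd p"] by simp

text \<open>The mean value theorem on times at least t / 2, where \<open>slope (t / 2)\<close>
  bounds the derivative uniformly, gives a majorant of the difference quotients independent of
  \<open>h\<close>; being summable over trees, it permits termwise differentiation.\<close>

lemma (in tree_sol) tamp_quotient_le:
  assumes t: "0 < t" and h: "\<bar>h\<bar> < t / 2" "h \<noteq> 0"
  shows "norm ((tamp (t + h) p - tamp t p) /\<^sub>R h) \<le> slope (t / 2) * tweight p"
proof -
  have "norm (tamp (t + h) p - tamp t p) \<le> (slope (t / 2) * tweight p) * norm (t + h - t)"
  proof (rule differentiable_bound[where S = "{t/2..}" and f' = "\<lambda>s h. h *\<^sub>R tdot s p" and f = "\<lambda>t. tamp t p"])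
    show "((\<lambda>t. tamp t p) has_derivative (\<lambda>h. h *\<^sub>R tdot s p)) (at s within {t / 2..})" if "s \<in> {t / 2..}" for s
      unfolding has_vector_derivative_def[symmetric]
      by (rule has_vector_derivative_within_subset[OF tamp_deriv]) (use that t in auto)
    show "onorm (\<lambda>h. h *\<^sub>R tdot s p) \<le> slope (t / 2) * tweight p" if "s \<in> {t / 2..}" for s
    proof -
      have le: "norm (tdot s p) \<le> slope (t / 2) * tweight p" by (rule tdot_le) (use that t in auto)
      show ?thesis
        by (rule onorm_bound[OF order_trans[OF norm_ge_zero le]]) (simp, subst mult.commute, rule mult_right_mono[OF le], simp)
    qed
  qed (use t h in auto)
  then have "norm (tamp (t + h) p - tamp t p) / \<bar>h\<bar> \<le> slope (t / 2) * tweight p"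
    using h by (simp add: pos_divide_le_eq)
  moreover have "norm ((tamp (t + h) p - tamp t p) /\<^sub>R h) = norm (tamp (t + h) p - tamp t p) / \<bar>h\<bar>"
    by (simp only: norm_scaleR abs_inverse divide_inverse_commute)
  ultimately show ?thesis by (simp only:)
qed

lemma (in tree_sol) tamp_quotient_tendsto:
  assumes t: "0 < t"
  shows "((\<lambda>h. (tamp (t + h) p - tamp t p) /\<^sub>R h - tdot t p) \<longlongrightarrow> 0) (at 0)"
proof -
  have "at t within {0..} = at t" using t by (intro at_within_interior) simp
  then have "((\<lambda>t. tamp t p) has_vector_derivative tdot t p) (at t)"
    using tamp_deriv[of t p] t by simp
  then have "((\<lambda>h. norm (tamp (t + h) p - tamp t p - h *\<^sub>R tdot t p) / norm h) \<longlongrightarrow> 0) (at 0)"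
    by (simp add: has_vector_derivative_def has_derivative_at)
  then show ?thesis
  proof (rule Lim_null_comparison[rotated])
    show "\<forall>\<^sub>F h in at 0. norm ((tamp (t + h) p - tamp t p) /\<^sub>R h - tdot t p) \<le> norm (tamp (t + h) p - tamp t p - h *\<^sub>R tdot t p) / norm h"
      unfolding eventually_at_filter
    proof (intro always_eventually allI impI)
      fix h :: real assume "h \<noteq> 0"
      then have "(tamp (t + h) p - tamp t p) /\<^sub>R h - tdot t p = (tamp (t + h) p - tamp t p - h *\<^sub>R tdot t p) /\<^sub>R h"
        by (simp add: scaleR_diff_right)
      then show "norm ((tamp (t + h) p - tamp t p) /\<^sub>R h - tdot t p) \<le> norm (tamp (t + h) p - tamp t p - h *\<^sub>R tdot t p) / norm h"
        by (simp add: divide_inverse mult.commute)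
    qed
  qed
qed

lemma (in tree_sol) inv_Quad: "inv (\<lambda>(a, b). Quad a b) (Quad a b) = (a, b)"
  by (rule inv_f_eq) (auto simp: inj_on_def)

lemma (in tree_sol) inv_Cub: "inv (\<lambda>(a, b, d). Cub a b d) (Cub a b d) = (a, b, d)"
  by (rule inv_f_eq) (auto simp: inj_on_def)

lemma (in tree_sol) prob_seq: "prob_space (PiM UNIV (\<lambda>_::nat. \<nu>))"
  using prob by (intro prob_space_PiM)

text \<open>At time 0 every Duhamel term vanishes, so only the label \<open>Leaf\<close>
  contributes, and it sees the sequence through coordinate 0, whose law is
  \<open>\<nu>\<close>.\<close>

lemma (in tree_sol) sol_0:
  assumes small: "4 * K * N + 8 * K * N\<^sup>2 \<le> 1"
  shows "sol 0 = fm_of \<nu> g"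
proof
  fix x
  define P where "P = PiM UNIV (\<lambda>_::nat. \<nu>)"
  interpret P: product_prob_space "\<lambda>_::nat. \<nu>" UNIV
    using prob by (intro product_prob_spaceI)
  interpret PP: prob_space P unfolding P_def by (rule prob_seq)
  interpret C: sigma_finite_measure "count_space (UNIV::tree set)" by (rule sigma_finite_measure_count_space)
  interpret CP: pair_sigma_finite "count_space (UNIV::tree set)" P ..
  have i0: "integrable M (tamp 0)"
    by (rule Bochner_Integration.integrable_bound[OF integrable_tweight[OF small]])
      (use tamp_le[of 0] tweight_nonneg in auto)
  have i: "integrable (count_space UNIV \<Otimes>\<^sub>M P) (\<lambda>p. cis (- (x \<bullet> tfreq p)) *s tamp 0 p)"
    using integrable_lift[OF tfreq_measurable i0] by (simp add: idx_def P_def)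
  have "sol 0 x = (\<integral>a. \<integral>\<omega>. cis (- (x \<bullet> tfreq (a, \<omega>))) *s tamp 0 (a, \<omega>) \<partial>P \<partial>count_space UNIV)"
    using CP.integral_fst'[OF i] by (simp add: sol_def lift_def idx_def P_def)
  also have "\<dots> = (\<integral>a. indicator {Leaf} a *\<^sub>R (\<integral>\<omega>. cis (- (x \<bullet> \<omega> 0)) *s g (\<omega> 0) \<partial>P) \<partial>count_space UNIV)"
    by (intro Bochner_Integration.integral_cong) (auto simp: tamp_def tfreq_def amp_0 split: split_indicator)
  also have "\<dots> = (\<integral>\<omega>. cis (- (x \<bullet> \<omega> 0)) *s g (\<omega> 0) \<partial>P)"
    by simp
  also have "\<dots> = (\<integral>\<xi>. cis (- (x \<bullet> \<xi>)) *s g \<xi> \<partial>distr P \<nu> (\<lambda>\<omega>. \<omega> 0))"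
  proof (subst integral_distr)
    show "(\<lambda>\<omega>. \<omega> 0) \<in> measurable P \<nu>" unfolding P_def by (rule measurable_component_singleton) simp
    show "(\<lambda>\<xi>. cis (- (x \<bullet> \<xi>)) *s g \<xi>) \<in> borel_measurable \<nu>"
      unfolding measurable_cong_sets[OF sets_\<nu> refl] using g_meas by measurable
  qed simp
  also have "distr P \<nu> (\<lambda>\<omega>. \<omega> 0) = \<nu>" unfolding P_def by (rule P.PiM_component) simp
  finally show "sol 0 x = fm_of \<nu> g x" by (simp add: fm_of_eq_lift lift_def)
qed

lemma (in tree_sol) integrable_tamp:
  assumes small: "4 * K * N + 8 * K * N\<^sup>2 \<le> 1" and t: "0 \<le> t"
  shows "integrable M (tamp t)"
proof (rule Bochner_Integration.integrable_bound[OF integrable_tweight[OF small]])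
  have "exp (- m * t) \<le> 1" using m t by simp
  then have "tweight p * exp (- m * t) \<le> tweight p * 1" for p by (intro mult_left_mono tweight_nonneg)
  then have "norm (tamp t p) \<le> norm (tweight p)" for p
    using order_trans[OF tamp_le[OF t, of p]] tweight_nonneg[of p] by simp
  then show "AE p in M. norm (tamp t p) \<le> norm (tweight p)" by simp
qed simp

lemma (in tree_sol) integrable_tamp_pow4:
  assumes small: "4 * K * N + 8 * K * N\<^sup>2 \<le> 1" and t: "0 < t"
  shows "integrable M (\<lambda>p. norm (tfreq p) ^ 4 * norm (tamp t p))"
proof (rule Bochner_Integration.integrable_bound)
  show "integrable M (\<lambda>p. growth t * tweight p)" using integrable_tweight[OF small] by simp
  have "norm (norm (tfreq p) ^ 4 * norm (tamp t p)) \<le> norm (growth t * tweight p)" for p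
    using order_trans[OF tamp_pow4_le[OF t] abs_ge_self] by simp
  then show "AE p in M. norm (norm (tfreq p) ^ 4 * norm (tamp t p)) \<le> norm (growth t * tweight p)" by simp
qed measurable

text \<open>The product of the tree series with itself is indexed by pairs of trees, and
  \<open>Quad\<close> is a bijection from pairs onto the trees with quadratic root, compatible with
  the parity splitting built into \<open>freq\<close> and \<open>amp\<close>. Positivity of the time
  makes the first moment finite, so that the gradient can be taken under the sum.\<close>

lemma (in tree_sol)
  assumes small: "4 * K * N + 8 * K * N\<^sup>2 \<le> 1" and t: "0 < t"
  shows integrable_tquad: "integrable M (tquad t)" and advect_sol: "advect (sol t) = lift M tfreq (tquad t)"
proof -
  note ia = integrable_tamp[OF small less_imp_le[OF t]]
  have w4: "integrable M (\<lambda>p. norm (tfreq p) powr 4 * norm (tamp t p))"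
    using integrable_tamp_pow4[OF small t] by (simp add: powr_4)
  have w1: "integrable M (\<lambda>p. norm (tfreq p) * norm (tamp t p))"
    using integrable_weight_mono[OF tfreq_measurable ia w4, of 1] by simp
  note * = sigma_finite_idx[OF prob] sigma_finite_idx[OF prob] tfreq_measurable tfreq_measurable ia ia w1
  let ?c = "\<lambda>(a, b). Quad a b"
  have c: "inj ?c" by (auto simp: inj_on_def)
  have Y: "(\<lambda>z. tfreq (fst z) + tfreq (snd z)) \<in> borel_measurable (M \<Otimes>\<^sub>M M)" by measurable
  have Y': "tfreq p = tfreq (fst (splt ?c p)) + tfreq (snd (splt ?c p))" if "fst p \<in> range ?c" for p
    using that by (cases p) (auto simp: splt_def inv_Quad tfreq_def)
  have H': "tquad t p = (- \<i> * cdot (tfreq (snd (splt ?c p))) (tamp t (fst (splt ?c p)))) *s tamp t (snd (splt ?c p))" if "fst p \<in> range ?c" for p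
    using that by (cases p) (auto simp: splt_def inv_Quad tfreq_def tamp_def tquad_def quad_force_def)
  have H0: "tquad t p = 0" if "fst p \<notin> range ?c" for p
    using that by (cases p, cases "fst p") (auto simp: tquad_def quad_force_def image_iff)
  note s = prob c Y integrable_advB[OF *] Y' H' H0
  show "integrable M (tquad t)" by (rule integrable_lift_splt[OF s])
  have "lift (M \<Otimes>\<^sub>M M) (\<lambda>z. tfreq (fst z) + tfreq (snd z)) (\<lambda>z. (- \<i> * cdot (tfreq (snd z)) (tamp t (fst z))) *s tamp t (snd z)) = lift M tfreq (tquad t)"
    by (rule lift_splt[OF s])
  then show "advect (sol t) = lift M tfreq (tquad t)"
    unfolding advect_eq_advB sol_def advB_lift[OF *] .
qed

text \<open>As for the advection term, with \<open>Cub\<close> in place of \<open>Quad\<close> and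
  two successive splittings of the sequence.\<close>

lemma (in tree_sol)
  assumes small: "4 * K * N + 8 * K * N\<^sup>2 \<le> 1" and t: "0 < t"
  shows integrable_tcub: "integrable M (tcub t)" and cubic_sol: "cubic (sol t) = lift M tfreq (tcub t)"
proof -
  note ia = integrable_tamp[OF small less_imp_le[OF t]]
  note sf = sigma_finite_idx[OF prob]
  note * = sf sf sf tfreq_measurable tfreq_measurable tfreq_measurable ia ia ia
  let ?c = "\<lambda>(a, b, d). Cub a b d"
  let ?Y = "\<lambda>z. tfreq (fst z) - tfreq (fst (snd z)) + tfreq (snd (snd z))"
  let ?H = "\<lambda>z. hdot (tamp t (fst z)) (tamp t (fst (snd z))) *s tamp t (snd (snd z))"
  have c: "inj ?c" by (auto simp: inj_on_def)
  have iid: "inv (\<lambda>z::tree \<times> tree. z) = (\<lambda>z. z)" by (rule inv_equality) auto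
  have Y: "?Y \<in> borel_measurable (M \<Otimes>\<^sub>M (M \<Otimes>\<^sub>M M))" by measurable
  have Y': "tfreq p = ?Y (q, splt (\<lambda>z. z) r)" if "fst p \<in> range ?c" "splt ?c p = (q, r)" for p q r
    using that by (cases p) (auto simp: splt_def inv_Cub iid tfreq_def)
  have H': "tcub t p = ?H (q, splt (\<lambda>z. z) r)" if "fst p \<in> range ?c" "splt ?c p = (q, r)" for p q r
    using that by (cases p) (auto simp: splt_def inv_Cub iid tamp_def tcub_def cub_force_def)
  have H0: "tcub t p = 0" if "fst p \<notin> range ?c" for p
    using that by (cases p, cases "fst p") (auto simp: tcub_def cub_force_def image_iff)
  note s = prob c Y integrable_cubT[OF *] Y' H' H0
  show "integrable M (tcub t)" by (rule integrable_lift_splt3[OF s])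
  have "lift (M \<Otimes>\<^sub>M (M \<Otimes>\<^sub>M M)) ?Y ?H = lift M tfreq (tcub t)" by (rule lift_splt3[OF s])
  then show "cubic (sol t) = lift M tfreq (tcub t)"
    unfolding cubic_eq_cubT sol_def cubT_lift[OF *] .
qed

lemma (in tree_sol) tdot_eq:
  "tdot t p = - (symb \<alpha> \<Gamma>0 \<Gamma>2 (tfreq p) *\<^sub>R tamp t p) - \<beta> *\<^sub>R proj (tfreq p) (tcub t p) - lam0 *\<^sub>R proj (tfreq p) (tquad t p)"
  by (simp add: tdot_def force_def tfreq_def tcub_def tquad_def)

lemma (in tree_sol) FM_norm_sol_le:
  assumes small: "4 * K * N + 8 * K * N\<^sup>2 \<le> 1" and t: "0 \<le> t"
  shows "FM_norm (sol t) \<le> 2 * N * exp (- m * t)"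
proof -
  have "FM_norm (sol t) \<le> (\<integral>p. norm (tamp t p) \<partial>M)"
    unfolding sol_def by (rule FM_norm_lift_le[OF tfreq_measurable integrable_tamp[OF small t]])
  also have "\<dots> \<le> (\<integral>p. tweight p * exp (- m * t) \<partial>M)"
    by (rule integral_mono) (use integrable_tamp[OF small t] integrable_tweight[OF small] tamp_le[OF t] in auto)
  also have "\<dots> \<le> 2 * N * exp (- m * t)"
    using integral_tweight_le[OF small] by (simp add: mult_right_mono)
  finally show ?thesis .
qed

lemma (in tree_sol) sol_continuous:
  assumes small: "4 * K * N + 8 * K * N\<^sup>2 \<le> 1" and t: "0 \<le> t"
  shows "((\<lambda>s. FM_norm (\<lambda>x. sol s x - sol t x)) \<longlongrightarrow> 0) (at t within {0..})"
proof -
  note ia = integrable_tamp[OF small]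
  have e: "(\<lambda>x. sol s x - sol t x) = lift M tfreq (\<lambda>p. tamp s p - tamp t p)" if "0 \<le> s" for s
    unfolding sol_def by (intro ext lift_diff[symmetric] tfreq_measurable ia that t)
  have "((\<lambda>s. \<integral>p. norm (tamp s p - tamp t p) \<partial>M) \<longlongrightarrow> (\<integral>p. 0 \<partial>M)) (at t within {0..})"
  \<comment> \<open>Domination by the weights alone holds down to time 0, which gives continuity at
    the initial time without smoothing.\<close>
  proof (rule dominated_convergence_within[where d = 1 and w = "\<lambda>p. 2 * tweight p"])
    show "((\<lambda>s. norm (tamp s p - tamp t p)) \<longlongrightarrow> 0) (at t within {0..})" for p
      using has_vector_derivative_continuous[OF tamp_deriv[OF t, of p]]
      by (intro tendsto_norm_zero LIM_zero) (simp add: continuous_within)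
    have le: "norm (tamp s p) \<le> tweight p" if "0 \<le> s" for s p
      using tamp_le[OF that, of p] mult_left_mono[OF _ tweight_nonneg[of p], of "exp (- m * s)" 1] m that by simp
    show "norm (norm (tamp s p - tamp t p)) \<le> 2 * tweight p" if "s \<in> {0..}" for s p
      using norm_triangle_ineq4[of "tamp s p" "tamp t p"] le[of s p] le[of t p] that t by simp
    show "integrable M (\<lambda>p. 2 * tweight p)" using integrable_tweight[OF small] by simp
  qed simp_all
  then have lim: "((\<lambda>s. \<integral>p. norm (tamp s p - tamp t p) \<partial>M) \<longlongrightarrow> 0) (at t within {0..})" by simp
  show ?thesis
  proof (rule Lim_null_comparison[OF _ lim])
    show "\<forall>\<^sub>F s in at t within {0..}. norm (FM_norm (\<lambda>x. sol s x - sol t x)) \<le> (\<integral>p. norm (tamp s p - tamp t p) \<partial>M)"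
      unfolding eventually_at_filter
    proof (intro always_eventually allI impI)
      fix s :: real assume "s \<in> {0..}"
      then have s: "0 \<le> s" by simp
      have i: "integrable M (\<lambda>p. tamp s p - tamp t p)" using ia[OF s] ia[OF t] by simp
      show "norm (FM_norm (\<lambda>x. sol s x - sol t x)) \<le> (\<integral>p. norm (tamp s p - tamp t p) \<partial>M)"
        unfolding e[OF s]
        using FM_norm_lift_le[OF tfreq_measurable i] FM_norm_nonneg[OF lift_in_FM[OF tfreq_measurable i]] by simp
    qed
  qed
qed

text \<open>The equation holds for each tree separately by \<open>tdot_eq\<close>. What has to be
  shown is that the linear part, the nonlinear terms and the time derivative may be evaluated under
  the sum, which the smoothing for t > 0 allows.\<close>

lemma (in tree_sol) sol_evol:
  assumes small: "4 * K * N + 8 * K * N\<^sup>2 \<le> 1" and t: "0 < t"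
  shows "evol \<alpha> \<Gamma>0 \<Gamma>2 \<beta> lam0 sol t"
proof -
  note X = tfreq_measurable
  note ia = integrable_tamp[OF small]
  have t0: "0 \<le> t" using t by simp
  note i4 = integrable_tamp_pow4[OF small t]
  note iq = integrable_tquad[OF small t] and ic = integrable_tcub[OF small t]
  note iA = integrable_symb[OF X ia[OF t0] i4, of \<alpha> \<Gamma>0 \<Gamma>2]
  note ipq = integrable_proj[OF X iq] and ipc = integrable_proj[OF X ic]
  have idot: "integrable M (tdot t)"
    unfolding tdot_eq[abs_def] using iA ipq ipc by simp
  define u' where "u' = lift M tfreq (tdot t)"
  have "sol t \<in> FMs 4"
    unfolding sol_def by (rule lift_in_FMs[OF X ia[OF t0]]) (use i4 in \<open>simp add: powr_4\<close>)
  moreover have "u' \<in> FM" unfolding u'_def by (rule lift_in_FM[OF X idot])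
  moreover have "((\<lambda>h. FM_norm (\<lambda>x. (sol (t + h) x - sol t x) /\<^sub>R h - u' x)) \<longlongrightarrow> 0) (at 0)"
  proof -
    define q where "q h p = (tamp (t + h) p - tamp t p) /\<^sub>R h - tdot t p" for h p
    have e: "(\<lambda>x. (sol (t + h) x - sol t x) /\<^sub>R h - u' x) = lift M tfreq (q h)" and iqh: "integrable M (q h)"
      if "0 \<le> t + h" for h :: real
    proof -
      have d: "integrable M (\<lambda>p. tamp (t + h) p - tamp t p)" using ia[OF that] ia[OF t0] by simp
      have dh: "integrable M (\<lambda>p. (tamp (t + h) p - tamp t p) /\<^sub>R h)" using d by simp
      show "integrable M (q h)" unfolding q_def using dh idot by simp
      show "(\<lambda>x. (sol (t + h) x - sol t x) /\<^sub>R h - u' x) = lift M tfreq (q h)"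
        unfolding sol_def u'_def q_def[abs_def]
        by (intro ext) (simp only: lift_diff[OF X dh idot] lift_scaleR lift_diff[OF X ia[OF that] ia[OF t0]])
    qed
    have dm[measurable]: "tdot t \<in> borel_measurable M" using idot by simp
    have "((\<lambda>h. \<integral>p. norm (q h p) \<partial>M) \<longlongrightarrow> (\<integral>p. 0 \<partial>M)) (at 0)"
    proof (rule dominated_convergence_within[where d = "t / 2" and w = "\<lambda>p. slope (t / 2) * tweight p + norm (tdot t p)"])
      show "((\<lambda>h. norm (q h p)) \<longlongrightarrow> 0) (at 0)" for p
        unfolding q_def by (rule tendsto_norm_zero[OF tamp_quotient_tendsto[OF t]])
      show "norm (norm (q h p)) \<le> slope (t / 2) * tweight p + norm (tdot t p)" if "h \<noteq> 0" "\<bar>h - 0\<bar> < t / 2" for h p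
        unfolding q_def using norm_triangle_ineq4[of "(tamp (t + h) p - tamp t p) /\<^sub>R h" "tdot t p"] tamp_quotient_le[OF t, of h p] that by simp
      show "integrable M (\<lambda>p. slope (t / 2) * tweight p + norm (tdot t p))"
        using integrable_tweight[OF small] idot by simp
      show "(\<lambda>p. norm (q h p)) \<in> borel_measurable M" for h unfolding q_def by measurable
    qed (use t in simp_all)
    then have lim: "((\<lambda>h. \<integral>p. norm (q h p) \<partial>M) \<longlongrightarrow> 0) (at 0)" by simp
    show ?thesis
    proof (rule Lim_null_comparison[OF _ lim])
      show "\<forall>\<^sub>F h in at 0. norm (FM_norm (\<lambda>x. (sol (t + h) x - sol t x) /\<^sub>R h - u' x)) \<le> (\<integral>p. norm (q h p) \<partial>M)"
        unfolding eventually_at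
      proof (intro exI[of _ t] conjI ballI impI t)
        fix h :: real assume "h \<noteq> 0 \<and> dist h 0 < t"
        then have h: "0 \<le> t + h" by (auto simp: dist_real_def)
        show "norm (FM_norm (\<lambda>x. (sol (t + h) x - sol t x) /\<^sub>R h - u' x)) \<le> (\<integral>p. norm (q h p) \<partial>M)"
          unfolding e[OF h] using FM_norm_lift_le[OF X iqh[OF h]] FM_norm_nonneg[OF lift_in_FM[OF X iqh[OF h]]] by simp
      qed
    qed
  qed
  moreover have "u' x + A_d \<alpha> \<Gamma>0 \<Gamma>2 (sol t) x + \<beta> *\<^sub>R helmholtz (cubic (sol t)) x + lam0 *\<^sub>R helmholtz (advect (sol t)) x = 0" for x
  proof -
    have A: "A_d \<alpha> \<Gamma>0 \<Gamma>2 (sol t) = lift M tfreq (\<lambda>p. symb \<alpha> \<Gamma>0 \<Gamma>2 (tfreq p) *\<^sub>R tamp t p)"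
      unfolding sol_def by (rule A_d_lift[OF X ia[OF t0] i4])
    have C: "helmholtz (cubic (sol t)) = lift M tfreq (\<lambda>p. proj (tfreq p) (tcub t p))"
      unfolding cubic_sol[OF small t] by (rule helmholtz_lift[OF X ic])
    have Q: "helmholtz (advect (sol t)) = lift M tfreq (\<lambda>p. proj (tfreq p) (tquad t p))"
      unfolding advect_sol[OF small t] by (rule helmholtz_lift[OF X iq])
    have "lift M tfreq (\<lambda>p. tdot t p + symb \<alpha> \<Gamma>0 \<Gamma>2 (tfreq p) *\<^sub>R tamp t p + \<beta> *\<^sub>R proj (tfreq p) (tcub t p) + lam0 *\<^sub>R proj (tfreq p) (tquad t p)) x
        = u' x + A_d \<alpha> \<Gamma>0 \<Gamma>2 (sol t) x + \<beta> *\<^sub>R helmholtz (cubic (sol t)) x + lam0 *\<^sub>R helmholtz (advect (sol t)) x"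
      unfolding A C Q u'_def lift_scaleR[symmetric]
      using idot iA ipc ipq by (subst lift_add[OF X], simp, simp)+ simp
    moreover have "lift M tfreq (\<lambda>p. tdot t p + symb \<alpha> \<Gamma>0 \<Gamma>2 (tfreq p) *\<^sub>R tamp t p + \<beta> *\<^sub>R proj (tfreq p) (tcub t p) + lam0 *\<^sub>R proj (tfreq p) (tquad t p)) x = 0"
      by (simp add: tdot_eq lift_zero)
    ultimately show ?thesis by simp
  qed
  ultimately show ?thesis unfolding evol_def by blast
qed

theorem (in tree_sol) sol_strong:
  assumes small: "4 * K * N + 8 * K * N\<^sup>2 \<le> 1"
  shows "strong_sol FM0_sigma FM_norm \<alpha> \<Gamma>0 \<Gamma>2 \<beta> lam0 \<infinity> (fm_of \<nu> g) sol"
proof -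
  have sig: "sol t \<in> FM0_sigma" if "0 \<le> t" for t
  proof -
    have "lift M tfreq (\<lambda>p. proj (tfreq p) (tamp t p)) \<in> FM0_sigma"
      by (rule lift_in_FM0_sigma[OF tfreq_measurable integrable_proj[OF tfreq_measurable integrable_tamp[OF small that]]]) (rule proj_idem)
    moreover have "(\<lambda>p. proj (tfreq p) (tamp t p)) = tamp t"
      by (auto simp: fun_eq_iff tamp_def tfreq_def proj_amp[OF that])
    ultimately show ?thesis by (simp add: sol_def)
  qed
  show ?thesis
    unfolding strong_sol_def
    using sol_0[OF small] sig sol_continuous[OF small] sol_evol[OF small]
    by (simp add: evol_def atLeast_def)
qed

section \<open>Coercivity of the symbol and the two halves of the theorem\<close>

lemma symb_coercive:
  fixes \<Gamma>0 \<Gamma>2 \<alpha> :: real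
  assumes \<Gamma>2: "\<Gamma>2 > 0" and c: "(\<Gamma>0 < 0 \<and> 4 * \<alpha> > \<Gamma>0\<^sup>2 / \<Gamma>2) \<or> (\<Gamma>0 \<ge> 0 \<and> \<alpha> > 0)"
  shows "\<exists>m>0. \<forall>\<xi>::real^'n. 2 * m * (1 + norm \<xi>) \<le> symb \<alpha> \<Gamma>0 \<Gamma>2 \<xi>"
proof -
  \<comment> \<open>Here \<open>y\<close> stands for |\<xi>|^2; the comparison with 1 + y^2 retains
    the full quartic growth.\<close>
  have "\<exists>e>0. \<forall>y\<ge>0. e * (1 + y\<^sup>2) \<le> \<alpha> + \<Gamma>0 * y + \<Gamma>2 * y\<^sup>2"
    using c
  proof
    assume h: "\<Gamma>0 \<ge> 0 \<and> \<alpha> > 0"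
    define e where "e = min \<alpha> \<Gamma>2"
    have "e * (1 + y\<^sup>2) \<le> \<alpha> + \<Gamma>0 * y + \<Gamma>2 * y\<^sup>2" if "0 \<le> y" for y
    proof -
      have "e * 1 \<le> \<alpha>" "e * y\<^sup>2 \<le> \<Gamma>2 * y\<^sup>2" "0 \<le> \<Gamma>0 * y"
        using h that by (auto simp: e_def intro!: mult_right_mono)
      then show ?thesis by (simp add: distrib_left)
    qed
    then show ?thesis using h \<Gamma>2 by (intro exI[of _ e]) (auto simp: e_def)
  next
    assume h: "\<Gamma>0 < 0 \<and> 4 * \<alpha> > \<Gamma>0\<^sup>2 / \<Gamma>2"
    define D where "D = 4 * \<alpha> * \<Gamma>2 - \<Gamma>0\<^sup>2"
    have D: "0 < D" using h \<Gamma>2 by (simp add: D_def divide_less_eq)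
    have \<alpha>: "0 < \<alpha>" using h \<Gamma>2 zero_le_power2[of \<Gamma>0] by (smt (verit) divide_nonneg_pos)
    define S where "S = 4 * (\<alpha> + \<Gamma>2)"
    have S: "0 < S" using \<alpha> \<Gamma>2 by (simp add: S_def)
    \<comment> \<open>Lowering \<alpha> and \<Gamma>2 by \<open>e\<close> must leave the quadratic
      nonnegative. Now 4 (\<Gamma>2 - e) (\<alpha> - e) - \<Gamma>0^2 equals D - 4 (\<alpha> +
      \<Gamma>2) e + 4 e^2, and this \<open>e\<close> cancels the first two terms, so 4 e^2 > 0
      remains.\<close>
    define e where "e = D / S"
    have e: "0 < e" using D S by (simp add: e_def)
    have "S * e = D" using S by (simp add: e_def)
    then have eD: "4 * (\<alpha> + \<Gamma>2) * e = D" by (simp only: S_def)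
    have e2: "e < \<Gamma>2"
    proof -
      have "D \<le> 4 * \<alpha> * \<Gamma>2" by (simp add: D_def)
      also have "\<dots> < 4 * \<Gamma>2 * (\<alpha> + \<Gamma>2)" using \<Gamma>2 by (simp add: algebra_simps)
      finally have "4 * (\<alpha> + \<Gamma>2) * e < 4 * (\<alpha> + \<Gamma>2) * \<Gamma>2" unfolding eD by (simp add: mult_ac)
      then show ?thesis using \<alpha> \<Gamma>2 by simp
    qed
    have "e * (1 + y\<^sup>2) \<le> \<alpha> + \<Gamma>0 * y + \<Gamma>2 * y\<^sup>2" for y
    proof -
      have "0 \<le> (2 * (\<Gamma>2 - e) * y + \<Gamma>0)\<^sup>2 + 4 * e\<^sup>2" by simp
      also have "\<dots> = 4 * (\<Gamma>2 - e) * ((\<alpha> - e) + \<Gamma>0 * y + (\<Gamma>2 - e) * y\<^sup>2)"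
        using eD by (simp add: D_def power2_eq_square algebra_simps)
      finally have "0 \<le> (\<alpha> - e) + \<Gamma>0 * y + (\<Gamma>2 - e) * y\<^sup>2" using e2 by (simp add: zero_le_mult_iff)
      then show ?thesis by (simp add: algebra_simps)
    qed
    then show ?thesis using e by blast
  qed
  then obtain e where e: "0 < e" and le: "\<And>y. 0 \<le> y \<Longrightarrow> e * (1 + y\<^sup>2) \<le> \<alpha> + \<Gamma>0 * y + \<Gamma>2 * y\<^sup>2" by blast
  \<comment> \<open>The inequality 1 + x \<le> 2 (1 + x^4) loses a factor 2, and the 2 in front of
    \<open>m\<close> costs another one, hence e / 4.\<close>
  have "2 * (e / 4) * (1 + norm \<xi>) \<le> symb \<alpha> \<Gamma>0 \<Gamma>2 \<xi>" for \<xi> :: "real^'n"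
  proof -
    have "1 + norm \<xi> \<le> 2 * (1 + norm \<xi> ^ 4)"
      by (rule one_plus_le_pow4) simp
    then have "(e / 2) * (1 + norm \<xi>) \<le> (e / 2) * (2 * (1 + norm \<xi> ^ 4))" using e by (intro mult_left_mono) auto
    also have "\<dots> = e * (1 + ((norm \<xi>)\<^sup>2)\<^sup>2)" by (simp flip: power_mult)
    also have "\<dots> \<le> symb \<alpha> \<Gamma>0 \<Gamma>2 \<xi>"
      using le[of "(norm \<xi>)\<^sup>2"] by (simp add: symb_def flip: power_mult)
    finally show ?thesis by simp
  qed
  then show ?thesis using e by (intro exI[of _ "e / 4"]) auto
qed

theorem stability:
  fixes \<alpha> \<Gamma>0 \<Gamma>2 \<beta> lam0 :: real
  assumes \<Gamma>2: "\<Gamma>2 > 0" and c: "(\<Gamma>0 < 0 \<and> 4 * \<alpha> > \<Gamma>0\<^sup>2 / \<Gamma>2) \<or> (\<Gamma>0 \<ge> 0 \<and> \<alpha> > 0)"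
  shows "\<exists>\<kappa>>0. \<exists>C>0. \<exists>\<omega>>0. \<forall>u0 \<in> (FM0_sigma :: ('n::finite) vfield set). FM_norm u0 < \<kappa> \<longrightarrow>
         (\<exists>u. strong_sol FM0_sigma FM_norm \<alpha> \<Gamma>0 \<Gamma>2 \<beta> lam0 \<infinity> u0 u \<and>
              (\<forall>t\<ge>0. FM_norm (u t) \<le> C * exp (- \<omega> * t) * FM_norm u0))"
proof -
  obtain m where m: "0 < m" and sm: "\<And>\<xi>::real^'n. 2 * m * (1 + norm \<xi>) \<le> symb \<alpha> \<Gamma>0 \<Gamma>2 \<xi>"
    using symb_coercive[OF \<Gamma>2 c] by blast
  define k where "k = 2 * (\<bar>lam0\<bar> + \<bar>\<beta>\<bar>) / m"
  have k: "0 \<le> k" using m by (simp add: k_def)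
  \<comment> \<open>With N = 2 \<open>FM_norm u0\<close> this ensures N (12 k + 1) \<le> 1, which
    yields N \<le> 1 and then 4 k N + 8 k N^2 \<le> 12 k N \<le> 1.\<close>
  define \<kappa> where "\<kappa> = 1 / (2 * (12 * k + 1))"
  have \<kappa>: "0 < \<kappa>" using k by (simp add: \<kappa>_def)
  \<comment> \<open>The 4 is a product of two factors 2: one for the density bound after the
    projection, one for the sum of the majorant series, which is at most 2 N.\<close>
  have "\<exists>u. strong_sol FM0_sigma FM_norm \<alpha> \<Gamma>0 \<Gamma>2 \<beta> lam0 \<infinity> u0 u \<and>
              (\<forall>t\<ge>0. FM_norm (u t) \<le> 4 * exp (- m * t) * FM_norm u0)"
    if u0: "u0 \<in> FM0_sigma" "FM_norm u0 < \<kappa>" for u0 :: "'n vfield"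
  proof -
    obtain \<nu> g where r: "fm_rep \<nu> g" "prob_space \<nu>" "fm_of \<nu> g = u0" "\<And>\<xi>. norm (g \<xi>) \<le> 2 * FM_norm u0" "\<And>\<xi>. proj \<xi> (g \<xi>) = g \<xi>"
      using FM0_sigma_prob_rep[OF u0(1)] by blast
    note D = fm_repD[OF r(1)]
    have gm: "g \<in> borel_measurable borel"
      using borel_measurable_integrable[OF D(2)] measurable_cong_sets[OF D(3) refl] by blast
    define N where "N = 2 * FM_norm u0"
    interpret tree_sol \<alpha> \<Gamma>0 \<Gamma>2 \<beta> lam0 m N \<nu> g
      by (rule tree_sol.intro[OF r(2) D(3) gm r(4)[folded N_def] r(5) m sm])
    have Kk: "K = k" unfolding K_def k_def ..
    have N0: "0 \<le> N" by (rule N_nonneg)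
    have N1: "N * (12 * k + 1) \<le> 1" using u0(2) k by (simp add: N_def \<kappa>_def field_simps)
    have "N * 1 \<le> N * (12 * k + 1)" using N0 k by (intro mult_left_mono) auto
    then have "N \<le> 1" using N1 by simp
    then have "8 * k * N\<^sup>2 \<le> 8 * k * N" using N0 k by (intro mult_left_mono) (auto simp: power2_eq_square mult_left_le)
    then have small: "4 * k * N + 8 * k * N\<^sup>2 \<le> 1" using N1 N0 by (simp add: algebra_simps)
    note small' = small[folded Kk]
    show ?thesis
    proof (intro exI[of _ sol] conjI allI impI)
      show "strong_sol FM0_sigma FM_norm \<alpha> \<Gamma>0 \<Gamma>2 \<beta> lam0 \<infinity> u0 sol"
        using sol_strong[OF small'] unfolding r(3) .
      show "FM_norm (sol t) \<le> 4 * exp (- m * t) * FM_norm u0" if "0 \<le> t" for t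
        using FM_norm_sol_le[OF small' that] by (simp add: N_def mult.commute mult.left_commute)
    qed
  qed
  note main = this
  show ?thesis
    by (rule exI[of _ \<kappa>], rule conjI[OF \<kappa>], rule exI[of _ 4], rule conjI, simp, rule exI[of _ m], rule conjI[OF m],
        intro ballI impI, rule main)
qed

theorem theorem3p12:
  fixes \<alpha> \<Gamma>0 \<Gamma>2 \<beta> lam0 :: real
  assumes "CARD('n) \<in> {2, 3}" and "\<Gamma>2 > 0" and "\<beta> > 0"
  shows "(((\<Gamma>0 < 0 \<and> 4 * \<alpha> > \<Gamma>0\<^sup>2 / \<Gamma>2) \<or> (\<Gamma>0 \<ge> 0 \<and> \<alpha> > 0)) \<longrightarrow>
      (\<exists>\<kappa>>0. \<exists>C>0. \<exists>\<omega>>0. \<forall>u0 \<in> (FM0_sigma :: ('n::finite) vfield set). FM_norm u0 < \<kappa> \<longrightarrow>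
         (\<exists>u. strong_sol FM0_sigma FM_norm \<alpha> \<Gamma>0 \<Gamma>2 \<beta> lam0 \<infinity> u0 u \<and>
              (\<forall>t\<ge>0. FM_norm (u t) \<le> C * exp (- \<omega> * t) * FM_norm u0)))) \<and>
      (((\<Gamma>0 < 0 \<and> 4 * \<alpha> < \<Gamma>0\<^sup>2 / \<Gamma>2) \<or> (\<Gamma>0 \<ge> 0 \<and> \<alpha> < 0)) \<longrightarrow>
      (\<forall>\<gamma> \<in> {1/4..<1}. \<exists>\<epsilon>>0. \<forall>\<delta>>0.
         \<exists>u0 \<in> FMs (4 * \<gamma>) \<inter> (FM0_sigma :: ('n::finite) vfield set). FMs_norm (4 * \<gamma>) u0 < \<delta> \<and>
         \<not> (\<exists>u. strong_sol (FMs (4 * \<gamma>) \<inter> FM0_sigma) (FMs_norm (4 * \<gamma>))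
                   \<alpha> \<Gamma>0 \<Gamma>2 \<beta> lam0 \<infinity> u0 u \<and>
                 (\<forall>t\<ge>0. FMs_norm (4 * \<gamma>) (u t) < \<epsilon>))))"
proof (rule conjI; intro impI)
  assume "(\<Gamma>0 < 0 \<and> 4 * \<alpha> > \<Gamma>0\<^sup>2 / \<Gamma>2) \<or> (\<Gamma>0 \<ge> 0 \<and> \<alpha> > 0)"
  from stability[OF assms(2) this]
  show "\<exists>\<kappa>>0. \<exists>C>0. \<exists>\<omega>>0. \<forall>u0 \<in> (FM0_sigma :: ('n::finite) vfield set). FM_norm u0 < \<kappa> \<longrightarrow>
         (\<exists>u. strong_sol FM0_sigma FM_norm \<alpha> \<Gamma>0 \<Gamma>2 \<beta> lam0 \<infinity> u0 u \<and>
              (\<forall>t\<ge>0. FM_norm (u t) \<le> C * exp (- \<omega> * t) * FM_norm u0))" .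
next
  assume c: "(\<Gamma>0 < 0 \<and> 4 * \<alpha> < \<Gamma>0\<^sup>2 / \<Gamma>2) \<or> (\<Gamma>0 \<ge> 0 \<and> \<alpha> < 0)"
  show "\<forall>\<gamma> \<in> {1/4..<1}. \<exists>\<epsilon>>0. \<forall>\<delta>>0.
         \<exists>u0 \<in> FMs (4 * \<gamma>) \<inter> (FM0_sigma :: ('n::finite) vfield set). FMs_norm (4 * \<gamma>) u0 < \<delta> \<and>
         \<not> (\<exists>u. strong_sol (FMs (4 * \<gamma>) \<inter> FM0_sigma) (FMs_norm (4 * \<gamma>))
                   \<alpha> \<Gamma>0 \<Gamma>2 \<beta> lam0 \<infinity> u0 u \<and>
                 (\<forall>t\<ge>0. FMs_norm (4 * \<gamma>) (u t) < \<epsilon>))"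
  proof
    fix \<gamma> :: real assume "\<gamma> \<in> {1/4..<1}"
    then have s: "1 \<le> 4 * \<gamma>" by simp
    have "2 \<le> CARD('n)" using assms(1) by auto
    from instability[OF this assms(2,3) c s]
    show "\<exists>\<epsilon>>0. \<forall>\<delta>>0.
         \<exists>u0 \<in> FMs (4 * \<gamma>) \<inter> (FM0_sigma :: ('n::finite) vfield set). FMs_norm (4 * \<gamma>) u0 < \<delta> \<and>
         \<not> (\<exists>u. strong_sol (FMs (4 * \<gamma>) \<inter> FM0_sigma) (FMs_norm (4 * \<gamma>))
                   \<alpha> \<Gamma>0 \<Gamma>2 \<beta> lam0 \<infinity> u0 u \<and>
                 (\<forall>t\<ge>0. FMs_norm (4 * \<gamma>) (u t) < \<epsilon>))" .
  qed
qed


end
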